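(* Let $d \geq 3$ be an integer, $g = \lfloor (d-1)/2\rfloor$, let $\alpha_1,\dots,\alpha_d$ be transcendental and independent over $\mathbb{C}$, let $K$ be the field generated over $\mathbb{C}$ by the symmetric functions of the $\alpha_i$'s, let $J$ be the Jacobian of the hyperelliptic curve over $K$ given by $y^2 = \prod_{i=1}^d(x-\alpha_i)$, and let $K_1 = K(J[2])$ and $K_2 = K(J[4])$. For $1 \leq i,j\leq 2g+1$ with $i \neq j$, let $\gamma_{i,j} = \alpha_j-\alpha_i$ if $d=2g+1$, and $\gamma_{i,j} = (\alpha_j-\alpha_i)\prod_{l\neq i,j}(\alpha_d-\alpha_l)$, with $l$ ranging over $\{1,\dots,2g+1\}\setminus\{i,j\}$, if $d = 2g+2$. Then $$K_2 = K_1(\{\sqrt{\gamma_{i,j}}\}_{1\leq i<j\leq 2g+1}).$$ Moreover, any Galois automorphism in $G_K = \mathrm{Gal}(\bar K/K)$ which acts as multiplication by $-1$ on the subgroup $J[4]$ acts on $K_2$ by fixing $K_1$ and changing the signs of all generators $\sqrt{\gamma_{i,j}}$.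
   Context: $\bar K$ is an algebraic closure of $K$. The hyperelliptic curve means the smooth projective curve with the given affine equation, of genus $g$. $J[m]\subset J(\bar K)$ is the $m$-torsion subgroup and $K(J[m])$ is the field generated over $K$ by the coordinates of its points. $\sqrt{a}$ denotes any fixed choice of square root of $a$ in $\bar K$. *)

theory Defs
  imports
    "HOL-Algebra.Coset"
    "HOL-Computational_Algebra.Polynomial"
    "HOL-Library.Poly_Mapping"
    Complex_Main
begin

section \<open>Fields, polynomials and algebraic independence\<close>

definition field_hom :: "('a::field \<Rightarrow> 'b::field) \<Rightarrow> bool" where
  "field_hom h \<longleftrightarrow> h 1 = 1 \<and> (\<forall>a b. h (a + b) = h a + h b) \<and> (\<forall>a b. h (a * b) = h a * h b)"

definition is_subfield :: "'a::field set \<Rightarrow> bool" where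
  "is_subfield F \<longleftrightarrow> 0 \<in> F \<and> 1 \<in> F \<and>
     (\<forall>a\<in>F. \<forall>b\<in>F. a - b \<in> F \<and> a * b \<in> F) \<and> (\<forall>a\<in>F. inverse a \<in> F)"

definition field_gen :: "'a::field set \<Rightarrow> 'a set" where
  "field_gen S = is_subfield hull S"

definition is_algebraic_over :: "'a::field set \<Rightarrow> 'a \<Rightarrow> bool" where
  "is_algebraic_over K a \<longleftrightarrow> (\<exists>p. p \<noteq> 0 \<and> (\<forall>i. coeff p i \<in> K) \<and> poly p a = 0)"

text \<open>The absolute Galois group of \<open>K\<close>, for \<open>K\<close> a subfield of an algebraic closure \<open>'a\<close> of \<open>K\<close>.\<close>

definition galois_group :: "'a::field set \<Rightarrow> ('a \<Rightarrow> 'a) set" where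
  "galois_group K = {\<sigma>. field_hom \<sigma> \<and> bij \<sigma> \<and> (\<forall>a\<in>K. \<sigma> a = a)}"

text \<open>Polynomials over \<open>'c\<close> in variables indexed by \<open>'v\<close>: finitely supported families of
  coefficients, indexed by exponent vectors.\<close>

type_synonym ('v, 'c) mpoly = "('v \<Rightarrow>\<^sub>0 nat) \<Rightarrow>\<^sub>0 'c"

definition mpoly_vars :: "('v, 'c::zero) mpoly \<Rightarrow> 'v set" where
  "mpoly_vars P = (\<Union>m\<in>Poly_Mapping.keys P. Poly_Mapping.keys m)"

text \<open>Evaluation at \<open>z\<close>, with the coefficients mapped by \<open>h\<close>.\<close>

definition mpoly_eval :: "('c::zero \<Rightarrow> 'a::field) \<Rightarrow> ('v \<Rightarrow> 'a) \<Rightarrow> ('v, 'c) mpoly \<Rightarrow> 'a" where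
  "mpoly_eval h z P =
     (\<Sum>m\<in>Poly_Mapping.keys P. h (Poly_Mapping.lookup P m) *
        (\<Prod>v\<in>Poly_Mapping.keys m. z v ^ Poly_Mapping.lookup m v))"

text \<open>Homogeneity of degree \<open>n\<close> in the variables from \<open>V\<close>; the others may occur arbitrarily.\<close>

definition homogeneous_in :: "'v set \<Rightarrow> nat \<Rightarrow> ('v, 'c::zero) mpoly \<Rightarrow> bool" where
  "homogeneous_in V n P \<longleftrightarrow>
     (\<forall>m\<in>Poly_Mapping.keys P. (\<Sum>v\<in>Poly_Mapping.keys m \<inter> V. Poly_Mapping.lookup m v) = n)"

definition alg_independent :: "('c::field \<Rightarrow> 'a::field) \<Rightarrow> ('i \<Rightarrow> 'a) \<Rightarrow> 'i set \<Rightarrow> bool" where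
  "alg_independent h \<alpha> I \<longleftrightarrow> (\<forall>P. mpoly_vars P \<subseteq> I \<and> mpoly_eval h \<alpha> P = 0 \<longrightarrow> P = 0)"

definition elem_sym :: "(nat \<Rightarrow> 'a::field) \<Rightarrow> nat \<Rightarrow> nat \<Rightarrow> 'a" where
  "elem_sym \<alpha> d k = (\<Sum>S | S \<subseteq> {1..d} \<and> card S = k. \<Prod>i\<in>S. \<alpha> i)"

definition sym_field :: "(complex \<Rightarrow> 'a::field) \<Rightarrow> (nat \<Rightarrow> 'a) \<Rightarrow> nat \<Rightarrow> 'a set" where
  "sym_field \<iota> \<alpha> d = field_gen (range \<iota> \<union> elem_sym \<alpha> d ` {..d})"

section \<open>The curve, its divisors and the points of its Jacobian\<close>

text \<open>\<open>'f\<close> is the function field over \<open>'a\<close> of the smooth projective curve with affine equation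
  \<open>y\<^sup>2 = f(x)\<close>; here \<open>emb\<close> embeds the constants.\<close>

definition curve_function_field ::
    "'a::field poly \<Rightarrow> ('a \<Rightarrow> 'f::field) \<Rightarrow> 'f \<Rightarrow> 'f \<Rightarrow> bool" where
  "curve_function_field f emb x y \<longleftrightarrow>
     field_hom emb \<and>
     (\<forall>p. poly (map_poly emb p) x = 0 \<longrightarrow> p = 0) \<and>
     y ^ 2 = poly (map_poly emb f) x \<and>
     field_gen (range emb \<union> {x, y}) = UNIV"

text \<open>Over an algebraically closed field of constants, the points of the smooth projective curve with
  function field \<open>'f\<close> are the normalised discrete valuations of \<open>'f\<close> that are trivial on constants;
  all points have degree 1. The value at \<open>0\<close>, which should be infinite, is set to the dummy value \<open>0\<close>
  so that equality of valuations is equality of functions.\<close>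

definition points :: "('a::field \<Rightarrow> 'f::field) \<Rightarrow> ('f \<Rightarrow> int) set" where
  "points emb = {v. v 0 = 0 \<and>
     (\<forall>h k. h \<noteq> 0 \<and> k \<noteq> 0 \<longrightarrow> v (h * k) = v h + v k) \<and>
     (\<forall>h k. h \<noteq> 0 \<and> k \<noteq> 0 \<and> h + k \<noteq> 0 \<longrightarrow> min (v h) (v k) \<le> v (h + k)) \<and>
     (\<forall>a. v (emb a) = 0) \<and>
     (\<exists>t. t \<noteq> 0 \<and> v t = 1)}"

type_synonym 'f divisor = "('f \<Rightarrow> int) \<Rightarrow>\<^sub>0 int"

definition div_degree :: "'f divisor \<Rightarrow> int" where
  "div_degree D = (\<Sum>v\<in>Poly_Mapping.keys D. Poly_Mapping.lookup D v)"

definition div0_group :: "('a::field \<Rightarrow> 'f::field) \<Rightarrow> 'f divisor monoid" where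
  "div0_group emb =
     \<lparr>carrier = {D. Poly_Mapping.keys D \<subseteq> points emb \<and> div_degree D = 0}, monoid.mult = (+), one = 0\<rparr>"

definition principal_divisors :: "('a::field \<Rightarrow> 'f::field) \<Rightarrow> 'f divisor set" where
  "principal_divisors emb =
     {D \<in> carrier (div0_group emb). \<exists>h. h \<noteq> 0 \<and> (\<forall>v\<in>points emb. Poly_Mapping.lookup D v = v h)}"

definition jacobian :: "('a::field \<Rightarrow> 'f::field) \<Rightarrow> 'f divisor set monoid" where
  "jacobian emb = div0_group emb Mod principal_divisors emb"

definition div_class :: "('a::field \<Rightarrow> 'f::field) \<Rightarrow> 'f divisor \<Rightarrow> 'f divisor set" where
  "div_class emb D = principal_divisors emb #>\<^bsub>div0_group emb\<^esub> D"

definition torsion :: "('a::field \<Rightarrow> 'f::field) \<Rightarrow> nat \<Rightarrow> 'f divisor set set" where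
  "torsion emb m =
     {P \<in> carrier (jacobian emb). P [^]\<^bsub>jacobian emb\<^esub> m = \<one>\<^bsub>jacobian emb\<^esub>}"

text \<open>An automorphism \<open>\<sigma>\<close> of the constants fixing the coefficients of the curve extends uniquely to an
  automorphism \<open>\<tau>\<close> of the function field fixing \<open>x\<close> and \<open>y\<close>. It sends the point \<open>v\<close> to
  \<open>v \<circ> \<tau>\<^sup>-\<^sup>1\<close> (so an affine point \<open>(a, b)\<close> to \<open>(\<sigma> a, \<sigma> b)\<close>); consequently the multiplicity of
  \<open>v\<close> in the image of a divisor \<open>D\<close> is that of \<open>v \<circ> \<tau>\<close> in \<open>D\<close>.\<close>

definition extend_aut :: "('a::field \<Rightarrow> 'f::field) \<Rightarrow> 'f \<Rightarrow> 'f \<Rightarrow> ('a \<Rightarrow> 'a) \<Rightarrow> 'f \<Rightarrow> 'f" where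
  "extend_aut emb x y \<sigma> =
     (THE \<tau>. field_hom \<tau> \<and> bij \<tau> \<and> (\<forall>a. \<tau> (emb a) = emb (\<sigma> a)) \<and> \<tau> x = x \<and> \<tau> y = y)"

definition galois_act ::
    "('a::field \<Rightarrow> 'f::field) \<Rightarrow> 'f \<Rightarrow> 'f \<Rightarrow> ('a \<Rightarrow> 'a) \<Rightarrow> 'f divisor set \<Rightarrow> 'f divisor set" where
  "galois_act emb x y \<sigma> P = Poly_Mapping.map_key (\<lambda>v. v \<circ> extend_aut emb x y \<sigma>) ` P"

section \<open>The Jacobian as a projective variety, and its division fields\<close>

definition proj_nonzero :: "nat \<Rightarrow> (nat \<Rightarrow> 'a::field) \<Rightarrow> bool" where
  "proj_nonzero N p \<longleftrightarrow> (\<exists>i\<le>N. p i \<noteq> 0)"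

definition proj_eq :: "nat \<Rightarrow> (nat \<Rightarrow> 'a::field) \<Rightarrow> (nat \<Rightarrow> 'a) \<Rightarrow> bool" where
  "proj_eq N p q \<longleftrightarrow> (\<exists>c. c \<noteq> 0 \<and> (\<forall>i\<le>N. p i = c * q i))"

text \<open>The set of points of projective \<open>N\<close>-space represented by values of \<open>\<phi>\<close> on \<open>J\<close> is closed and
  defined by equations over \<open>K\<close>.\<close>

definition proj_closed_over :: "'a::field set \<Rightarrow> nat \<Rightarrow> ('p \<Rightarrow> nat \<Rightarrow> 'a) \<Rightarrow> 'p set \<Rightarrow> bool" where
  "proj_closed_over K N \<phi> J \<longleftrightarrow>
     (\<exists>S :: (nat, 'a) mpoly set.
        (\<forall>F\<in>S. mpoly_vars F \<subseteq> {..N} \<and> (\<exists>n. homogeneous_in {..N} n F) \<and>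
                (\<forall>m. Poly_Mapping.lookup F m \<in> K)) \<and>
        (\<forall>p. proj_nonzero N p \<longrightarrow>
           ((\<forall>F\<in>S. mpoly_eval id p F = 0) \<longleftrightarrow> (\<exists>P\<in>J. proj_eq N p (\<phi> P)))))"

text \<open>The map from the curve to projective space given by \<open>\<psi>\<close> is a morphism: it is given by functions
  \<open>h 0, \<dots>, h N\<close>, rescaled at each point \<open>v\<close> by some \<open>t\<close> such that all \<open>t * h i\<close> are regular at \<open>v\<close>
  with values \<open>\<psi> v i\<close> that are not all zero.\<close>

definition curve_morphism ::
    "('a::field \<Rightarrow> 'f::field) \<Rightarrow> nat \<Rightarrow> (('f \<Rightarrow> int) \<Rightarrow> nat \<Rightarrow> 'a) \<Rightarrow> bool" where
  "curve_morphism emb N \<psi> \<longleftrightarrow>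
     (\<exists>h :: nat \<Rightarrow> 'f. \<forall>v\<in>points emb. proj_nonzero N (\<psi> v) \<and>
        (\<exists>t. t \<noteq> 0 \<and> (\<forall>i\<le>N. let w = t * h i - emb (\<psi> v i) in w = 0 \<or> v w > 0)))"

text \<open>A binary operation on the points of a projective variety (with coordinates \<open>\<phi>\<close>) is a morphism:
  it is given locally by bihomogeneous polynomials.\<close>

definition proj_morphism2 :: "nat \<Rightarrow> ('p \<Rightarrow> nat \<Rightarrow> 'a::field) \<Rightarrow> 'p set \<Rightarrow> ('p \<Rightarrow> 'p \<Rightarrow> 'p) \<Rightarrow> bool" where
  "proj_morphism2 N \<phi> J \<mu> \<longleftrightarrow>
     (\<forall>P\<in>J. \<forall>Q\<in>J. \<exists>(F :: nat \<Rightarrow> (nat + nat, 'a) mpoly) m n.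
        (\<forall>i\<le>N. mpoly_vars (F i) \<subseteq> Inl ` {..N} \<union> Inr ` {..N} \<and>
                homogeneous_in (range Inl) m (F i) \<and> homogeneous_in (range Inr) n (F i)) \<and>
        proj_nonzero N (\<lambda>i. mpoly_eval id (case_sum (\<phi> P) (\<phi> Q)) (F i)) \<and>
        (\<forall>P'\<in>J. \<forall>Q'\<in>J.
           proj_nonzero N (\<lambda>i. mpoly_eval id (case_sum (\<phi> P') (\<phi> Q')) (F i)) \<longrightarrow>
           proj_eq N (\<lambda>i. mpoly_eval id (case_sum (\<phi> P') (\<phi> Q')) (F i)) (\<phi> (\<mu> P' Q'))))"

text \<open>\<open>\<phi>\<close> assigns homogeneous coordinates in projective \<open>N\<close>-space to the degree zero divisor classes,
  and thereby realises the Jacobian as a projective variety over \<open>K\<close>: its image is a closed subvariety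
  over \<open>K\<close>, the Galois action on classes is the action on coordinates, the group law is algebraic, and
  the Abel-Jacobi maps are morphisms. By the Albanese property these conditions determine the
  variety with its group law up to isomorphism over \<open>K\<close>.\<close>

definition projective_jacobian ::
    "'a::field set \<Rightarrow> ('a \<Rightarrow> 'f::field) \<Rightarrow> 'f \<Rightarrow> 'f \<Rightarrow> nat \<Rightarrow> ('f divisor set \<Rightarrow> nat \<Rightarrow> 'a) \<Rightarrow> bool" where
  "projective_jacobian K emb x y N \<phi> \<longleftrightarrow>
     (let J = jacobian emb in
       (\<forall>P\<in>carrier J. proj_nonzero N (\<phi> P)) \<and>
       (\<forall>P\<in>carrier J. \<forall>Q\<in>carrier J. proj_eq N (\<phi> P) (\<phi> Q) \<longrightarrow> P = Q) \<and>
       proj_closed_over K N \<phi> (carrier J) \<and>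
       (\<forall>\<sigma>\<in>galois_group K. \<forall>P\<in>carrier J.
          proj_eq N (\<phi> (galois_act emb x y \<sigma> P)) (\<lambda>i. \<sigma> (\<phi> P i))) \<and>
       proj_morphism2 N \<phi> (carrier J) (\<lambda>P Q. P \<otimes>\<^bsub>J\<^esub> inv\<^bsub>J\<^esub> Q) \<and>
       (\<forall>q\<in>points emb. curve_morphism emb N
          (\<lambda>p. \<phi> (div_class emb (Poly_Mapping.single p 1 - Poly_Mapping.single q 1)))))"

text \<open>The field generated over \<open>K\<close> by the coordinates of the points in \<open>T\<close>; coordinates of a point of
  projective space are defined up to a common factor, so the generators are their ratios.\<close>

definition coord_field :: "'a::field set \<Rightarrow> nat \<Rightarrow> ('p \<Rightarrow> nat \<Rightarrow> 'a) \<Rightarrow> 'p set \<Rightarrow> 'a set" where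
  "coord_field K N \<phi> T =
     field_gen (K \<union> {\<phi> P i / \<phi> P j | P i j. P \<in> T \<and> i \<le> N \<and> j \<le> N \<and> \<phi> P j \<noteq> 0})"

section \<open>The elements under the square roots\<close>

definition genus :: "nat \<Rightarrow> nat" where
  "genus d = (d - 1) div 2"

definition \<gamma> :: "nat \<Rightarrow> (nat \<Rightarrow> 'a::field) \<Rightarrow> nat \<Rightarrow> nat \<Rightarrow> 'a" where
  "\<gamma> d \<alpha> i j =
     (if d = 2 * genus d + 1 then \<alpha> j - \<alpha> i
      else (\<alpha> j - \<alpha> i) * (\<Prod>l\<in>{1..2 * genus d + 1} - {i, j}. \<alpha> d - \<alpha> l))"

end

(* Both fields contain K, so by Galois theory it suffices to compare the automorphisms fixing them; as
   the coordinates are Galois equivariant, this means: if sigma fixes J[2], then it fixes J[4] iff it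
   fixes all square roots of the gamma_ij.

   Moving a Weierstrass point to infinity, the curve becomes y^2 = prod (x - b_i) of odd degree with
   b_j - b_i = gamma_ij. Trivial action on J[2] forces sigma to fix the b_i (for d = 4 only up to a
   translation, which acts trivially on J). Let e_i be the point over b_i. By Hilbert 90, J[2] consists of the
   sums over subsets of the classes e_i - oo. By Tsen's theorem x - b_i is a norm up to squares, so there are
   divisors Q with 2 Q = e_i - oo + div k. Then 2 (sigma Q - Q) = div (sigma k / k), and Hilbert 90 expresses the
   class sigma Q - Q through the values (+1 or -1) at the Weierstrass points of a normalisation of
   sigma k / k to norm 1. At e_j this value is sigma(s) / s with s^2 = b_j - b_i, at oo it is 1. *)
theory Submission
  imports Defs "HOL-Computational_Algebra.Formal_Laurent_Series"
begin

section \<open>Homomorphisms of fields and the function field\<close>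

text \<open>The coordinates in projective space serve only to say which automorphisms fix the
  division fields; all else happens with divisor classes. Points, degree zero divisors and principal
  divisors depend on \<open>emb\<close> alone, so every coordinate system of the one function field
  shares them. The obstacle is that the Galois action is defined through the original
  \<open>x\<close> and \<open>y\<close>, while the computation of \<open>sigma Q - Q\<close> needs
  an automorphism fixing the coordinates of the odd model. Trivial action on \<open>J[2]\<close>
  only says that each pair of branch points \<open>{i, d}\<close> is sent to itself or to its
  complement. With four branch points this leaves the double transpositions; there the two
  automorphisms differ by a translation of an elliptic curve, a product of the hyperelliptic
  involutions of two different double covers of the line, each acting as -1. Two signs need care. A
  function of norm 1 is normalised only up to sign, and value 1 at infinity selects the sign that
  yields subsets of even size. At infinity a comparison with a uniformizer negated by the involution
  produces a constant with square -1, harmless because \<open>K\<close> contains the image of the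
  imaginary unit.\<close>

locale fld_hom =
  fixes h :: "'a::field \<Rightarrow> 'b::field"
  assumes hom: "field_hom h"
begin

lemma one [simp]: "h 1 = 1"
  and add [simp]: "h (a + b) = h a + h b"
  and mult [simp]: "h (a * b) = h a * h b"
  using hom by (auto simp: field_hom_def)

lemma zero [simp]: "h 0 = 0"
  using add[of 0 0] by (metis add_0_right add_left_cancel)

lemma uminus [simp]: "h (- a) = - h a"
  using add[of a "- a"] by (simp add: eq_neg_iff_add_eq_0 add.commute)

lemma diff [simp]: "h (a - b) = h a - h b"
  using add[of a "- b"] by simp

lemma eq_0_iff [simp]: "h a = 0 \<longleftrightarrow> a = 0"
proof
  assume "h a = 0"
  then have "h (a * inverse a) = 0" by (simp only: mult mult_zero_left)
  then show "a = 0" by (cases "a = 0") auto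
qed simp

lemma eq_iff [simp]: "h a = h b \<longleftrightarrow> a = b"
  using eq_0_iff[of "a - b"] by (simp del: eq_0_iff)

lemma inj: "inj h"
  by (simp add: inj_on_def)

lemma inverse [simp]: "h (inverse a) = inverse (h a)"
proof (cases "a = 0")
  case False
  then have "h a * h (inverse a) = 1" by (simp flip: mult)
  then show ?thesis by (metis inverse_unique)
qed simp

lemma divide [simp]: "h (a / b) = h a / h b"
  by (simp add: divide_inverse)

lemma power [simp]: "h (a ^ n) = h a ^ n"
  by (induction n) auto

lemma sum [simp]: "h (sum g A) = (\<Sum>i\<in>A. h (g i))"
  by (induction A rule: infinite_finite_induct) auto

lemma prod [simp]: "h (prod g A) = (\<Prod>i\<in>A. h (g i))"
  by (induction A rule: infinite_finite_induct) auto

lemma numeral [simp]: "h (numeral n) = numeral n"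
proof -
  have "h (of_nat k) = of_nat k" for k by (induction k) auto
  from this[of "numeral n"] show ?thesis by simp
qed

lemma mp_coeff [simp]: "coeff (map_poly h p) n = h (coeff p n)"
  by (simp add: coeff_map_poly)

lemma mp_add [simp]: "map_poly h (p + q) = map_poly h p + map_poly h q"
  by (rule poly_eqI) simp

lemma mp_diff [simp]: "map_poly h (p - q) = map_poly h p - map_poly h q"
  by (rule poly_eqI) simp

lemma mp_mult [simp]: "map_poly h (p * q) = map_poly h p * map_poly h q"
  by (rule poly_eqI) (simp add: coeff_mult)

lemma mp_pCons [simp]: "map_poly h (pCons a p) = pCons (h a) (map_poly h p)"
  by (rule map_poly_pCons) simp

lemma mp_one [simp]: "map_poly h 1 = 1"
  by (simp add: one_pCons)

lemma mp_prod [simp]: "map_poly h (prod g A) = (\<Prod>i\<in>A. map_poly h (g i))"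
  by (induction A rule: infinite_finite_induct) auto

lemma mp_smult [simp]: "map_poly h (smult c p) = smult (h c) (map_poly h p)"
  by (rule poly_eqI) simp

lemma poly_mp: "poly (map_poly h p) (h a) = h (poly p a)"
  by (induction p) auto

lemma mp_eq_0_iff [simp]: "map_poly h p = 0 \<longleftrightarrow> p = 0"
  by (rule map_poly_eq_0_iff) auto

end

section \<open>Generated subfields and homomorphisms determined on generators\<close>

lemma is_subfield_field_gen: "is_subfield (field_gen S)"
  unfolding field_gen_def by (rule hull_in) (auto simp: is_subfield_def)

lemma field_gen_subset: "S \<subseteq> field_gen S"
  unfolding field_gen_def by (rule hull_subset)

lemma field_gen_minimal: "S \<subseteq> T \<Longrightarrow> is_subfield T \<Longrightarrow> field_gen S \<subseteq> T"
  unfolding field_gen_def by (rule hull_minimal)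

lemma field_hom_fixed_subfield:
  assumes "field_hom \<sigma>"
  shows "is_subfield {a. \<sigma> a = a}"
proof -
  interpret fld_hom \<sigma> by unfold_locales fact
  show ?thesis by (auto simp: is_subfield_def)
qed

lemma field_hom_eq_on_gen:
  assumes "field_hom \<sigma>" "field_hom \<tau>" "\<And>a. a \<in> S \<Longrightarrow> \<sigma> a = \<tau> a" "field_gen S = UNIV"
  shows "\<sigma> = \<tau>"
proof -
  interpret s: fld_hom \<sigma> by unfold_locales fact
  interpret t: fld_hom \<tau> by unfold_locales fact
  have "is_subfield {a. \<sigma> a = \<tau> a}"
    by (auto simp: is_subfield_def)
  then have "field_gen S \<subseteq> {a. \<sigma> a = \<tau> a}"
    using assms(3) by (intro field_gen_minimal) auto
  then show ?thesis using assms(4) by auto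
qed

text \<open>Over algebraically closed constants a nonzero polynomial splits into factors
  \<open>X - c\<close>, none of which vanishes outside the image of \<open>s\<close>. Transcendence
  of a new coordinate thereby reduces to its not being constant.\<close>

lemma field_hom_transcendental:
  fixes s :: "'a::alg_closed_field \<Rightarrow> 'g::field"
  assumes "field_hom s" "z \<notin> range s" "poly (map_poly s p) z = 0"
  shows "p = 0"
proof (rule ccontr)
  interpret fld_hom s by unfold_locales fact
  assume "p \<noteq> 0"
  then show False using assms(3)
  proof (induction "degree p" arbitrary: p)
    case 0
    then obtain c where "p = [:c:]" by (metis degree_eq_zeroE)
    then show ?case using 0 by auto
  next
    case (Suc n)
    then obtain c where "poly p c = 0" using alg_closed_imp_poly_has_root[of p] by auto
    then obtain q where q: "p = [:- c, 1:] * q" by (metis poly_eq_0_iff_dvd dvdE)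
    have "poly (map_poly s [:- c, 1:]) z * poly (map_poly s q) z = 0"
      using Suc.prems(2) unfolding q by (simp only: mp_mult poly_mult)
    moreover have "poly (map_poly s [:- c, 1:]) z \<noteq> 0"
      using assms(2) by (auto simp: algebra_simps)
    ultimately have "poly (map_poly s q) z = 0" by simp
    moreover have "q \<noteq> 0" using Suc.prems(1) q by auto
    moreover have "degree q = n"
      using Suc.hyps(2) \<open>q \<noteq> 0\<close> unfolding q by (subst (asm) degree_mult_eq) auto
    ultimately show ?case using Suc.hyps(1)[of q] by auto
  qed
qed

text \<open>\<open>nonsquare\<close> keeps \<open>y\<close> out of the rational functions in
  \<open>x\<close>: the function field is a quadratic extension with basis \<open>1\<close>,
  \<open>y\<close>, so the numerators \<open>p\<close> and \<open>q\<close> over a given denominator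
  are unique.\<close>

locale func_field =
  fixes f :: "'a::field poly" and emb :: "'a \<Rightarrow> 'f::field" and x y :: 'f
  assumes cff: "curve_function_field f emb x y"
    and nonsquare: "\<And>p q. p ^ 2 = q ^ 2 * f \<Longrightarrow> q = 0"
begin

sublocale emb: fld_hom emb
  using cff by unfold_locales (simp add: curve_function_field_def)

definition ev :: "'a poly \<Rightarrow> 'f" where
  "ev p = poly (map_poly emb p) x"

lemma ev_add [simp]: "ev (p + q) = ev p + ev q"
  and ev_diff [simp]: "ev (p - q) = ev p - ev q"
  and ev_mult [simp]: "ev (p * q) = ev p * ev q"
  and ev_0 [simp]: "ev 0 = 0"
  and ev_1 [simp]: "ev 1 = 1"
  and ev_pCons [simp]: "ev (pCons c p) = emb c + x * ev p"
  by (simp_all add: ev_def)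

lemma ev_power [simp]: "ev (p ^ n) = ev p ^ n"
  by (induction n) auto

lemma ev_prod [simp]: "ev (prod g A) = (\<Prod>i\<in>A. ev (g i))"
  by (induction A rule: infinite_finite_induct) auto

lemma ev_smult [simp]: "ev (smult c p) = emb c * ev p"
  by (simp add: ev_def)

lemma ev_eq_0_iff [simp]: "ev p = 0 \<longleftrightarrow> p = 0"
  using cff by (auto simp: ev_def curve_function_field_def)

lemma ev_eq_iff [simp]: "ev p = ev q \<longleftrightarrow> p = q"
  using ev_eq_0_iff[of "p - q"] by (simp del: ev_eq_0_iff)

lemma y_square: "y ^ 2 = ev f"
  using cff by (auto simp: ev_def curve_function_field_def)

lemma generated: "field_gen (range emb \<union> {x, y}) = UNIV"
  using cff by (auto simp: curve_function_field_def)

lemma ev_y_eq_0: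
  assumes "ev p + ev q * y = 0"
  shows "p = 0 \<and> q = 0"
proof -
  have "ev p ^ 2 = (ev q * y) ^ 2"
    using assms by (metis add_eq_0_iff power2_minus)
  then have "ev (p ^ 2) = ev (q ^ 2 * f)"
    by (simp add: power_mult_distrib y_square)
  then have "q = 0" using nonsquare by (simp only: ev_eq_iff)
  then show ?thesis using assms by auto
qed

lemma ev_y_eq_iff: "ev p + ev q * y = ev p' + ev q' * y \<longleftrightarrow> p = p' \<and> q = q'"
proof
  assume "ev p + ev q * y = ev p' + ev q' * y"
  then have "ev (p - p') + ev (q - q') * y = 0" by (simp add: algebra_simps)
  from ev_y_eq_0[OF this] show "p = p' \<and> q = q'" by simp
qed simp

lemma norm_neq_0:
  assumes "p \<noteq> 0 \<or> q \<noteq> 0"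
  shows "p ^ 2 - q ^ 2 * f \<noteq> 0"
  using nonsquare[of p q] assms by auto

lemma y_mult_y: "y * y = ev f"
  using y_square by (simp add: power2_eq_square)

lemma ev_y_mult:
  "(ev p + ev q * y) * (ev p' + ev q' * y) = ev (p * p' + q * q' * f) + ev (p * q' + q * p') * y"
proof -
  have "(ev p + ev q * y) * (ev p' + ev q' * y)
      = ev p * ev p' + ev q * ev q' * (y * y) + (ev p * ev q' + ev q * ev p') * y"
    by (simp add: algebra_simps)
  then show ?thesis by (simp add: y_mult_y)
qed

lemma ev_y_norm:
  "(ev p + ev q * y) * (ev p - ev q * y) = ev (p ^ 2 - q ^ 2 * f)"
proof -
  have "(ev p + ev q * y) * (ev p - ev q * y) = ev p ^ 2 - ev q ^ 2 * (y * y)"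
    by (simp add: algebra_simps power2_eq_square)
  then show ?thesis by (simp add: y_mult_y)
qed

text \<open>The fractions of this shape form a subfield containing the generators. Inverses come
  from the conjugate \<open>p - q y\<close>, whose product with \<open>p + q y\<close> is the
  nonzero polynomial \<open>p^2 - q^2 f\<close>.\<close>

lemma repr: "\<exists>p q r. r \<noteq> 0 \<and> h * ev r = ev p + ev q * y"
proof -
  define G where "G = {h. \<exists>p q r. r \<noteq> 0 \<and> h * ev r = ev p + ev q * y}"
  have GI: "h \<in> G" if "r \<noteq> 0" "h * ev r = ev p + ev q * y" for h p q r
    using that unfolding G_def by blast
  have "is_subfield G"
    unfolding is_subfield_def
  proof (intro conjI ballI)
    show "0 \<in> G" by (rule GI[of 1 0 0 0]) auto
    show "1 \<in> G" by (rule GI[of 1 1 1 0]) auto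
  next
    fix a b assume "a \<in> G" "b \<in> G"
    then obtain p q r p' q' r' where
      a: "r \<noteq> 0" "a * ev r = ev p + ev q * y" and b: "r' \<noteq> 0" "b * ev r' = ev p' + ev q' * y"
      unfolding G_def by blast
    have "(a - b) * ev (r * r') = (a * ev r) * ev r' - (b * ev r') * ev r"
      by (simp add: algebra_simps)
    also have "\<dots> = ev (p * r' - p' * r) + ev (q * r' - q' * r) * y"
      unfolding a(2) b(2) by (simp add: algebra_simps)
    finally show "a - b \<in> G" using a(1) b(1) by (intro GI[of "r * r'" _ "p * r' - p' * r" "q * r' - q' * r"]) simp_all
    have "(a * b) * ev (r * r') = (a * ev r) * (b * ev r')"
      by (simp add: algebra_simps)
    also have "\<dots> = ev (p * p' + q * q' * f) + ev (p * q' + q * p') * y"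
      unfolding a(2) b(2) by (rule ev_y_mult)
    finally show "a * b \<in> G" using a(1) b(1)
      by (intro GI[of "r * r'" _ "p * p' + q * q' * f" "p * q' + q * p'"]) simp_all
  next
    fix a assume "a \<in> G"
    then obtain p q r where a: "r \<noteq> 0" "a * ev r = ev p + ev q * y"
      unfolding G_def by blast
    show "inverse a \<in> G"
    proof (cases "a = 0")
      case True
      then show ?thesis by (intro GI[of 1 _ 0 0]) auto
    next
      case False
      then have "ev p + ev q * y \<noteq> 0" using a by auto
      then have nz: "p ^ 2 - q ^ 2 * f \<noteq> 0" by (intro norm_neq_0) auto
      have "inverse a * ev (p ^ 2 - q ^ 2 * f) = inverse a * ((a * ev r) * (ev p - ev q * y))"
        unfolding a(2) by (simp only: ev_y_norm)
      also have "\<dots> = ev r * (ev p - ev q * y)"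
        using False by (simp add: field_simps)
      also have "\<dots> = ev (r * p) + ev (0 - r * q) * y"
        unfolding ev_diff ev_0 ev_mult by (simp add: algebra_simps)
      finally show ?thesis by (rule GI[OF nz])
    qed
  qed
  moreover have "range emb \<union> {x, y} \<subseteq> G"
  proof -
    have "emb a \<in> G" for a by (rule GI[of 1 _ "[:a:]" 0]) auto
    moreover have "x \<in> G" by (rule GI[of 1 _ "[:0, 1:]" 0]) auto
    moreover have "y \<in> G" by (rule GI[of 1 _ 0 1]) auto
    ultimately show ?thesis by auto
  qed
  ultimately have "field_gen (range emb \<union> {x, y}) \<subseteq> G"
    by (intro field_gen_minimal)
  then have "h \<in> G" using generated by auto
  then show ?thesis unfolding G_def by blast
qed

text \<open>The universal property of the function field. The target is an arbitrary field: the
  function field itself yields automorphisms, Laurent series yield points.\<close>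

lemma hom_extension:
  fixes s :: "'a \<Rightarrow> 'g::field"
  assumes s: "field_hom s"
    and y': "y' ^ 2 = poly (map_poly s f) x'"
    and tr: "\<And>p. poly (map_poly s p) x' = 0 \<Longrightarrow> p = 0"
  shows "\<exists>\<Phi>. field_hom \<Phi> \<and> (\<forall>a. \<Phi> (emb a) = s a) \<and> \<Phi> x = x' \<and> \<Phi> y = y'"
proof -
  interpret s: fld_hom s by unfold_locales fact
  define ev' where "ev' p = poly (map_poly s p) x'" for p
  have ev'_simps [simp]: "ev' (p + q) = ev' p + ev' q" "ev' (p - q) = ev' p - ev' q"
    "ev' (p * q) = ev' p * ev' q" "ev' 0 = 0" "ev' 1 = 1" "ev' (pCons c p) = s c + x' * ev' p" for p q c
    by (simp_all add: ev'_def)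
  have ev'_0_iff [simp]: "ev' p = 0 \<longleftrightarrow> p = 0" for p
    using tr[of p] by (auto simp: ev'_def)
  have yy: "y' * y' = ev' f" using y' by (simp add: ev'_def power2_eq_square)
  \<comment> \<open>The choice of a representation is immaterial: two of them are compared after
    clearing denominators, and uniqueness of the numerators transfers the equality to the
    target.\<close>
  define \<Phi> where "\<Phi> h = (SOME w. \<exists>p q r. r \<noteq> 0 \<and> h * ev r = ev p + ev q * y \<and>
      w * ev' r = ev' p + ev' q * y')" for h
  have \<Phi>: "\<Phi> h = (ev' p + ev' q * y') / ev' r" if "r \<noteq> 0" "h * ev r = ev p + ev q * y" for h p q r
  proof -
    have "\<exists>p q r. r \<noteq> 0 \<and> h * ev r = ev p + ev q * y \<and>
      ((ev' p + ev' q * y') / ev' r) * ev' r = ev' p + ev' q * y'"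
      using that by (intro exI[of _ p] exI[of _ q] exI[of _ r]) auto
    then have "\<exists>w. \<exists>p q r. r \<noteq> 0 \<and> h * ev r = ev p + ev q * y \<and> w * ev' r = ev' p + ev' q * y'"
      using repr[of h] that by (intro exI[of _ "(ev' p + ev' q * y') / ev' r"] exI[of _ p] exI[of _ q] exI[of _ r]) auto
    from someI_ex[OF this] obtain p1 q1 r1 where 1: "r1 \<noteq> 0" "h * ev r1 = ev p1 + ev q1 * y"
      "\<Phi> h * ev' r1 = ev' p1 + ev' q1 * y'"
      unfolding \<Phi>_def by blast
    have "ev (p * r1) + ev (q * r1) * y = (h * ev r) * ev r1"
      unfolding that(2) by (simp add: algebra_simps)
    also have "\<dots> = (h * ev r1) * ev r" by simp
    also have "\<dots> = ev (p1 * r) + ev (q1 * r) * y"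
      unfolding 1(2) by (simp add: algebra_simps)
    finally have e: "p * r1 = p1 * r" "q * r1 = q1 * r"
      by (simp_all only: ev_y_eq_iff)
    have "\<Phi> h * ev' r * ev' r1 = (\<Phi> h * ev' r1) * ev' r" by simp
    also have "\<dots> = (ev' p1 + ev' q1 * y') * ev' r" unfolding 1(3) ..
    also have "\<dots> = ev' (p1 * r) + ev' (q1 * r) * y'" by (simp add: algebra_simps)
    also have "\<dots> = (ev' p + ev' q * y') * ev' r1" unfolding e[symmetric] by (simp add: algebra_simps)
    finally have "\<Phi> h * ev' r = ev' p + ev' q * y'" using 1(1) by (simp only: mult_cancel_right ev'_0_iff) simp
    then show ?thesis using that(1) by (metis ev'_0_iff nonzero_eq_divide_eq)
  qed
  have "field_hom \<Phi>"
    unfolding field_hom_def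
  proof (intro conjI allI)
    show "\<Phi> 1 = 1" using \<Phi>[of 1 1 1 0] by simp
  next
    fix a b
    obtain p q r p' q' r' where
      a: "r \<noteq> 0" "a * ev r = ev p + ev q * y" and b: "r' \<noteq> 0" "b * ev r' = ev p' + ev q' * y"
      using repr[of a] repr[of b] by blast
    have "(a + b) * ev (r * r') = (a * ev r) * ev r' + (b * ev r') * ev r"
      by (simp add: algebra_simps)
    also have "\<dots> = ev (p * r' + p' * r) + ev (q * r' + q' * r) * y"
      unfolding a(2) b(2) by (simp add: algebra_simps)
    finally have "\<Phi> (a + b) = (ev' (p * r' + p' * r) + ev' (q * r' + q' * r) * y') / ev' (r * r')"
      using a b by (intro \<Phi>) auto
    then show "\<Phi> (a + b) = \<Phi> a + \<Phi> b"
      using a(1) b(1) unfolding \<Phi>[OF a] \<Phi>[OF b] by (simp add: field_simps)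
    have "(a * b) * ev (r * r') = (a * ev r) * (b * ev r')"
      by (simp add: algebra_simps)
    also have "\<dots> = ev (p * p' + q * q' * f) + ev (p * q' + q * p') * y"
      unfolding a(2) b(2) by (rule ev_y_mult)
    finally have "\<Phi> (a * b) = (ev' (p * p' + q * q' * f) + ev' (p * q' + q * p') * y') / ev' (r * r')"
      using a b by (intro \<Phi>) auto
    also have "ev' (p * p' + q * q' * f) + ev' (p * q' + q * p') * y' =
      (ev' p + ev' q * y') * (ev' p' + ev' q' * y')"
      by (simp add: algebra_simps flip: yy)
    finally show "\<Phi> (a * b) = \<Phi> a * \<Phi> b"
      using \<Phi>[OF a] \<Phi>[OF b] by simp
  qed
  moreover have "\<Phi> (emb a) = s a" for a using \<Phi>[of 1 "emb a" "[:a:]" 0] by simp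
  moreover have "\<Phi> x = x'" using \<Phi>[of 1 x "[:0, 1:]" 0] by simp
  moreover have "\<Phi> y = y'" using \<Phi>[of 1 y 0 1] by simp
  ultimately show ?thesis by blast
qed

text \<open>Surjectivity holds because the image is a subfield containing the generators
  \<open>emb a\<close>, \<open>x'\<close> and \<open>y'\<close>. The uniqueness part justifies the
  definite descriptions in \<open>extend_aut\<close> and \<open>bar\<close>.\<close>

lemma aut_extension:
  assumes \<sigma>: "field_hom \<sigma>" "bij \<sigma>"
    and y': "y' ^ 2 = poly (map_poly (\<lambda>a. emb (\<sigma> a)) f) x'"
    and tr: "\<And>p. poly (map_poly emb p) x' = 0 \<Longrightarrow> p = 0"
    and gen: "field_gen (range emb \<union> {x', y'}) = UNIV"
  shows "\<exists>!\<tau>. field_hom \<tau> \<and> bij \<tau> \<and> (\<forall>a. \<tau> (emb a) = emb (\<sigma> a)) \<and> \<tau> x = x' \<and> \<tau> y = y'"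
proof -
  interpret s: fld_hom \<sigma> by unfold_locales fact
  have hom: "field_hom (\<lambda>a. emb (\<sigma> a))" by (simp add: field_hom_def)
  have mp: "map_poly (\<lambda>a. emb (\<sigma> a)) p = map_poly emb (map_poly \<sigma> p)" for p
    by (rule poly_eqI) (simp add: coeff_map_poly)
  have "\<exists>\<Phi>. field_hom \<Phi> \<and> (\<forall>a. \<Phi> (emb a) = emb (\<sigma> a)) \<and> \<Phi> x = x' \<and> \<Phi> y = y'"
  proof (rule hom_extension[OF hom y'])
    show "p = 0" if "poly (map_poly (\<lambda>a. emb (\<sigma> a)) p) x' = 0" for p
      using tr[of "map_poly \<sigma> p"] that by (simp add: mp)
  qed
  then obtain \<tau> where \<tau>: "field_hom \<tau>" "\<And>a. \<tau> (emb a) = emb (\<sigma> a)" "\<tau> x = x'" "\<tau> y = y'"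
    by blast
  interpret t: fld_hom \<tau> by unfold_locales fact
  have "is_subfield (range \<tau>)"
    unfolding is_subfield_def
  proof (intro conjI)
    show "0 \<in> range \<tau>" "1 \<in> range \<tau>" by (metis t.zero rangeI, metis t.one rangeI)
  qed (auto simp flip: t.diff t.mult t.inverse)
  moreover have "range emb \<union> {x', y'} \<subseteq> range \<tau>"
  proof -
    have "emb a \<in> range \<tau>" for a
      using \<tau>(2)[of "inv_into UNIV \<sigma> a"] \<sigma>(2) by (metis bij_inv_eq_iff rangeI)
    then show ?thesis using \<tau> by auto
  qed
  ultimately have "surj \<tau>" using gen field_gen_minimal[of "range emb \<union> {x', y'}" "range \<tau>"] by auto
  then have bij: "bij \<tau>" using t.inj by (simp add: bij_def)
  show ?thesis
  proof (rule ex1I[of _ \<tau>])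
    show "field_hom \<tau> \<and> bij \<tau> \<and> (\<forall>a. \<tau> (emb a) = emb (\<sigma> a)) \<and> \<tau> x = x' \<and> \<tau> y = y'"
      using \<tau> bij by auto
  next
    fix \<rho> assume "field_hom \<rho> \<and> bij \<rho> \<and> (\<forall>a. \<rho> (emb a) = emb (\<sigma> a)) \<and> \<rho> x = x' \<and> \<rho> y = y'"
    then show "\<rho> = \<tau>" using \<tau> generated by (intro field_hom_eq_on_gen[of _ _ "range emb \<union> {x, y}"]) auto
  qed
qed

end

section \<open>Fixed fields of Galois groups\<close>

text \<open>A homomorphism over \<open>L\<close>, defined on a subring, is given by its graph.\<close>

definition partial_hom :: "'a::field set \<Rightarrow> ('a \<times> 'a) set \<Rightarrow> bool" where
  "partial_hom L R \<longleftrightarrow> (\<forall>l\<in>L. (l, l) \<in> R) \<and>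
     (\<forall>a c. \<forall>a' c'. (a, a') \<in> R \<longrightarrow> (c, c') \<in> R \<longrightarrow> (a - c, a' - c') \<in> R \<and> (a * c, a' * c') \<in> R) \<and>
     (\<forall>c. (0, c) \<in> R \<longrightarrow> c = 0)"

definition poly_rel :: "('a::field \<times> 'a) set \<Rightarrow> 'a poly \<Rightarrow> 'a poly \<Rightarrow> bool" where
  "poly_rel R p q \<longleftrightarrow> (\<forall>i. (coeff p i, coeff q i) \<in> R)"

context
  fixes L :: "'a::field set" and R
  assumes L: "is_subfield L" and R: "partial_hom L R"
begin

lemma ph_diff: "(a, a') \<in> R \<Longrightarrow> (c, c') \<in> R \<Longrightarrow> (a - c, a' - c') \<in> R"
  and ph_mult: "(a, a') \<in> R \<Longrightarrow> (c, c') \<in> R \<Longrightarrow> (a * c, a' * c') \<in> R"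
  and ph_L: "l \<in> L \<Longrightarrow> (l, l) \<in> R"
  and ph_zero: "(0, c) \<in> R \<Longrightarrow> c = 0"
  using R unfolding partial_hom_def by blast+

lemma ph_0: "(0, 0) \<in> R" and ph_1: "(1, 1) \<in> R"
  using L ph_L by (auto simp: is_subfield_def)

lemma ph_add: "(a, a') \<in> R \<Longrightarrow> (c, c') \<in> R \<Longrightarrow> (a + c, a' + c') \<in> R"
  using ph_diff[of a a' "0 - c" "0 - c'"] ph_diff[OF ph_0, of c c'] by simp

lemma ph_unique: "(a, a') \<in> R \<Longrightarrow> (a, c') \<in> R \<Longrightarrow> a' = c'"
  using ph_diff[of a a' a c'] ph_zero by fastforce

lemma ph_sum: "(\<And>i. i \<in> A \<Longrightarrow> (g i, g' i) \<in> R) \<Longrightarrow> (sum g A, sum g' A) \<in> R"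
  by (induction A rule: infinite_finite_induct) (auto intro: ph_0 ph_add)

lemma pr_diff: "poly_rel R p p' \<Longrightarrow> poly_rel R q q' \<Longrightarrow> poly_rel R (p - q) (p' - q')"
  by (auto simp: poly_rel_def intro: ph_diff)

lemma pr_mult: "poly_rel R p p' \<Longrightarrow> poly_rel R q q' \<Longrightarrow> poly_rel R (p * q) (p' * q')"
  unfolding poly_rel_def coeff_mult by (intro allI ph_sum ph_mult) auto

lemma pr_monom: "(a, a') \<in> R \<Longrightarrow> poly_rel R (monom a n) (monom a' n)"
  by (auto simp: poly_rel_def intro: ph_0)

text \<open>Long division by \<open>p\<close>, carried out in parallel on both sides of
  \<open>R\<close>. As \<open>p\<close> is monic it needs no inverses; it ends with a remainder of
  degree below that of \<open>p\<close>, which minimality forces to be zero. Hence \<open>z\<close>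
  can be sent to \<open>z'\<close> without contradiction.\<close>

lemma pr_root:
  assumes p: "poly_rel R p p'" "lead_coeff p = 1" "poly p z = 0" "poly p' z' = 0"
    and minimal: "\<And>q. (\<forall>i. coeff q i \<in> Domain R) \<Longrightarrow> poly q z = 0 \<Longrightarrow> q \<noteq> 0 \<Longrightarrow> degree p \<le> degree q"
    and q: "poly_rel R q q'" "poly q z = 0"
  shows "poly q' z' = 0"
  using q
proof (induction "degree q" arbitrary: q q' rule: less_induct)
  case less
  show ?case
  proof (cases "q = 0")
    case True
    then have "q' = 0" using less.prems(1) ph_zero by (intro poly_eqI) (simp add: poly_rel_def)
    then show ?thesis by simp
  next
    case False
    have "\<forall>i. coeff q i \<in> Domain R" using less.prems(1) by (auto simp: poly_rel_def)
    then have le: "degree p \<le> degree q" using minimal less.prems(2) False by blast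
    define n where "n = degree q - degree p"
    define q1 where "q1 = q - monom (lead_coeff q) n * p"
    \<comment> \<open>The coefficient is taken at the degree of \<open>q\<close>, not of
      \<open>q'\<close>: so far \<open>R\<close> might send the leading coefficient of
      \<open>q\<close> to zero.\<close>
    define q1' where "q1' = q' - monom (coeff q' (degree q)) n * p'"
    have rel: "poly_rel R q1 q1'"
      unfolding q1_def q1'_def using less.prems(1) p(1)
      by (intro pr_diff pr_mult pr_monom) (auto simp: poly_rel_def)
    have z: "poly q1 z = 0" using less.prems(2) p(3) by (simp add: q1_def)
    have "poly q1' z' = 0"
    proof (cases "q1 = 0")
      case True
      then have "q1' = 0" using rel ph_zero by (intro poly_eqI) (simp add: poly_rel_def)
      then show ?thesis by simp
    next
      case q1: False
      have p0: "p \<noteq> 0" using p(2) by auto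
      have dm: "degree (monom (lead_coeff q) n * p) = degree q"
        using False p0 le by (simp add: degree_mult_eq degree_monom_eq n_def)
      have "coeff (monom (lead_coeff q) n * p) (degree q) = lead_coeff q"
        using le p(2) by (simp add: coeff_monom_mult n_def)
      then have "coeff q1 (degree q) = 0" by (simp add: q1_def)
      moreover have "degree q1 \<le> degree q" unfolding q1_def using dm by (intro degree_diff_le) auto
      ultimately have "degree q1 < degree q" using q1 by (metis le_neq_implies_less leading_coeff_0_iff)
      then show ?thesis using less.hyps rel z by blast
    qed
    then show ?thesis using p(4) by (simp add: q1'_def)
  qed
qed

text \<open>The extension consists of the pairs of values, at \<open>z\<close> and
  \<open>z'\<close>, of coefficientwise related polynomials; \<open>pr_root\<close> makes it single
  valued at zero.\<close>

lemma partial_hom_extend: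
  assumes p: "poly_rel R p p'" "lead_coeff p = 1" "poly p z = 0" "poly p' z' = 0"
    and minimal: "\<And>q. (\<forall>i. coeff q i \<in> Domain R) \<Longrightarrow> poly q z = 0 \<Longrightarrow> q \<noteq> 0 \<Longrightarrow> degree p \<le> degree q"
  shows "\<exists>R'. partial_hom L R' \<and> R \<subseteq> R' \<and> (z, z') \<in> R'"
proof -
  define R' where "R' = {(poly q z, poly q' z') | q q'. poly_rel R q q'}"
  have R'I: "(a, a') \<in> R'" if "poly_rel R q q'" "a = poly q z" "a' = poly q' z'" for a a' q q'
    using that by (auto simp: R'_def)
  have const: "(a, a') \<in> R'" if "(a, a') \<in> R" for a a'
    using pr_monom[OF that, of 0] by (intro R'I[of "monom a 0" "monom a' 0"]) (simp_all add: poly_monom)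
  have "partial_hom L R'"
    unfolding partial_hom_def
  proof (intro conjI allI impI ballI)
    show "(l, l) \<in> R'" if "l \<in> L" for l using const ph_L that by blast
    fix a c a' c' assume "(a, a') \<in> R'" "(c, c') \<in> R'"
    then obtain q q' s s' where q: "poly_rel R q q'" "a = poly q z" "a' = poly q' z'"
      and s: "poly_rel R s s'" "c = poly s z" "c' = poly s' z'" unfolding R'_def by blast
    show "(a - c, a' - c') \<in> R'" using pr_diff[OF q(1) s(1)] by (rule R'I) (simp_all add: q s)
    show "(a * c, a' * c') \<in> R'" using pr_mult[OF q(1) s(1)] by (rule R'I) (simp_all add: q s)
  next
    fix c assume "(0, c) \<in> R'"
    then obtain q q' where "poly_rel R q q'" "0 = poly q z" "c = poly q' z'" unfolding R'_def by blast
    then show "c = 0" using pr_root[OF p minimal] by metis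
  qed
  moreover have "(z, z') \<in> R'"
    using pr_monom[OF ph_1, of 1] by (rule R'I) (simp_all add: poly_monom)
  ultimately show ?thesis using const by auto
qed

lemma ph_Domain_ring:
  "a \<in> Domain R \<Longrightarrow> c \<in> Domain R \<Longrightarrow> a - c \<in> Domain R \<and> a * c \<in> Domain R"
  using ph_diff ph_mult by blast

end

text \<open>A ring of algebraic elements over a field is a field: after cancelling powers of
  \<open>a\<close>, its equation has a nonzero constant term \<open>c\<close>, and
  \<open>a * poly q a = - c\<close> exhibits the inverse.\<close>

lemma algebraic_inverse:
  fixes L M :: "'a::field set"
  assumes L: "is_subfield L" "L \<subseteq> M" and M: "\<And>a c. a \<in> M \<Longrightarrow> c \<in> M \<Longrightarrow> a - c \<in> M \<and> a * c \<in> M"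
    and a: "is_algebraic_over L a" "a \<in> M" "a \<noteq> 0"
  shows "inverse a \<in> M"
proof -
  obtain p where p: "p \<noteq> 0" "\<And>i. coeff p i \<in> L" "poly p a = 0"
    using a(1) by (auto simp: is_algebraic_over_def)
  have M0: "0 \<in> M" using L by (auto simp: is_subfield_def)
  have M_add: "c + e \<in> M" if "c \<in> M" "e \<in> M" for c e
    using M[of c "0 - e"] M[OF M0 that(2)] that by simp
  have val: "poly q a \<in> M" if "\<And>i. coeff q i \<in> L" for q
    using that
  proof (induction q)
    case (pCons c q)
    have "coeff q i \<in> L" for i using pCons.prems[of "Suc i"] by simp
    then have "poly q a \<in> M" using pCons by blast
    moreover have "c \<in> M" using pCons.prems[of 0] L(2) by auto
    ultimately show ?case using M a(2) M_add by simp
  qed (use M0 in simp)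
  show ?thesis using p
  proof (induction p)
    case (pCons c q)
    have qL: "coeff q i \<in> L" for i using pCons.prems(2)[of "Suc i"] by simp
    show ?case
    proof (cases "c = 0")
      case True
      then show ?thesis using pCons qL a(3) by auto
    next
      case False
      have c: "c \<in> L" using pCons.prems(2)[of 0] by simp
      have "a * poly q a = - c" using pCons.prems(3) by (simp add: eq_neg_iff_add_eq_0 add.commute)
      then have "inverse a = 0 - poly q a * inverse c" using a(3) False by (simp add: field_simps eq_neg_iff_add_eq_0)
      moreover have "inverse c \<in> M" using c L by (auto simp: is_subfield_def)
      ultimately show ?thesis using M M0 val[OF qL] by metis
    qed
  qed simp
qed

lemma ex_minimal_poly:
  fixes M :: "'a::field set"
  assumes inv: "\<And>a. a \<in> M \<Longrightarrow> inverse a \<in> M" and mult: "\<And>a c. a \<in> M \<Longrightarrow> c \<in> M \<Longrightarrow> a * c \<in> M"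
    and p: "p \<noteq> 0" "\<forall>i. coeff p i \<in> M" "poly p z = 0"
  shows "\<exists>p. (\<forall>i. coeff p i \<in> M) \<and> lead_coeff p = 1 \<and> poly p z = 0 \<and>
    (\<forall>q. (\<forall>i. coeff q i \<in> M) \<longrightarrow> poly q z = 0 \<longrightarrow> q \<noteq> 0 \<longrightarrow> degree p \<le> degree q)"
proof -
  let ?Q = "\<lambda>p. p \<noteq> 0 \<and> (\<forall>i. coeff p i \<in> M) \<and> poly p z = 0"
  have "?Q p" using p by blast
  from exists_least_lemma[of "\<lambda>n. \<exists>p. ?Q p \<and> degree p = n"] this obtain q where
    q: "?Q q" "\<And>r. ?Q r \<Longrightarrow> degree q \<le> degree r"
    using ex_has_least_nat[of ?Q p degree] by blast
  let ?p = "smult (inverse (lead_coeff q)) q"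
  have "lead_coeff ?p = 1" "degree ?p = degree q" using q(1) by auto
  moreover have "\<forall>i. coeff ?p i \<in> M" using q(1) inv mult by simp
  ultimately show ?thesis using q by (intro exI[of _ ?p]) auto
qed

text \<open>Zorn's lemma gives a maximal extension \<open>R\<close>. Its domain is a field by
  algebraicity, and it is everything: otherwise a further \<open>z\<close> could be sent to a root
  of its transported minimal polynomial.\<close>

lemma partial_hom_extend_to_aut:
  fixes L :: "'a::alg_closed_field set"
  assumes L: "is_subfield L" and alg: "\<And>a. is_algebraic_over L a" and R0: "partial_hom L R0"
  shows "\<exists>\<sigma>\<in>galois_group L. \<forall>(a, c)\<in>R0. \<sigma> a = c"
proof -
  let ?A = "{R. partial_hom L R \<and> R0 \<subseteq> R}"
  have "\<exists>M\<in>?A. \<forall>X\<in>?A. M \<subseteq> X \<longrightarrow> X = M"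
  proof (rule subset_Zorn_nonempty)
    show "?A \<noteq> {}" using R0 by auto
    fix C assume C: "C \<noteq> {}" "subset.chain ?A C"
    have lin: "X \<subseteq> Y \<or> Y \<subseteq> X" if "X \<in> C" "Y \<in> C" for X Y
      using C(2) that by (auto simp: subset_chain_def)
    have CA: "partial_hom L X" "R0 \<subseteq> X" if "X \<in> C" for X
      using C(2) that by (auto simp: subset_chain_def)
    have "partial_hom L (\<Union> C)"
      unfolding partial_hom_def
    proof (intro conjI allI impI ballI)
      show "(l, l) \<in> \<Union> C" if "l \<in> L" for l using C(1) CA(1) that by (auto simp: partial_hom_def)
      fix a c a' c' assume "(a, a') \<in> \<Union> C" "(c, c') \<in> \<Union> C"
      then obtain X where X: "X \<in> C" "(a, a') \<in> X" "(c, c') \<in> X" using lin by blast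
      then show "(a - c, a' - c') \<in> \<Union> C" "(a * c, a' * c') \<in> \<Union> C"
        using CA(1)[OF X(1)] unfolding partial_hom_def by blast+
    next
      show "c = 0" if "(0, c) \<in> \<Union> C" for c using CA(1) that by (auto simp: partial_hom_def)
    qed
    then show "\<Union> C \<in> ?A" using C(1) CA(2) by auto
  qed
  then obtain R where R: "partial_hom L R" "R0 \<subseteq> R" and max: "\<And>X. partial_hom L X \<Longrightarrow> R \<subseteq> X \<Longrightarrow> X = R"
    by (auto simp: subset_eq)
  note ph = L R(1)
  have LD: "L \<subseteq> Domain R" using ph_L[OF ph] by auto
  have inv: "inverse a \<in> Domain R" if "a \<in> Domain R" for a
  proof (cases "a = 0")
    case False
    then show ?thesis using algebraic_inverse[OF L LD] ph_Domain_ring[OF ph] alg that by blast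
  qed (use that in simp)
  have "z \<in> Domain R" for z
  proof -
    obtain p0 where "p0 \<noteq> 0" "\<forall>i. coeff p0 i \<in> Domain R" "poly p0 z = 0"
      using alg[of z] LD by (auto simp: is_algebraic_over_def)
    from ex_minimal_poly[OF _ _ this] inv ph_Domain_ring[OF ph] obtain p where
      p: "\<forall>i. coeff p i \<in> Domain R" "lead_coeff p = 1" "poly p z = 0"
        "\<And>q. (\<forall>i. coeff q i \<in> Domain R) \<Longrightarrow> poly q z = 0 \<Longrightarrow> q \<noteq> 0 \<Longrightarrow> degree p \<le> degree q"
      by blast
    have "\<exists>g. \<forall>i. (coeff p i, g i) \<in> R" using p(1) by (intro choice) auto
    then obtain g where g: "\<And>i. (coeff p i, g i) \<in> R" by blast
    have g0: "g i = 0" if "i > degree p" for i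
      using g[of i] ph_zero[OF ph] that by (simp add: coeff_eq_0)
    have g1: "g (degree p) = 1" using g[of "degree p"] ph_unique[OF ph _ ph_1[OF ph]] p(2) by simp
    define p' where "p' = Poly (map g [0..<Suc (degree p)])"
    have cp': "coeff p' i = g i" for i
      unfolding p'_def using g0[of i] by (auto simp: nth_default_def simp del: upt_Suc)
    have "degree p \<noteq> 0"
    proof
      assume "degree p = 0"
      then obtain c where "p = [:c:]" by (metis degree_eq_zeroE)
      then show False using p(2,3) by simp
    qed
    moreover have "degree p' \<ge> degree p" by (rule le_degree) (simp add: cp' g1)
    ultimately obtain z' where z': "poly p' z' = 0" using alg_closed_imp_poly_has_root[of p'] by auto
    have "poly_rel R p p'" using g cp' by (simp add: poly_rel_def)
    from partial_hom_extend[OF ph this p(2,3) z' p(4)]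
    obtain R' where "partial_hom L R'" "R \<subseteq> R'" "(z, z') \<in> R'" by blast
    then show ?thesis using max by blast
  qed
  then have "\<forall>a. \<exists>c. (a, c) \<in> R" by auto
  then obtain \<sigma> where \<sigma>: "\<And>a. (a, \<sigma> a) \<in> R" by metis
  have eq: "\<sigma> a = c" if "(a, c) \<in> R" for a c using ph_unique[OF ph \<sigma> that] .
  have hom: "field_hom \<sigma>"
    unfolding field_hom_def using ph_1[OF ph] ph_add[OF ph] ph_mult[OF ph] \<sigma> by (auto intro!: eq)
  then interpret s: fld_hom \<sigma> by unfold_locales
  have fix_L: "\<sigma> a = a" if "a \<in> L" for a using eq ph_L[OF ph that] .
  \<comment> \<open>Surjectivity is a finiteness argument: the injective \<open>\<sigma>\<close>
    maps the finite root set of a polynomial over \<open>L\<close> into itself, hence onto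
    itself.\<close>
  have "c \<in> range \<sigma>" for c
  proof -
    obtain p where p: "p \<noteq> 0" "\<And>i. coeff p i \<in> L" "poly p c = 0"
      using alg[of c] by (auto simp: is_algebraic_over_def)
    have "map_poly \<sigma> p = p" by (rule poly_eqI) (simp add: fix_L p(2))
    then have "\<sigma> ` {a. poly p a = 0} \<subseteq> {a. poly p a = 0}" using s.poly_mp[of p] by auto
    then have "\<sigma> ` {a. poly p a = 0} = {a. poly p a = 0}"
      using poly_roots_finite[OF p(1)] s.inj by (intro endo_inj_surj) (auto simp: inj_on_def)
    then show ?thesis using p(3) by blast
  qed
  then have "surj \<sigma>" by blast
  then have "bij \<sigma>" using s.inj by (simp add: bij_def)
  then have "\<sigma> \<in> galois_group L" using hom fix_L by (auto simp: galois_group_def)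
  then show ?thesis using R(2) eq by (intro bexI[of _ \<sigma>]) auto
qed

text \<open>The minimal polynomial of \<open>a\<close> has degree at least 2, and \<open>a\<close>
  can be sent to another root \<open>a'\<close>. A repeated root would be a root of the derivative,
  which has smaller degree and is nonzero in characteristic 0.\<close>

lemma galois_moves:
  fixes L :: "'a::alg_closed_field set"
  assumes L: "is_subfield L" and alg: "\<And>a. is_algebraic_over L a"
    and char0: "\<And>n::nat. n > 0 \<Longrightarrow> (of_nat n :: 'a) \<noteq> 0" and a: "a \<notin> L"
  shows "\<exists>\<sigma>\<in>galois_group L. \<sigma> a \<noteq> a"
proof -
  have L01: "0 \<in> L" "1 \<in> L" and Ld: "\<And>a c. a \<in> L \<Longrightarrow> c \<in> L \<Longrightarrow> a - c \<in> L"
    and Lm: "\<And>a c. a \<in> L \<Longrightarrow> c \<in> L \<Longrightarrow> a * c \<in> L" and Li: "\<And>a. a \<in> L \<Longrightarrow> inverse a \<in> L"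
    using L by (auto simp: is_subfield_def)
  have La: "c + e \<in> L" if "c \<in> L" "e \<in> L" for c e
    using Ld[of c "0 - e"] Ld[OF L01(1) that(2)] that by simp
  have Ln: "of_nat n \<in> L" for n by (induction n) (auto intro: La L01)
  obtain p0 where "p0 \<noteq> 0" "\<forall>i. coeff p0 i \<in> L" "poly p0 a = 0"
    using alg[of a] by (auto simp: is_algebraic_over_def)
  from ex_minimal_poly[OF _ _ this] Li Lm obtain p where
    p: "\<forall>i. coeff p i \<in> L" "lead_coeff p = 1" "poly p a = 0"
      "\<And>q. (\<forall>i. coeff q i \<in> L) \<Longrightarrow> poly q a = 0 \<Longrightarrow> q \<noteq> 0 \<Longrightarrow> degree p \<le> degree q"
    by blast
  obtain q where q: "p = [:- a, 1:] * q" using p(3) by (metis poly_eq_0_iff_dvd dvdE)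
  have p0: "p \<noteq> 0" using p(2) by auto
  then have q0: "q \<noteq> 0" using q by auto
  have dp: "degree p = Suc (degree q)" unfolding q using q0 by (subst degree_mult_eq) auto
  have "degree q \<noteq> 0"
  proof
    assume "degree q = 0"
    then obtain c where c: "q = [:c:]" by (metis degree_eq_zeroE)
    then have "c = 1" using p(2) q q0 by (auto split: if_splits)
    then have "coeff p 0 = - a" using c q by simp
    then have "0 - (- a) \<in> L" using p(1) Ld L01 by metis
    then show False using a by simp
  qed
  then obtain a' where a': "poly q a' = 0" using alg_closed_imp_poly_has_root[of q] by auto
  have "a' \<noteq> a"
  proof
    assume "a' = a"
    then have "poly (pderiv p) a = 0" unfolding q pderiv_mult using a' by (simp add: pderiv_pCons)
    moreover have "\<forall>i. coeff (pderiv p) i \<in> L" unfolding coeff_pderiv using p(1) Ln Lm by blast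
    moreover have "coeff (pderiv p) (degree q) \<noteq> 0"
      unfolding coeff_pderiv using char0[of "Suc (degree q)"] p(2) dp by simp
    then have "pderiv p \<noteq> 0" by auto
    ultimately have "degree p \<le> degree (pderiv p)" using p(4) by blast
    moreover have "degree (pderiv p) \<le> degree q"
      by (rule degree_le) (simp add: coeff_pderiv coeff_eq_0 dp)
    ultimately show False using dp by simp
  qed
  have ph: "partial_hom L (Id_on L)" using L01 Ld Lm by (auto simp: partial_hom_def)
  have rel: "poly_rel (Id_on L) p p" using p(1) by (auto simp: poly_rel_def)
  have root: "poly p a' = 0" unfolding q using a' by simp
  have "Domain (Id_on L) = L" by auto
  with p(4) have "\<And>q. (\<forall>i. coeff q i \<in> Domain (Id_on L)) \<Longrightarrow> poly q a = 0 \<Longrightarrow> q \<noteq> 0 \<Longrightarrow> degree p \<le> degree q"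
    by simp
  from partial_hom_extend[OF L ph rel p(2,3) root this]
  obtain R where "partial_hom L R" "(a, a') \<in> R" by blast
  from partial_hom_extend_to_aut[OF L alg this(1)] obtain \<sigma> where
    s: "\<sigma> \<in> galois_group L" "\<forall>(a, c)\<in>R. \<sigma> a = c" by blast
  from bspec[OF s(2) \<open>(a, a') \<in> R\<close>] have "\<sigma> a = a'" by simp
  then show ?thesis using s(1) \<open>a' \<noteq> a\<close> by blast
qed

text \<open>The part of the Galois correspondence that is needed: an element of one field outside
  the other is moved by an automorphism fixing the other, and this automorphism fixes
  \<open>K\<close> as well.\<close>

lemma galois_fixed_eqI:
  fixes K A B :: "'a::alg_closed_field set"
  assumes A: "is_subfield A" "K \<subseteq> A" and B: "is_subfield B" "K \<subseteq> B" and alg: "\<And>a. is_algebraic_over K a"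
    and char0: "\<And>n::nat. n > 0 \<Longrightarrow> (of_nat n :: 'a) \<noteq> 0"
    and eq: "\<And>\<sigma>. \<sigma> \<in> galois_group K \<Longrightarrow> (\<forall>a\<in>A. \<sigma> a = a) \<longleftrightarrow> (\<forall>a\<in>B. \<sigma> a = a)"
  shows "A = B"
proof -
  have sub: "C \<subseteq> D" if C: "is_subfield C" "K \<subseteq> C" and D: "is_subfield D" "K \<subseteq> D"
    and eq: "\<And>\<sigma>. \<sigma> \<in> galois_group K \<Longrightarrow> (\<forall>a\<in>D. \<sigma> a = a) \<Longrightarrow> (\<forall>a\<in>C. \<sigma> a = a)" for C D
  proof (rule ccontr)
    assume "\<not> C \<subseteq> D"
    then obtain a where a: "a \<in> C" "a \<notin> D" by auto
    have "is_algebraic_over D a" for a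
      using alg[of a] D(2) unfolding is_algebraic_over_def by blast
    from galois_moves[OF D(1) this char0 a(2)] obtain \<sigma> where
      s: "\<sigma> \<in> galois_group D" "\<sigma> a \<noteq> a" by blast
    then have "\<sigma> \<in> galois_group K" using D(2) by (auto simp: galois_group_def)
    moreover have "\<forall>a\<in>D. \<sigma> a = a" using s by (auto simp: galois_group_def)
    ultimately show False using eq a(1) s(2) by blast
  qed
  show ?thesis using sub[OF A B] sub[OF B A] eq by blast
qed

section \<open>Valuations\<close>

lemma order_prod_linear:
  fixes b :: "'i \<Rightarrow> 'a::field"
  assumes "finite I" "inj_on b I"
  shows "order c (\<Prod>i\<in>I. [:- b i, 1:]) = (if c \<in> b ` I then 1 else (0::nat))"
  using assms
proof (induction I rule: finite_induct)
  case (insert i I)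
  have "(\<Prod>i\<in>I. [:- b i, 1:]) \<noteq> 0"
    using insert.hyps prod_zero_iff[of I "\<lambda>i. [:- b i, 1:]"] by auto
  then have nz: "[:- b i, 1:] * (\<Prod>i\<in>I. [:- b i, 1:]) \<noteq> 0"
    by (simp only: mult_eq_0_iff) simp
  have "order c [:- b i, 1:] = (if c = b i then 1 else 0)"
    using order_power_n_n[of c 1] by (auto intro!: order_0I)
  then show ?case
    using insert order_mult[OF nz, of c] by (auto simp: inj_on_def)
qed auto

text \<open>At a root \<open>b i\<close> the order of the left side is even and that of the right
  side is odd.\<close>

lemma prod_linear_nonsquare:
  fixes b :: "'i \<Rightarrow> 'a::field"
  assumes "finite I" "inj_on b I" "I \<noteq> {}"
    and eq: "p ^ 2 = q ^ 2 * (\<Prod>i\<in>I. [:- b i, 1:])"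
  shows "q = 0"
proof (rule ccontr)
  assume q: "q \<noteq> 0"
  have f: "(\<Prod>i\<in>I. [:- b i, 1:]) \<noteq> 0"
    using assms(1) prod_zero_iff[of I "\<lambda>i. [:- b i, 1:]"] by auto
  obtain i where i: "i \<in> I" using assms(3) by auto
  have p: "p \<noteq> 0" using eq q f by auto
  have "order (b i) (p * p) = order (b i) (q * q * (\<Prod>i\<in>I. [:- b i, 1:]))"
    using eq by (simp add: power2_eq_square)
  then have "2 * order (b i) p = 2 * order (b i) q + 1"
    using p q f i by (simp add: order_mult order_prod_linear[OF assms(1,2)])
  then show False by presburger
qed

definition vpos :: "('f::field \<Rightarrow> int) \<Rightarrow> 'f \<Rightarrow> bool" where
  "vpos v h \<longleftrightarrow> h = 0 \<or> 0 < v h"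

definition vnn :: "('f::field \<Rightarrow> int) \<Rightarrow> 'f \<Rightarrow> bool" where
  "vnn v h \<longleftrightarrow> h = 0 \<or> 0 \<le> v h"

context func_field
begin

abbreviation "P \<equiv> points emb"

text \<open>The value of a function at a point, stated as congruence to a constant modulo the
  maximal ideal; this avoids constructing residue fields.\<close>

definition hasval :: "('f \<Rightarrow> int) \<Rightarrow> 'f \<Rightarrow> 'a \<Rightarrow> bool" where
  "hasval v h a \<longleftrightarrow> vpos v (h - emb a)"

context
  fixes v assumes v: "v \<in> P"
begin

lemma v_0 [simp]: "v 0 = 0"
  using v by (simp add: points_def)

lemma v_mult: "h \<noteq> 0 \<Longrightarrow> k \<noteq> 0 \<Longrightarrow> v (h * k) = v h + v k"
  using v by (simp add: points_def)

lemma v_add: "h \<noteq> 0 \<Longrightarrow> k \<noteq> 0 \<Longrightarrow> h + k \<noteq> 0 \<Longrightarrow> min (v h) (v k) \<le> v (h + k)"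
  using v by (simp add: points_def)

lemma v_emb [simp]: "v (emb a) = 0"
  using v by (simp add: points_def)

lemma v_uniformizer: "\<exists>t. t \<noteq> 0 \<and> v t = 1"
  using v by (simp add: points_def)

lemma v_1 [simp]: "v 1 = 0"
  using v_emb[of 1] by simp

lemma v_uminus [simp]: "v (- h) = v h"
proof (cases "h = 0")
  case False
  then show ?thesis using v_mult[of "- 1" h] v_emb[of "- 1"] by simp
qed simp

lemma v_inverse: "h \<noteq> 0 \<Longrightarrow> v (inverse h) = - v h"
  using v_mult[of h "inverse h"] by simp

lemma v_divide: "h \<noteq> 0 \<Longrightarrow> k \<noteq> 0 \<Longrightarrow> v (h / k) = v h - v k"
  using v_mult[of h "inverse k"] v_inverse[of k] by (simp add: divide_inverse)

lemma v_power: "h \<noteq> 0 \<Longrightarrow> v (h ^ n) = int n * v h"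
  by (induction n) (auto simp: v_mult algebra_simps)

lemma v_add_lt:
  assumes "h \<noteq> 0" "k = 0 \<or> v h < v k"
  shows "h + k \<noteq> 0 \<and> v (h + k) = v h"
proof (cases "k = 0")
  case False
  then have lt: "v h < v k" using assms by auto
  have nz: "h + k \<noteq> 0"
  proof
    assume "h + k = 0"
    then have "h = - k" by (simp add: eq_neg_iff_add_eq_0)
    then show False using lt by simp
  qed
  have "min (v (h + k)) (v (- k)) \<le> v (h + k + - k)"
    using nz False assms(1) by (intro v_add) auto
  moreover have "min (v h) (v k) \<le> v (h + k)"
    using nz False assms(1) by (intro v_add) auto
  ultimately show ?thesis using lt nz by auto
qed (use assms in auto)

lemma vpos_imp_vnn: "vpos v h \<Longrightarrow> vnn v h"
  by (auto simp: vpos_def vnn_def)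

lemma vpos_add: "vpos v h \<Longrightarrow> vpos v k \<Longrightarrow> vpos v (h + k)"
  using v_add[of h k] unfolding vpos_def
  by (cases "h = 0"; cases "k = 0"; cases "h + k = 0") auto

lemma vnn_add: "vnn v h \<Longrightarrow> vnn v k \<Longrightarrow> vnn v (h + k)"
  using v_add[of h k] unfolding vnn_def
  by (cases "h = 0"; cases "k = 0"; cases "h + k = 0") auto

lemma vpos_uminus: "vpos v (- h) = vpos v h"
  by (simp add: vpos_def)

lemma vpos_mult: "vpos v h \<Longrightarrow> vnn v k \<Longrightarrow> vpos v (h * k)"
  unfolding vpos_def vnn_def using v_mult[of h k] by (cases "h = 0"; cases "k = 0") auto

lemma vpos_multD: "vpos v (h * k) \<Longrightarrow> vpos v h \<or> vpos v k"
  unfolding vpos_def using v_mult[of h k] by (cases "h = 0"; cases "k = 0") auto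

lemma vnn_emb: "vnn v (emb a)"
  by (simp add: vnn_def)

lemma hasval_emb: "hasval v (emb a) a"
  by (simp add: hasval_def vpos_def)

lemma hasval_vnn: "hasval v h a \<Longrightarrow> vnn v h"
  unfolding hasval_def using vnn_add[of "h - emb a" "emb a"] vpos_imp_vnn vnn_emb by simp

lemma hasval_add: "hasval v h a \<Longrightarrow> hasval v k c \<Longrightarrow> hasval v (h + k) (a + c)"
  unfolding hasval_def using vpos_add[of "h - emb a" "k - emb c"] by (simp add: algebra_simps)

lemma hasval_uminus: "hasval v h a \<Longrightarrow> hasval v (- h) (- a)"
  unfolding hasval_def using vpos_uminus[of "h - emb a"] by (simp add: algebra_simps)

lemma hasval_diff: "hasval v h a \<Longrightarrow> hasval v k c \<Longrightarrow> hasval v (h - k) (a - c)"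
  using hasval_add[of h a "- k" "- c"] hasval_uminus by simp

lemma hasval_mult: "hasval v h a \<Longrightarrow> hasval v k c \<Longrightarrow> hasval v (h * k) (a * c)"
proof -
  assume h: "hasval v h a" and k: "hasval v k c"
  have "vpos v ((h - emb a) * k + (k - emb c) * emb a)"
    using h k hasval_vnn[OF k] vnn_emb unfolding hasval_def by (intro vpos_add vpos_mult)
  then show ?thesis by (simp add: hasval_def algebra_simps)
qed

lemma hasval_unique: "hasval v h a \<Longrightarrow> hasval v h c \<Longrightarrow> a = c"
  using hasval_diff[of h a h c] by (simp add: hasval_def vpos_def flip: emb.diff)

lemma hasval_0: "hasval v h 0 \<longleftrightarrow> vpos v h"
  by (simp add: hasval_def)

lemma hasval_unit:
  assumes "hasval v h a" "a \<noteq> 0"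
  shows "h \<noteq> 0 \<and> v h = 0"
proof -
  have "emb a + (h - emb a) \<noteq> 0 \<and> v (emb a + (h - emb a)) = v (emb a)"
    using assms by (intro v_add_lt) (auto simp: hasval_def vpos_def)
  then show ?thesis by simp
qed

lemma hasval_inverse:
  assumes "hasval v h a" "a \<noteq> 0"
  shows "hasval v (inverse h) (inverse a)"
proof -
  have h: "h \<noteq> 0" "v h = 0" using hasval_unit[OF assms] by auto
  have "vpos v ((h - emb a) * (- inverse h * emb (inverse a)))"
    using assms h by (intro vpos_mult) (auto simp: hasval_def vnn_def v_mult v_inverse)
  also have "(h - emb a) * (- inverse h * emb (inverse a)) = inverse h - emb (inverse a)"
    using h assms by (simp add: field_simps)
  finally show ?thesis by (simp add: hasval_def)
qed

lemma hasval_divide: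
  "hasval v h a \<Longrightarrow> hasval v k c \<Longrightarrow> c \<noteq> 0 \<Longrightarrow> hasval v (h / k) (a / c)"
  unfolding divide_inverse by (intro hasval_mult hasval_inverse)

lemma hasval_ev: "hasval v x c \<Longrightarrow> hasval v (ev p) (poly p c)"
proof (induction p)
  case 0
  then show ?case using hasval_emb[of 0] by simp
next
  case (pCons a p)
  then show ?case by (auto intro!: hasval_add hasval_mult hasval_emb)
qed

lemma x_neq_emb [simp]: "x \<noteq> emb c" "emb c \<noteq> x"
proof -
  have "ev [:- c, 1:] \<noteq> 0" by (simp del: ev_pCons)
  then show "x \<noteq> emb c" "emb c \<noteq> x" by auto
qed

lemma over_hasval: "0 < v (x - emb c) \<longleftrightarrow> hasval v x c"
  by (simp add: hasval_def vpos_def)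

lemma v_ev:
  assumes "hasval v x c" "p \<noteq> 0"
  shows "v (ev p) = int (order c p) * v (x - emb c)"
proof -
  obtain q where q: "p = [:- c, 1:] ^ order c p * q" "\<not> [:- c, 1:] dvd q"
    using order_decomp[OF assms(2)] by blast
  then have "poly q c \<noteq> 0" by (simp add: poly_eq_0_iff_dvd)
  then have "ev q \<noteq> 0 \<and> v (ev q) = 0" using hasval_unit[OF hasval_ev[OF assms(1)]] by auto
  moreover have "ev p = (x - emb c) ^ order c p * ev q"
    by (subst q(1)) simp
  ultimately show ?thesis by (simp add: v_mult v_power)
qed

lemma v_ev_inf:
  assumes "v x < 0" "p \<noteq> 0"
  shows "v (ev p) = int (degree p) * v x"
  using assms(2)
proof (induction p)
  case (pCons c p)
  have x0: "x \<noteq> 0" using x_neq_emb[of 0] by simp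
  show ?case
  proof (cases "p = 0")
    case False
    then have *: "v (x * ev p) = v x + int (degree p) * v x" using x0 pCons by (simp add: v_mult)
    have "int (degree p) * v x \<le> 0" using assms(1) by (simp add: mult_nonneg_nonpos)
    then have "v (x * ev p + emb c) = v (x * ev p)"
      using x0 False * assms(1) by (intro v_add_lt[THEN conjunct2]) auto
    then show ?thesis using * False by (simp add: algebra_simps)
  qed simp
qed simp

end


lemma points_comp:
  assumes "v \<in> P" "field_hom \<tau>" "bij \<tau>" "\<And>a. \<exists>c. \<tau> (emb a) = emb c"
  shows "v \<circ> \<tau> \<in> P"
proof -
  interpret t: fld_hom \<tau> by unfold_locales fact
  obtain t where t: "t \<noteq> 0" "v t = 1" using v_uniformizer[OF assms(1)] by auto
  obtain t' where t': "\<tau> t' = t" using assms(3) by (metis bij_pointE)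
  have e: "v (\<tau> (emb a)) = 0" for a using assms(4)[of a] v_emb[OF assms(1)] by auto
  have "\<exists>t. t \<noteq> 0 \<and> v (\<tau> t) = 1" using t t' by (intro exI[of _ t']) auto
  moreover have "min (v (\<tau> h)) (v (\<tau> k)) \<le> v (\<tau> (h + k))" if "h \<noteq> 0" "k \<noteq> 0" "h + k \<noteq> 0" for h k
    using that v_add[OF assms(1), of "\<tau> h" "\<tau> k"] by (metis t.add t.eq_0_iff)
  ultimately show ?thesis
    using v_mult[OF assms(1)] e v_0[OF assms(1)] unfolding points_def by auto
qed

text \<open>The order of vanishing along a local parametrisation of the curve. All points whose
  existence is needed are produced in this way.\<close>

lemma points_fls:
  fixes \<Phi> :: "'f \<Rightarrow> 'a fls"
  assumes "field_hom \<Phi>" "\<And>a. \<Phi> (emb a) = fls_const a" "fls_subdegree (\<Phi> t) = 1"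
  shows "(\<lambda>h. fls_subdegree (\<Phi> h)) \<in> P"
proof -
  interpret h: fld_hom \<Phi> by unfold_locales fact
  have "t \<noteq> 0" using assms(3) by auto
  moreover have "min (fls_subdegree (\<Phi> h)) (fls_subdegree (\<Phi> k)) \<le> fls_subdegree (\<Phi> (h + k))"
    if "h + k \<noteq> 0" for h k
    using fls_plus_subdegree[of "\<Phi> h" "\<Phi> k"] that by (metis h.add h.eq_0_iff)
  ultimately show ?thesis unfolding points_def using assms by auto
qed

end

text \<open>The coefficients of a square root \<open>G\<close> of \<open>F\<close> with constant
  term \<open>s\<close>: the coefficient of \<open>G^2\<close> in degree \<open>n > 0\<close> is
  \<open>2 * s * G n\<close> plus products of earlier coefficients, and this is solved for
  \<open>G n\<close>.\<close>

function fps_sqrt_coeff :: "(nat \<Rightarrow> 'a::field) \<Rightarrow> 'a \<Rightarrow> nat \<Rightarrow> 'a" where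
  "fps_sqrt_coeff F s n = (if n = 0 then s else
     (F n - (\<Sum>i\<in>{1..<n}. fps_sqrt_coeff F s i * fps_sqrt_coeff F s (n - i))) / (2 * s))"
  by auto
termination
  by (relation "measure (\<lambda>(F, s, n). n)") auto

declare fps_sqrt_coeff.simps [simp del]

lemma fps_sqrt_exists:
  fixes F :: "'a::field fps"
  assumes "fps_nth F 0 = s ^ 2" "s \<noteq> 0" "(2::'a) \<noteq> 0"
  shows "\<exists>G. G ^ 2 = F \<and> fps_nth G 0 = s"
proof -
  let ?c = "fps_sqrt_coeff (fps_nth F) s"
  define G where "G = Abs_fps ?c"
  have c0: "?c 0 = s" by (subst fps_sqrt_coeff.simps) simp
  have "fps_nth (G * G) n = fps_nth F n" for n
  proof (cases "n = 0")
    case True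
    then show ?thesis using assms(1) by (simp add: G_def c0 power2_eq_square)
  next
    case False
    then have "{0..n} = {0, n} \<union> {1..<n}" by auto
    then have "fps_nth (G * G) n = (\<Sum>i\<in>{0, n} \<union> {1..<n}. ?c i * ?c (n - i))"
      unfolding fps_mult_nth G_def by simp
    also have "\<dots> = (\<Sum>i\<in>{0, n}. ?c i * ?c (n - i)) + (\<Sum>i\<in>{1..<n}. ?c i * ?c (n - i))"
      by (intro sum.union_disjoint) auto
    also have "(\<Sum>i\<in>{0, n}. ?c i * ?c (n - i)) = 2 * s * ?c n"
      using False by (simp add: c0)
    also have "2 * s * ?c n = fps_nth F n - (\<Sum>i\<in>{1..<n}. ?c i * ?c (n - i))"
      using False assms by (subst fps_sqrt_coeff.simps) simp
    finally show ?thesis by simp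
  qed
  then have "G ^ 2 = F" by (simp add: fps_eq_iff power2_eq_square)
  then show ?thesis using c0 by (auto simp: G_def)
qed

section \<open>Points of a curve with a Weierstrass point at infinity\<close>

text \<open>The odd number of roots makes infinity a branch point. The index set stays arbitrary,
  since besides \<open>{1..n}\<close> the model is used on a reordered set of three indices and, for
  a second model of an elliptic curve, on \<open>{1, 2, 3}\<close>.\<close>

locale odd_model =
  fixes I :: "'i set" and b :: "'i \<Rightarrow> 'a::alg_closed_field" and emb :: "'a \<Rightarrow> 'f::field" and x y :: 'f
  assumes curve: "curve_function_field (\<Prod>i\<in>I. [:- b i, 1:]) emb x y"
    and fin: "finite I" and odd_card: "odd (card I)" and inj_b: "inj_on b I"
    and two: "(2::'a) \<noteq> 0"
begin

definition "f = (\<Prod>i\<in>I. [:- b i, 1:])"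

lemma I_ne: "I \<noteq> {}"
  using odd_card by auto

sublocale func_field f emb x y
proof
  show "curve_function_field f emb x y" using curve by (simp add: f_def)
  show "q = 0" if "p ^ 2 = q ^ 2 * f" for p q
    using prod_linear_nonsquare[OF fin inj_b I_ne] that by (simp add: f_def)
qed

lemma f_nz: "f \<noteq> 0"
  using fin prod_zero_iff[of I "\<lambda>i. [:- b i, 1:]"] by (auto simp: f_def)

lemma order_f: "order c f = (if c \<in> b ` I then 1 else 0)"
  unfolding f_def by (rule order_prod_linear[OF fin inj_b])

lemma poly_f: "poly f c = (\<Prod>i\<in>I. c - b i)"
  by (simp add: f_def poly_prod)

lemma ev_f: "ev f = (\<Prod>i\<in>I. x - emb (b i))"
  by (simp add: f_def)

lemma degree_f: "degree f = card I"
  unfolding f_def using fin by (subst degree_prod_eq_sum_degree) auto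

lemma y_nz [simp]: "y \<noteq> 0"
  using y_square f_nz by auto

lemma two_F: "(2::'f) \<noteq> 0"
  using two emb.eq_0_iff[of 2] by (simp del: emb.eq_0_iff)

text \<open>The hyperelliptic involution. Its fixed elements are the rational functions of
  \<open>x\<close>, and \<open>h * bar h\<close> is the norm to that field.\<close>

definition bar :: "'f \<Rightarrow> 'f" where
  "bar = (THE \<tau>. field_hom \<tau> \<and> bij \<tau> \<and> (\<forall>a. \<tau> (emb a) = emb a) \<and> \<tau> x = x \<and> \<tau> y = - y)"

lemma bar: "field_hom bar \<and> bij bar \<and> (\<forall>a. bar (emb a) = emb a) \<and> bar x = x \<and> bar y = - y"
proof -
  have "\<exists>!\<tau>. field_hom \<tau> \<and> bij \<tau> \<and> (\<forall>a. \<tau> (emb a) = emb (id a)) \<and> \<tau> x = x \<and> \<tau> y = - y"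
  proof (rule aut_extension)
    show "field_hom (id :: 'a \<Rightarrow> 'a)" by (simp add: field_hom_def)
    show "(- y) ^ 2 = poly (map_poly (\<lambda>a. emb (id a)) f) x"
      using y_square by (simp add: ev_def)
    show "p = 0" if "poly (map_poly emb p) x = 0" for p
      using that ev_eq_0_iff[of p] by (simp add: ev_def)
    have "is_subfield (field_gen (range emb \<union> {x, - y}))" by (rule is_subfield_field_gen)
    moreover have "range emb \<union> {x, - y} \<subseteq> field_gen (range emb \<union> {x, - y})"
      by (rule field_gen_subset)
    ultimately have "range emb \<union> {x, y} \<subseteq> field_gen (range emb \<union> {x, - y})"
      unfolding is_subfield_def by (auto, metis diff_0 minus_minus)
    then have "field_gen (range emb \<union> {x, y}) \<subseteq> field_gen (range emb \<union> {x, - y})"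
      using is_subfield_field_gen by (rule field_gen_minimal)
    then show "field_gen (range emb \<union> {x, - y}) = UNIV" using generated by auto
  qed (rule bij_id)
  from theI'[OF this] show ?thesis unfolding bar_def id_apply .
qed

sublocale bar: fld_hom bar
  using bar by unfold_locales simp

lemma bar_emb [simp]: "bar (emb a) = emb a" and bar_x [simp]: "bar x = x" and bar_y [simp]: "bar y = - y"
  and bij_bar: "bij bar"
  using bar by auto

lemma bar_ev [simp]: "bar (ev p) = ev p"
  by (induction p) auto

lemma bar_bar [simp]: "bar (bar h) = h"
proof -
  have "(\<lambda>h. bar (bar h)) = (\<lambda>h. h)"
    using generated by (intro field_hom_eq_on_gen[of _ _ "range emb \<union> {x, y}"]) (auto simp: field_hom_def)
  then show ?thesis by metis
qed

lemma bar_fixed_repr: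
  assumes "bar h = h"
  shows "\<exists>p r. r \<noteq> 0 \<and> h = ev p / ev r"
proof -
  obtain p q r where r: "r \<noteq> 0" "h * ev r = ev p + ev q * y" using repr by blast
  have "bar (h * ev r) = bar (ev p + ev q * y)" using r(2) by (rule arg_cong)
  then have "h * ev r = ev p - ev q * y" using assms by simp
  then have "ev q * y = - (ev q * y)" using r(2) by simp
  then have "2 * (ev q * y) = 0" by (metis add.right_inverse mult_2)
  then have "q = 0" using two_F by simp
  then show ?thesis using r by (intro exI[of _ p] exI[of _ r]) (auto simp: field_simps)
qed

lemma decompose: "\<exists>A B. bar A = A \<and> bar B = B \<and> h = A + B * y"
proof (intro exI conjI)
  show "bar ((h + bar h) / 2) = (h + bar h) / 2" by (simp add: add.commute)
  show "bar ((h - bar h) / (2 * y)) = (h - bar h) / (2 * y)"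
    using two_F by (simp add: field_simps)
  have e: "(h - bar h) / (2 * y) * y = (h - bar h) / 2" by simp
  have "h = (2 * h) / 2" using two_F by simp
  also have "\<dots> = ((h + bar h) + (h - bar h)) / 2"
    unfolding mult_2 by (rule arg_cong[of _ _ "\<lambda>t. t / 2"]) (simp add: algebra_simps)
  also have "\<dots> = (h + bar h) / 2 + (h - bar h) / 2"
    by (rule add_divide_distrib)
  finally show "h = (h + bar h) / 2 + (h - bar h) / (2 * y) * y"
    unfolding e .
qed

lemma bar_neg_repr:
  assumes "bar h = - h"
  shows "bar (h / y) = h / y"
  using assms by simp

lemma points_bar: "v \<in> P \<Longrightarrow> v \<circ> bar \<in> P"
  using bar by (intro points_comp) auto

lemma v_fixed_over:
  assumes "v \<in> P" "hasval v x c" "bar A = A" "A \<noteq> 0"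
  shows "\<exists>k::int. v A = k * v (x - emb c) \<and>
    (\<forall>v'\<in>P. hasval v' x c \<longrightarrow> v' A = k * v' (x - emb c))"
proof -
  obtain p r where A: "r \<noteq> 0" "A = ev p / ev r" using bar_fixed_repr[OF assms(3)] by blast
  then have "p \<noteq> 0" using assms(4) by auto
  with A have "v' A = (int (order c p) - int (order c r)) * v' (x - emb c)"
    if "v' \<in> P" "hasval v' x c" for v'
    using that by (simp add: v_divide v_ev algebra_simps)
  then show ?thesis using assms(1,2) by blast
qed

lemma v_fixed_inf:
  assumes "v \<in> P" "v x < 0" "bar A = A" "A \<noteq> 0"
  shows "\<exists>k::int. v A = k * v x \<and> (\<forall>v'\<in>P. v' x < 0 \<longrightarrow> v' A = k * v' x)"
proof -
  obtain p r where A: "r \<noteq> 0" "A = ev p / ev r" using bar_fixed_repr[OF assms(3)] by blast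
  then have "p \<noteq> 0" using assms(4) by auto
  with A have "v' A = (int (degree p) - int (degree r)) * v' x"
    if "v' \<in> P" "v' x < 0" for v'
    using that by (simp add: v_divide v_ev_inf algebra_simps)
  then show ?thesis using assms(1,2) by blast
qed

text \<open>Otherwise all \<open>x - emb c\<close> are units, so \<open>v\<close> vanishes on the
  rational functions of \<open>x\<close>. A uniformizer \<open>t\<close> then has norm of value 0,
  so \<open>bar t\<close> has value -1, and the trace \<open>t + bar t\<close> also has value -1
  although it is rational in \<open>x\<close>.\<close>

lemma point_cases:
  assumes "v \<in> P"
  shows "v x < 0 \<or> (\<exists>c. hasval v x c)"
proof (rule ccontr)
  assume neg: "\<not> ?thesis"
  have x0: "x \<noteq> 0" using x_neq_emb[OF assms, of 0] by simp
  have xc: "v (x - emb c) = 0" for c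
  proof -
    have "vnn v (x + emb (- c))"
      using neg by (intro vnn_add[OF assms] vnn_emb[OF assms]) (simp add: vnn_def)
    then have "0 \<le> v (x - emb c)" using x_neq_emb[OF assms] by (simp add: vnn_def)
    then show ?thesis using neg over_hasval[OF assms, of c] by force
  qed
  have v_ev0: "v (ev p) = 0" if "p \<noteq> 0" for p
    using that
  proof (induction "degree p" arbitrary: p)
    case 0
    then obtain c where "p = [:c:]" by (metis degree_eq_zeroE)
    then show ?case using assms by simp
  next
    case (Suc n)
    then obtain c where "poly p c = 0" using alg_closed_imp_poly_has_root[of p] by auto
    then obtain q where q: "p = [:- c, 1:] * q" by (metis poly_eq_0_iff_dvd dvdE)
    have q0: "q \<noteq> 0" using Suc.prems q by auto
    then have "degree q = n"
      using Suc.hyps(2) unfolding q by (subst (asm) degree_mult_eq) auto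
    then have "v (ev q) = 0" using Suc.hyps(1)[of q] q0 by auto
    moreover have "ev p = (x - emb c) * ev q" unfolding q ev_mult by simp
    ultimately show ?case using v_mult[OF assms, of "x - emb c" "ev q"] xc q0 x_neq_emb[OF assms] by simp
  qed
  have fixed0: "v A = 0" if A: "bar A = A" "A \<noteq> 0" for A
  proof -
    obtain p r where "r \<noteq> 0" "A = ev p / ev r" using bar_fixed_repr[OF A(1)] by blast
    then show ?thesis using A(2) assms by (auto simp: v_divide v_ev0)
  qed
  obtain t where t: "t \<noteq> 0" "v t = 1" using v_uniformizer[OF assms] by blast
  have "v (t * bar t) = 0" using t by (intro fixed0) (auto simp: mult.commute)
  then have "v (bar t) = - 1" using t assms by (simp add: v_mult)
  then have "bar t + t \<noteq> 0 \<and> v (bar t + t) = - 1"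
    using v_add_lt[OF assms, of "bar t" t] t by auto
  moreover have "v (bar t + t) = 0 \<or> bar t + t = 0"
    using fixed0[of "bar t + t"] by (auto simp: add.commute)
  ultimately show False by auto
qed

lemma not_both_cases: "v \<in> P \<Longrightarrow> v x < 0 \<Longrightarrow> \<not> hasval v x c"
  using hasval_vnn[of v x c] by (auto simp: vnn_def x_neq_emb[of v 0, simplified])

text \<open>These are the Weierstrass points.\<close>

definition ramified :: "('f \<Rightarrow> int) \<Rightarrow> bool" where
  "ramified v \<longleftrightarrow> v \<in> P \<and> (\<forall>A. bar A = A \<longrightarrow> A \<noteq> 0 \<longrightarrow> even (v A)) \<and> odd (v y)"

text \<open>In \<open>A + B * y\<close> one summand has a value that is an even multiple of
  \<open>u\<close> and the other an odd multiple, so no cancellation occurs and all values are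
  multiples of \<open>u\<close>. As some element has value 1, \<open>u\<close> is a unit of the
  integers.\<close>

lemma ramified_multiples:
  assumes v: "v \<in> P" and u: "u \<noteq> 0" and A: "\<And>A. bar A = A \<Longrightarrow> A \<noteq> 0 \<Longrightarrow> \<exists>k. v A = 2 * k * u"
    and y: "v y = (2 * l + 1) * u"
  shows "\<bar>u\<bar> = 1 \<and> ramified v"
proof -
  have dvd: "u dvd v h" if "h \<noteq> 0" for h
  proof -
    obtain A B where h: "bar A = A" "bar B = B" "h = A + B * y" using decompose by blast
    show ?thesis
    proof (cases "A = 0 \<or> B = 0")
      case True
      then show ?thesis using h that A[of A] A[of B] v y by (auto simp: v_mult)
    next
      case False
      obtain k l' where k: "v A = 2 * k * u" "v B = 2 * l' * u" using False A h by metis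
      then have By: "v (B * y) = (2 * (l + l') + 1) * u" using False v y by (simp add: v_mult algebra_simps)
      have "2 * k * u \<noteq> (2 * (l + l') + 1) * u" using u by (simp, presburger)
      then have ne: "v A \<noteq> v (B * y)" using k By by simp
      then have "v h = v A \<or> v h = v (B * y)"
        using v_add_lt[OF v, of A "B * y"] v_add_lt[OF v, of "B * y" A] False h(3)
        by (cases "v A < v (B * y)") (auto simp: add.commute)
      then show ?thesis using k By by auto
    qed
  qed
  obtain t where "t \<noteq> 0" "v t = 1" using v_uniformizer[OF v] by blast
  then have u1: "\<bar>u\<bar> = 1" using dvd[of t] by auto
  moreover have "even (v B)" if "bar B = B" "B \<noteq> 0" for B using A[OF that] by auto
  moreover have "odd (v y)"
  proof -
    have "u = 1 \<or> u = - 1" using u1 by linarith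
    then have "odd u" by auto
    then show ?thesis using y by simp
  qed
  ultimately show ?thesis using v by (auto simp: ramified_def)
qed

lemma ramified_min:
  assumes "ramified v" "bar A = A" "bar B = B" "A \<noteq> 0" "B \<noteq> 0"
  shows "A + B * y \<noteq> 0 \<and> v (A + B * y) = min (v A) (v B + v y)"
proof -
  have v: "v \<in> P" using assms by (simp add: ramified_def)
  have By: "v (B * y) = v B + v y" using assms(5) v by (simp add: v_mult)
  have "even (v A)" "odd (v B + v y)" using assms by (auto simp: ramified_def)
  then have "v A \<noteq> v (B * y)" using By by auto
  then show ?thesis
    using v_add_lt[OF v, of A "B * y"] v_add_lt[OF v, of "B * y" A] assms By
    by (cases "v A < v (B * y)") (auto simp: add.commute)
qed

text \<open>By \<open>ramified_min\<close> the value of \<open>A + B * y\<close> is a minimum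
  computed from values on \<open>k(x)\<close> and at \<open>y\<close>.\<close>

lemma ramified_unique:
  assumes v: "ramified v" and v': "ramified v'" and y: "v y = v' y"
    and A: "\<And>A. bar A = A \<Longrightarrow> A \<noteq> 0 \<Longrightarrow> v A = v' A"
  shows "v = v'"
proof
  fix h
  have P: "v \<in> P" "v' \<in> P" using v v' by (auto simp: ramified_def)
  obtain A' B where h: "bar A' = A'" "bar B = B" "h = A' + B * y" using decompose by blast
  consider "A' = 0" "B = 0" | "A' = 0" "B \<noteq> 0" | "A' \<noteq> 0" "B = 0" | "A' \<noteq> 0" "B \<noteq> 0" by blast
  then show "v h = v' h"
  proof cases
    case 4
    then show ?thesis using ramified_min[OF v h(1,2)] ramified_min[OF v' h(1,2)] A[of A'] A[of B] y h by simp
  qed (use h A P y in \<open>auto simp: v_mult\<close>)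
qed

lemma v_y2: "v \<in> P \<Longrightarrow> 2 * v y = v (ev f)"
  using v_power[of v y 2] y_square by simp

text \<open>\<open>b i\<close> is a simple root of \<open>f\<close>, so \<open>y^2\<close> vanishes
  to the same order as \<open>x - emb (b i)\<close>. Hence \<open>u = v y\<close> can serve in
  \<open>ramified_multiples\<close>.\<close>

lemma branch_point:
  assumes "v \<in> P" "i \<in> I" "hasval v x (b i)"
  shows "ramified v \<and> v (x - emb (b i)) = 2 \<and> v y = 1"
proof -
  have y: "v (x - emb (b i)) = 2 * v y"
    using v_y2[OF assms(1)] v_ev[OF assms(1,3) f_nz] assms(2) by (simp add: order_f)
  have pos: "0 < v y" using y assms(3) over_hasval[OF assms(1), of "b i"] by simp
  have "\<bar>v y\<bar> = 1 \<and> ramified v"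
  proof (rule ramified_multiples[OF assms(1), where l = 0])
    show "\<exists>k. v A = 2 * k * v y" if "bar A = A" "A \<noteq> 0" for A
      using v_fixed_over[OF assms(1,3) that] y by (auto simp: algebra_simps)
  qed (use pos in auto)
  then show ?thesis using pos y by simp
qed

text \<open>The degree of \<open>f\<close> is odd, so \<open>2 * v y = deg f * v x\<close> forces
  \<open>v x\<close> to be even; half of it serves as \<open>u\<close> in
  \<open>ramified_multiples\<close>.\<close>

lemma infinite_point:
  assumes "v \<in> P" "v x < 0"
  shows "ramified v \<and> v x = - 2 \<and> v y = - int (card I)"
proof -
  obtain m where m: "card I = 2 * m + 1" using odd_card by (auto elim: oddE)
  have y: "2 * v y = (2 * int m + 1) * v x"
    using v_y2[OF assms(1)] v_ev_inf[OF assms f_nz] m by (simp add: degree_f)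
  then have "even ((2 * int m + 1) * v x)" by (metis dvd_triv_left)
  then have "even (v x)" by simp
  then obtain u where u: "v x = 2 * u" by auto
  then have vy: "v y = (2 * int m + 1) * u" using y by (simp add: algebra_simps)
  have "\<bar>u\<bar> = 1 \<and> ramified v"
  proof (rule ramified_multiples[OF assms(1)])
    show "u \<noteq> 0" using u assms by auto
    show "\<exists>k. v A = 2 * k * u" if "bar A = A" "A \<noteq> 0" for A
      using v_fixed_inf[OF assms that] u by (auto simp: algebra_simps)
  qed (use vy in auto)
  moreover have "u < 0" using u assms by auto
  ultimately have "u = - 1" by auto
  then show ?thesis using \<open>\<bar>u\<bar> = 1 \<and> ramified v\<close> u vy m by simp
qed

lemma branch_point_unique:
  assumes "v \<in> P" "v' \<in> P" "i \<in> I" "hasval v x (b i)" "hasval v' x (b i)"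
  shows "v = v'"
proof (rule ramified_unique)
  show "v A = v' A" if "bar A = A" "A \<noteq> 0" for A
    using v_fixed_over[OF assms(1,4) that] branch_point[OF assms(1,3,4)] branch_point[OF assms(2,3,5)] assms
    by auto
qed (use branch_point[OF assms(1,3,4)] branch_point[OF assms(2,3,5)] in auto)

lemma infinite_point_unique:
  assumes "v \<in> P" "v' \<in> P" "v x < 0" "v' x < 0"
  shows "v = v'"
proof (rule ramified_unique)
  show "v A = v' A" if "bar A = A" "A \<noteq> 0" for A
    using v_fixed_inf[OF assms(1,3) that] infinite_point[OF assms(1,3)] infinite_point[OF assms(2,4)] assms
    by auto
qed (use infinite_point[OF assms(1,3)] infinite_point[OF assms(2,4)] in auto)

text \<open>The factor \<open>k\<close> is the same for all such \<open>v\<close>, which gives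
  uniqueness of the point. If \<open>p + q y\<close> vanishes there and its conjugate does not, its
  order is that of the norm, a polynomial in \<open>x\<close>. If both vanish, then
  \<open>s \<noteq> 0\<close> makes \<open>p\<close> and \<open>q\<close> vanish at
  \<open>c\<close>, and \<open>x - c\<close> is divided out.\<close>

lemma v_over_aux:
  assumes "s ^ 2 = poly f c" "s \<noteq> 0" "p \<noteq> 0 \<or> q \<noteq> 0"
  shows "\<exists>k::int. \<forall>v\<in>P. hasval v x c \<longrightarrow> hasval v y s \<longrightarrow> v (ev p + ev q * y) = k * v (x - emb c)"
  using assms(3)
proof (induction "degree p + degree q" arbitrary: p q rule: less_induct)
  case less
  have val: "hasval v (ev p + ev q * y) (poly p c + poly q c * s)"
    if "v \<in> P" "hasval v x c" "hasval v y s" for v p q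
    using that by (intro hasval_add hasval_mult hasval_ev) auto
  consider "poly p c + poly q c * s \<noteq> 0" | "poly p c + poly q c * s = 0" "poly p c + poly (- q) c * s \<noteq> 0"
    | "poly p c = 0" "poly q c = 0"
  proof (cases "poly p c + poly q c * s = 0 \<and> poly p c + poly (- q) c * s = 0")
    case True
    have "2 * (poly q c * s) = (poly p c + poly q c * s) - (poly p c + poly (- q) c * s)" by simp
    also have "\<dots> = 0" using True by (simp only: diff_zero)
    finally have "poly q c = 0" using two assms(2) by (simp only: mult_eq_0_iff) simp
    then show ?thesis using True that by auto
  qed (use that in blast)
  then show ?case
  proof cases
    case 1
    then show ?thesis using val hasval_unit by (intro exI[of _ 0]) force
  next
    case 2
    let ?n = "p ^ 2 - q ^ 2 * f"
    have n: "?n \<noteq> 0" using less.prems by (rule norm_neq_0)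
    have "v (ev p + ev q * y) = int (order c ?n) * v (x - emb c)"
      if v: "v \<in> P" "hasval v x c" "hasval v y s" for v
    proof -
      have u: "ev p + ev (- q) * y \<noteq> 0 \<and> v (ev p + ev (- q) * y) = 0"
        using hasval_unit[OF v(1) val[OF v] 2(2)] .
      have mq: "ev (- q) = - ev q" using ev_diff[of 0 q] by simp
      have "(ev p + ev q * y) * (ev p + ev (- q) * y) = ev ?n"
        using ev_y_norm[of p q] by (simp add: mq)
      then have "v (ev p + ev q * y) + 0 = v (ev ?n)"
        using u v_mult[OF v(1)] ev_y_eq_0[of p q] less.prems by metis
      then show ?thesis using v_ev[OF v(1,2) n] by simp
    qed
    then show ?thesis by blast
  next
    case 3
    then obtain p' q' where pq: "p = [:- c, 1:] * p'" "q = [:- c, 1:] * q'"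
      by (metis poly_eq_0_iff_dvd dvdE)
    have nz: "p' \<noteq> 0 \<or> q' \<noteq> 0" using less.prems pq by auto
    have d: "degree ([:- c, 1:] * r) = (if r = 0 then 0 else Suc (degree r))" for r
      by (cases "r = 0") (simp_all add: degree_mult_eq del: mult_pCons_left)
    have "degree p' + degree q' < degree p + degree q"
      using nz unfolding pq d by auto
    from less.hyps[OF this nz] obtain k where
      k: "\<And>v. v \<in> P \<Longrightarrow> hasval v x c \<Longrightarrow> hasval v y s \<Longrightarrow> v (ev p' + ev q' * y) = k * v (x - emb c)"
      by blast
    have "v (ev p + ev q * y) = (k + 1) * v (x - emb c)"
      if v: "v \<in> P" "hasval v x c" "hasval v y s" for v
    proof -
      have "ev p' + ev q' * y \<noteq> 0" using ev_y_eq_0[of p' q'] nz by auto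
      then have "v ((x - emb c) * (ev p' + ev q' * y)) = v (x - emb c) + k * v (x - emb c)"
        using k[OF v] v_mult[OF v(1)] x_neq_emb[OF v(1)] by simp
      moreover have "ev p + ev q * y = (x - emb c) * (ev p' + ev q' * y)"
        unfolding pq ev_mult by (simp add: algebra_simps)
      ultimately show ?thesis by (simp add: distrib_right)
    qed
    then show ?thesis by blast
  qed
qed

lemma v_over_multiple:
  assumes "s ^ 2 = poly f c" "s \<noteq> 0" "h \<noteq> 0"
  shows "\<exists>k::int. \<forall>v\<in>P. hasval v x c \<longrightarrow> hasval v y s \<longrightarrow> v h = k * v (x - emb c)"
proof -
  obtain p q r where r: "r \<noteq> 0" "h * ev r = ev p + ev q * y" using repr by blast
  have "p \<noteq> 0 \<or> q \<noteq> 0" using r assms(3) by auto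
  from v_over_aux[OF assms(1,2) this] obtain k where
    k: "\<And>v. v \<in> P \<Longrightarrow> hasval v x c \<Longrightarrow> hasval v y s \<Longrightarrow> v (h * ev r) = k * v (x - emb c)"
    unfolding r by blast
  have "v h = (k - int (order c r)) * v (x - emb c)" if "v \<in> P" "hasval v x c" "hasval v y s" for v
    using k[OF that] v_ev[OF that(1,2) r(1)] v_mult[OF that(1) assms(3), of "ev r"] r(1)
    by (simp add: algebra_simps)
  then show ?thesis by blast
qed

lemma ordinary_point:
  assumes "v \<in> P" "hasval v x c" "hasval v y s" "s ^ 2 = poly f c" "s \<noteq> 0"
  shows "v (x - emb c) = 1"
proof -
  obtain t where t: "t \<noteq> 0" "v t = 1" using v_uniformizer[OF assms(1)] by blast
  obtain k :: int where "v t = k * v (x - emb c)"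
    using v_over_multiple[OF assms(4,5) t(1)] assms by blast
  moreover have "0 < v (x - emb c)" using over_hasval[OF assms(1)] assms(2) by simp
  ultimately show ?thesis using t by (auto simp: zmult_eq_1_iff)
qed

lemma ordinary_point_unique:
  assumes "v \<in> P" "v' \<in> P" "hasval v x c" "hasval v y s" "hasval v' x c" "hasval v' y s"
    "s ^ 2 = poly f c" "s \<noteq> 0"
  shows "v = v'"
proof
  fix h
  show "v h = v' h"
  proof (cases "h = 0")
    case False
    obtain k :: int where "v h = k * v (x - emb c)" "v' h = k * v' (x - emb c)"
      using v_over_multiple[OF assms(7,8) False] assms by blast
    then show ?thesis
      using ordinary_point[OF assms(1,3,4,7,8)] ordinary_point[OF assms(2,5,6,7,8)] by simp
  qed (use assms in simp)
qed

lemma ordinary_point_y: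
  assumes "v \<in> P" "hasval v x c" "s ^ 2 = poly f c"
  shows "hasval v y s \<or> hasval v y (- s)"
proof -
  have "hasval v (y ^ 2) (s ^ 2)" unfolding y_square assms(3) by (rule hasval_ev[OF assms(1,2)])
  then have "vpos v ((y - emb s) * (y - emb (- s)))"
    by (simp add: hasval_def algebra_simps power2_eq_square)
  then show ?thesis using vpos_multD[OF assms(1)] by (auto simp: hasval_def)
qed

end

section \<open>Existence of points from parametrisations by Laurent series\<close>

lemma fps_prod_nth_0: "fps_nth (prod g A) 0 = (\<Prod>i\<in>A. fps_nth (g i :: 'a::comm_ring_1 fps) 0)"
  by (induction A rule: infinite_finite_induct) auto

lemma fps_to_fls_prod: "fps_to_fls (prod g A) = (\<Prod>i\<in>A. fps_to_fls (g i :: 'a::comm_ring_1 fps))"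
  by (induction A rule: infinite_finite_induct) (auto simp: fls_times_fps_to_fls)

context odd_model
begin

lemma fls_point:
  fixes x' y' :: "'a fls"
  assumes y': "y' ^ 2 = (\<Prod>i\<in>I. x' - fls_const (b i))"
    and x': "\<And>c. x' \<noteq> fls_const c"
  shows "\<exists>\<Phi>. field_hom \<Phi> \<and> (\<forall>a. \<Phi> (emb a) = fls_const a) \<and> \<Phi> x = x' \<and> \<Phi> y = y'"
proof (rule hom_extension)
  show hom: "field_hom (fls_const :: 'a \<Rightarrow> 'a fls)"
    by (simp add: field_hom_def fls_plus_const)
  interpret c: fld_hom "fls_const :: 'a \<Rightarrow> 'a fls" by unfold_locales (fact hom)
  show "p = 0" if "poly (map_poly fls_const p) x' = 0" for p
    using field_hom_transcendental[OF hom _ that] x' by auto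
  have "map_poly fls_const f = (\<Prod>i\<in>I. [:- fls_const (b i), 1:])"
    unfolding f_def by simp
  then show "y' ^ 2 = poly (map_poly fls_const f) x'"
    using y' by (simp add: poly_prod)
qed

lemma nonzero_sqrt: "\<exists>s. s ^ 2 = (c::'a)"
  using nth_root_exists[of 2 c] by auto

text \<open>Parametrise by \<open>x = b i + T^2\<close> and \<open>y = T * G\<close>, where
  \<open>G^2\<close> is the product of the other factors of \<open>f\<close>. The roots are
  distinct, so this product has nonzero constant term and \<open>G\<close> exists; \<open>y\<close>
  has order 1.\<close>

lemma ex_point_branch:
  assumes "i \<in> I"
  shows "\<exists>v\<in>P. hasval v x (b i)"
proof -
  let ?F = "\<Prod>j\<in>I - {i}. fps_const (b i - b j) + fps_X ^ 2 :: 'a fps"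
  have F0: "fps_nth ?F 0 = (\<Prod>j\<in>I - {i}. b i - b j)"
    by (simp add: fps_prod_nth_0)
  obtain s where s: "s ^ 2 = (\<Prod>j\<in>I - {i}. b i - b j)" using nonzero_sqrt by blast
  have "(\<Prod>j\<in>I - {i}. b i - b j) \<noteq> 0"
    using fin inj_b assms by (auto simp: inj_on_def)
  then have "s \<noteq> 0" using s by auto
  then obtain G where G: "G ^ 2 = ?F" using fps_sqrt_exists[of ?F s] F0 s two by auto
  let ?x = "fls_const (b i) + fls_X ^ 2 :: 'a fls" and ?y = "fls_X * fps_to_fls G"
  have d: "?x - fls_const (b j) = fps_to_fls (fps_const (b i - b j) + fps_X ^ 2)" for j
    by (simp add: fps_to_fls_power fls_minus_const[symmetric] algebra_simps)
  have "?y ^ 2 = fls_X ^ 2 * fps_to_fls (G ^ 2)"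
    by (simp add: power_mult_distrib fps_to_fls_power)
  also have "\<dots> = (?x - fls_const (b i)) * (\<Prod>j\<in>I - {i}. ?x - fls_const (b j))"
    unfolding G fps_to_fls_prod d[symmetric] by simp
  also have "\<dots> = (\<Prod>j\<in>I. ?x - fls_const (b j))"
    using fin assms by (simp add: prod.remove)
  finally have y2: "?y ^ 2 = (\<Prod>j\<in>I. ?x - fls_const (b j))" .
  have x': "?x \<noteq> fls_const c" for c
  proof
    assume "?x = fls_const c"
    then have "fls_nth ?x 2 = fls_nth (fls_const c) 2" by simp
    then show False by (simp add: fls_X_power_nth)
  qed
  obtain \<Phi> where \<Phi>: "field_hom \<Phi>" "\<And>a. \<Phi> (emb a) = fls_const a" "\<Phi> x = ?x" "\<Phi> y = ?y"
    using fls_point[OF y2 x'] by blast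
  interpret h: fld_hom \<Phi> by unfold_locales fact
  have "fps_nth (G ^ 2) 0 \<noteq> 0" unfolding G F0 by fact
  then have "fps_nth G 0 \<noteq> 0" by (auto simp: power2_eq_square)
  then have "subdegree G = 0" "G \<noteq> 0" by auto
  then have "fls_subdegree (\<Phi> y) = 1" using \<Phi>(4) by (simp add: fls_subdegree_fls_to_fps)
  then have "(\<lambda>h. fls_subdegree (\<Phi> h)) \<in> P" using points_fls[of \<Phi> y] \<Phi> by blast
  moreover have "hasval (\<lambda>h. fls_subdegree (\<Phi> h)) x (b i)"
    unfolding hasval_def vpos_def by (simp add: \<Phi>)
  ultimately show ?thesis by blast
qed

text \<open>Here \<open>x - c\<close> is the parameter, and \<open>f\<close> expanded at
  \<open>c\<close> has a nonzero constant term, hence a square root.\<close>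

lemma ex_point_ordinary:
  assumes "c \<notin> b ` I"
  shows "\<exists>v\<in>P. hasval v x c"
proof -
  let ?F = "\<Prod>j\<in>I. fps_const (c - b j) + fps_X :: 'a fps"
  have F0: "fps_nth ?F 0 = (\<Prod>j\<in>I. c - b j)"
    by (simp add: fps_prod_nth_0)
  obtain s where s: "s ^ 2 = (\<Prod>j\<in>I. c - b j)" using nonzero_sqrt by blast
  have "(\<Prod>j\<in>I. c - b j) \<noteq> 0"
    using fin assms by auto
  then have "s \<noteq> 0" using s by auto
  then obtain G where G: "G ^ 2 = ?F" using fps_sqrt_exists[of ?F s] F0 s two by auto
  let ?x = "fls_const c + fls_X :: 'a fls" and ?y = "fps_to_fls G"
  have d: "?x - fls_const (b j) = fps_to_fls (fps_const (c - b j) + fps_X)" for j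
    by (simp add: fls_minus_const[symmetric] algebra_simps)
  have y2: "?y ^ 2 = (\<Prod>j\<in>I. ?x - fls_const (b j))"
    unfolding fps_to_fls_power[symmetric] G fps_to_fls_prod d[symmetric] by simp
  have x': "?x \<noteq> fls_const a" for a
  proof
    assume "?x = fls_const a"
    then have "fls_nth ?x 1 = fls_nth (fls_const a) 1" by simp
    then show False by simp
  qed
  obtain \<Phi> where \<Phi>: "field_hom \<Phi>" "\<And>a. \<Phi> (emb a) = fls_const a" "\<Phi> x = ?x" "\<Phi> y = ?y"
    using fls_point[OF y2 x'] by blast
  interpret h: fld_hom \<Phi> by unfold_locales fact
  have "fls_subdegree (\<Phi> (x - emb c)) = 1" by (simp add: \<Phi>)
  then have "(\<lambda>h. fls_subdegree (\<Phi> h)) \<in> P" using points_fls[of \<Phi> "x - emb c"] \<Phi> by blast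
  moreover have "hasval (\<lambda>h. fls_subdegree (\<Phi> h)) x c"
    unfolding hasval_def vpos_def by (simp add: \<Phi>)
  ultimately show ?thesis by blast
qed

lemma ex_point: "\<exists>v\<in>P. hasval v x c"
  using ex_point_branch ex_point_ordinary[of c] by (cases "c \<in> b ` I") auto

text \<open>Parametrise by \<open>x = T^(-2)\<close> and \<open>y = T^(-card I) * G\<close>, with
  \<open>G^2\<close> the product of all \<open>1 - b j * T^2\<close>.\<close>

lemma ex_point_infinite: "\<exists>v\<in>P. v x < 0"
proof -
  let ?F = "\<Prod>j\<in>I. 1 - fps_const (b j) * fps_X ^ 2 :: 'a fps"
  have F0: "fps_nth ?F 0 = 1"
    by (simp add: fps_prod_nth_0)
  then obtain G where G: "G ^ 2 = ?F" "fps_nth G 0 = 1" using fps_sqrt_exists[of ?F 1] two by auto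
  obtain m where m: "card I = 2 * m + 1" using odd_card by (auto elim: oddE)
  let ?x = "inverse fls_X ^ 2 :: 'a fls" and ?y = "inverse fls_X ^ card I * fps_to_fls G"
  have d: "?x - fls_const (b j) = inverse fls_X ^ 2 * fps_to_fls (1 - fps_const (b j) * fps_X ^ 2)" for j
  proof -
    have "(inverse fls_X ^ 2 :: 'a fls) * fls_X ^ 2 = 1"
      by (simp flip: power_mult_distrib)
    then show ?thesis by (simp add: fps_to_fls_power fls_times_fps_to_fls algebra_simps)
  qed
  have y2: "?y ^ 2 = (\<Prod>j\<in>I. ?x - fls_const (b j))"
    unfolding d prod.distrib fps_to_fls_prod[symmetric] power_mult_distrib fps_to_fls_power[symmetric] G
    by (simp add: power_mult[symmetric] mult.commute)
  have x': "?x \<noteq> fls_const c" for c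
  proof
    assume "?x = fls_const c"
    then have "fls_subdegree ?x = fls_subdegree (fls_const c)" by simp
    then show False by (simp add: fls_subdegree_pow)
  qed
  obtain \<Phi> where \<Phi>: "field_hom \<Phi>" "\<And>a. \<Phi> (emb a) = fls_const a" "\<Phi> x = ?x" "\<Phi> y = ?y"
    using fls_point[OF y2 x'] by blast
  interpret h: fld_hom \<Phi> by unfold_locales fact
  have "G \<noteq> 0" "subdegree G = 0" using G(2) by auto
  then have sy: "fls_subdegree (\<Phi> y) = - int (card I)"
    by (simp add: \<Phi> fls_subdegree_pow fls_subdegree_fls_to_fps)
  have sx: "fls_subdegree (\<Phi> x) = - 2" by (simp add: \<Phi> fls_subdegree_pow)
  \<comment> \<open>With \<open>card I = 2 * m + 1\<close>, the order of
    \<open>y / x^(m + 1)\<close> is \<open>- (2 * m + 1) + 2 * (m + 1) = 1\<close>. The same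
    uniformizer reappears in the Kummer map.\<close>
  have "\<Phi> x ^ (m + 1) \<noteq> 0" by (simp add: \<Phi>)
  then have "fls_subdegree (\<Phi> (y / x ^ (m + 1))) = - int (card I) + int (m + 1) * 2"
    using sx sy \<open>G \<noteq> 0\<close> by (simp add: fls_divide_subdegree \<Phi> fls_subdegree_pow fls_subdegree_fls_to_fps)
  then have "fls_subdegree (\<Phi> (y / x ^ (m + 1))) = 1" using m by simp
  then have "(\<lambda>h. fls_subdegree (\<Phi> h)) \<in> P" using points_fls[of \<Phi>] \<Phi> by blast
  then show ?thesis using sx by (intro bexI[of _ "\<lambda>h. fls_subdegree (\<Phi> h)"]) auto
qed

section \<open>The Weierstrass points and the divisor of \<open>x - c\<close>\<close>

definition e :: "'i \<Rightarrow> 'f \<Rightarrow> int" where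
  "e i = (THE v. v \<in> P \<and> hasval v x (b i))"

definition pinf :: "'f \<Rightarrow> int" where
  "pinf = (THE v. v \<in> P \<and> v x < 0)"

lemma e: assumes "i \<in> I" shows "e i \<in> P" "hasval (e i) x (b i)"
proof -
  have "\<exists>!v. v \<in> P \<and> hasval v x (b i)"
    using ex_point_branch[OF assms] branch_point_unique[OF _ _ assms] by blast
  from theI'[OF this] show "e i \<in> P" "hasval (e i) x (b i)" by (auto simp: e_def)
qed

lemma pinf: "pinf \<in> P" "pinf x < 0"
proof -
  have "\<exists>!v. v \<in> P \<and> v x < 0"
    using ex_point_infinite infinite_point_unique by blast
  from theI'[OF this] show "pinf \<in> P" "pinf x < 0" by (auto simp: pinf_def)
qed

lemma e_eqI: "v \<in> P \<Longrightarrow> i \<in> I \<Longrightarrow> hasval v x (b i) \<Longrightarrow> v = e i"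
  using branch_point_unique e by blast

lemma pinf_eqI: "v \<in> P \<Longrightarrow> v x < 0 \<Longrightarrow> v = pinf"
  using infinite_point_unique pinf by blast

lemma e_inj: "i \<in> I \<Longrightarrow> j \<in> I \<Longrightarrow> e i = e j \<longleftrightarrow> i = j"
  using hasval_unique[of "e i" x "b i" "b j"] e inj_b by (auto simp: inj_on_def)

lemma e_neq_pinf: "i \<in> I \<Longrightarrow> e i \<noteq> pinf"
  using not_both_cases[OF pinf, of "b i"] e by metis

definition W :: "('f \<Rightarrow> int) set" where
  "W = insert pinf (e ` I)"

lemma W_ramified: "w \<in> W \<Longrightarrow> ramified w"
  using infinite_point[OF pinf] branch_point e by (auto simp: W_def)

lemma e_y: "i \<in> I \<Longrightarrow> e i y = 1"
  and e_x: "i \<in> I \<Longrightarrow> j \<in> I \<Longrightarrow> e i (x - emb (b j)) = (if i = j then 2 else 0)"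
  and pinf_y: "pinf y = - int (card I)"
  and pinf_x: "pinf (x - emb c) = - 2"
proof -
  show "e i y = 1" if "i \<in> I" using branch_point[OF e(1)] e that by blast
  show "pinf y = - int (card I)" using infinite_point[OF pinf] by simp
  have "pinf (ev [:- c, 1:]) = - 2"
    using v_ev_inf[OF pinf, of "[:- c, 1:]"] infinite_point[OF pinf] by (simp del: ev_pCons)
  then show "pinf (x - emb c) = - 2" by simp
  show "e i (x - emb (b j)) = (if i = j then 2 else 0)" if ij: "i \<in> I" "j \<in> I"
  proof (cases "i = j")
    case True
    then show ?thesis using branch_point[OF e(1) _ e(2)] ij by auto
  next
    case False
    have "hasval (e i) (x - emb (b j)) (b i - b j)"
      using ij e by (intro hasval_diff hasval_emb) auto
    moreover have "b i - b j \<noteq> 0" using False ij inj_b by (auto simp: inj_on_def)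
    ultimately show ?thesis using hasval_unit[OF e(1)[OF ij(1)]] False by auto
  qed
qed

lemma vpos_bar: "vpos (v \<circ> bar) h \<longleftrightarrow> vpos v (bar h)"
  by (simp add: vpos_def)

lemma bar_over: "hasval v x c \<Longrightarrow> hasval (v \<circ> bar) x c"
  unfolding hasval_def vpos_bar by simp

lemma W_bar: "w \<in> W \<Longrightarrow> w \<circ> bar = w"
proof -
  assume "w \<in> W"
  then consider "w = pinf" | i where "i \<in> I" "w = e i" by (auto simp: W_def)
  then show "w \<circ> bar = w"
  proof cases
    case 1
    then show ?thesis using pinf_eqI[OF points_bar[OF pinf(1)]] pinf by simp
  next
    case 2
    then show ?thesis using e_eqI[OF points_bar[OF e(1)] _ bar_over[OF e(2)]] by simp
  qed
qed

lemma point_over: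
  assumes "v \<in> P"
  obtains (inf) "v = pinf" | (branch) i where "i \<in> I" "v = e i"
    | (ordinary) c s where "c \<notin> b ` I" "hasval v x c" "s ^ 2 = poly f c" "s \<noteq> 0" "hasval v y s"
proof -
  consider "v x < 0" | i where "i \<in> I" "hasval v x (b i)" | c where "c \<notin> b ` I" "hasval v x c"
  proof -
    assume *: "v x < 0 \<Longrightarrow> thesis" "\<And>i. i \<in> I \<Longrightarrow> hasval v x (b i) \<Longrightarrow> thesis"
      "\<And>c. c \<notin> b ` I \<Longrightarrow> hasval v x c \<Longrightarrow> thesis"
    show thesis
    proof (cases "v x < 0")
      case False
      then obtain c where "hasval v x c" using point_cases[OF assms] by auto
      then show thesis using *(2,3) by (cases "c \<in> b ` I") auto
    qed (rule *(1))
  qed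
  then show ?thesis
  proof cases
    case 1
    then show ?thesis using inf[OF pinf_eqI[OF assms]] by simp
  next
    case 2
    then show ?thesis using branch[OF 2(1) e_eqI[OF assms 2]] by simp
  next
    case 3
    obtain s where s: "s ^ 2 = poly f c" using nonzero_sqrt by blast
    have "poly f c \<noteq> 0" using 3 fin by (auto simp: poly_f)
    then have "s \<noteq> 0" using s by auto
    show ?thesis using ordinary_point_y[OF assms 3(2) s]
    proof
      assume "hasval v y (- s)"
      moreover have "(- s) ^ 2 = poly f c" "- s \<noteq> 0" using s \<open>s \<noteq> 0\<close> by simp_all
      ultimately show ?thesis using ordinary[OF 3, of "- s"] \<open>hasval v y (- s)\<close> by simp
    qed (rule ordinary[OF 3 s \<open>s \<noteq> 0\<close>])
  qed
qed

text \<open>Two separate indicator terms cover both kinds of fibre: for a branch point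
  \<open>q = q \<circ> bar\<close> they add up to the double zero, otherwise the two points over
  \<open>c\<close> are distinguished by the values \<open>s\<close> and \<open>- s\<close> of
  \<open>y\<close>.\<close>

lemma v_x_minus_c:
  assumes q: "q \<in> P" "hasval q x c" and v: "v \<in> P"
  shows "v (x - emb c) = (if v = q then 1 else 0) + (if v = q \<circ> bar then 1 else 0) - (if v = pinf then 2 else 0)"
proof (cases "v = pinf")
  case True
  then have "\<not> hasval v x c" using not_both_cases[OF v] pinf by auto
  then have "v \<noteq> q" "v \<noteq> q \<circ> bar" using q(2) bar_over[OF q(2)] by metis+
  then show ?thesis using True pinf_x by simp
next
  case False
  then obtain a where a: "hasval v x a" using point_cases[OF v] pinf_eqI[OF v] by blast
  show ?thesis
  proof (cases "a = c")
    case neq: False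
    have "hasval v (x - emb c) (a - c)" using a v by (intro hasval_diff hasval_emb)
    then have "v (x - emb c) = 0" using hasval_unit[OF v] neq by simp
    moreover have "v \<noteq> q" "v \<noteq> q \<circ> bar"
      using hasval_unique[OF v a, of c] q bar_over[OF q(2)] neq by auto
    ultimately show ?thesis using False by simp
  next
    case True
    then have vc: "hasval v x c" using a by simp
    show ?thesis
    proof (cases "c \<in> b ` I")
      case True
      then obtain i where i: "i \<in> I" "c = b i" by auto
      then have "v = e i" "q = e i" using e_eqI[OF v i(1)] e_eqI[OF q(1) i(1)] vc q by auto
      moreover have "e i \<in> W" using i by (auto simp: W_def)
      ultimately show ?thesis using e_x[OF i(1) i(1)] False W_bar[of "e i"] i by simp
    next
      case ord: False
      obtain s where s: "s ^ 2 = poly f c" using nonzero_sqrt by blast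
      have "poly f c \<noteq> 0" using ord fin by (auto simp: poly_f)
      then have s0: "s \<noteq> 0" using s by auto
      have ms: "(- s) ^ 2 = poly f c" "- s \<noteq> 0" using s s0 by auto
      have bs: "hasval (q \<circ> bar) y (- t)" if "hasval q y t" for t
      proof -
        have "vpos q (- (y - emb t))"
          using that vpos_uminus[OF q(1), of "y - emb t"] by (simp only: hasval_def)
        moreover have "- (y - emb t) = bar (y - emb (- t))" by simp
        ultimately show ?thesis unfolding hasval_def vpos_bar by (simp only:)
      qed
      have one: "v (x - emb c) = 1"
        using ordinary_point_y[OF v vc s] ordinary_point[OF v vc _ s s0] ordinary_point[OF v vc _ ms] by blast
      have ne: "q \<noteq> q \<circ> bar"
      proof
        assume qb: "q = q \<circ> bar"
        have "t + t = 0" if "hasval q y t" for t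
        proof -
          have "hasval q y (- t)" using bs[OF that] unfolding qb[symmetric] .
          from hasval_unique[OF q(1) that this] show ?thesis by (simp add: eq_neg_iff_add_eq_0)
        qed
        from this[of s] this[of "- s"] have "s + s = 0 \<or> - s + - s = 0"
          using ordinary_point_y[OF q s] by blast
        then have "2 * s = 0 \<or> 2 * (- s) = 0" unfolding mult_2 .
        then show False using two s0 by (simp only: mult_eq_0_iff) simp
      qed
      have "v = q \<or> v = q \<circ> bar"
      proof -
        have Pb: "q \<circ> bar \<in> P" by (rule points_bar[OF q(1)])
        have xb: "hasval (q \<circ> bar) x c" by (rule bar_over[OF q(2)])
        consider "hasval v y s" "hasval q y s" | "hasval v y s" "hasval q y (- s)"
          | "hasval v y (- s)" "hasval q y s" | "hasval v y (- s)" "hasval q y (- s)"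
          using ordinary_point_y[OF q s] ordinary_point_y[OF v vc s] by blast
        then show ?thesis
        proof cases
          case 1
          then show ?thesis using ordinary_point_unique[OF v q(1) vc _ q(2) _ s s0] by blast
        next
          case 2
          then show ?thesis using ordinary_point_unique[OF v Pb vc _ xb _ s s0] bs[of "- s"] by simp
        next
          case 3
          then show ?thesis using ordinary_point_unique[OF v Pb vc _ xb _ ms] bs[of s] by simp
        next
          case 4
          then show ?thesis using ordinary_point_unique[OF v q(1) vc _ q(2) _ ms] by blast
        qed
      qed
      then show ?thesis using one ne False by auto
    qed
  qed
qed

end

section \<open>Divisors\<close>

lemma div_degree_superset:
  assumes "finite A" "Poly_Mapping.keys D \<subseteq> A"
  shows "div_degree D = (\<Sum>v\<in>A. Poly_Mapping.lookup D v)"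
  unfolding div_degree_def using assms
  by (intro sum.mono_neutral_left) (auto simp: in_keys_iff)

lemma div_degree_add [simp]: "div_degree (D + E) = div_degree D + div_degree E"
proof -
  let ?A = "Poly_Mapping.keys D \<union> Poly_Mapping.keys E"
  have "div_degree (D + E) = (\<Sum>v\<in>?A. Poly_Mapping.lookup (D + E) v)"
    using keys_add[of D E] by (intro div_degree_superset) auto
  also have "\<dots> = div_degree D + div_degree E"
    by (subst (1 2) div_degree_superset[of ?A]) (auto simp: lookup_add sum.distrib)
  finally show ?thesis .
qed

lemma div_degree_0 [simp]: "div_degree 0 = 0"
  by (simp add: div_degree_def)

lemma div_degree_uminus [simp]: "div_degree (- D) = - div_degree D"
  using div_degree_add[of D "- D"] by simp

lemma div_degree_diff [simp]: "div_degree (D - E) = div_degree D - div_degree E"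
  using div_degree_add[of D "- E"] by simp

lemma div_degree_frag_of [simp]: "div_degree (frag_of v) = 1"
  by (simp add: div_degree_def keys_frag_of)

text \<open>The point \<open>v \<circ> \<tau>\<close> moves to \<open>v\<close>, in agreement with
  \<open>galois_act\<close>. Precomposition with a bijection is injective, which is what
  \<open>map_key\<close> needs.\<close>

definition act :: "('f \<Rightarrow> 'f) \<Rightarrow> 'f divisor \<Rightarrow> 'f divisor" where
  "act \<tau> D = Poly_Mapping.map_key (\<lambda>v. v \<circ> \<tau>) D"

lemma inj_comp_bij: "bij \<tau> \<Longrightarrow> inj (\<lambda>v. v \<circ> \<tau>)"
  by (rule injI) (metis comp_assoc bij_is_surj surj_iff comp_id)

lemma lookup_act [simp]: "bij \<tau> \<Longrightarrow> Poly_Mapping.lookup (act \<tau> D) v = Poly_Mapping.lookup D (v \<circ> \<tau>)"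
  unfolding act_def by (subst map_key.rep_eq[OF inj_comp_bij]) auto

lemma act_add: "bij \<tau> \<Longrightarrow> act \<tau> (D + E) = act \<tau> D + act \<tau> E"
  by (rule poly_mapping_eqI) (simp add: lookup_add)

lemma act_diff: "bij \<tau> \<Longrightarrow> act \<tau> (D - E) = act \<tau> D - act \<tau> E"
  by (rule poly_mapping_eqI) (simp add: lookup_minus)

lemma act_0: "bij \<tau> \<Longrightarrow> act \<tau> 0 = 0"
  by (rule poly_mapping_eqI) simp

lemma act_frag_of: "bij \<tau> \<Longrightarrow> act \<tau> (frag_of (v \<circ> \<tau>)) = frag_of v"
  by (rule poly_mapping_eqI) (auto dest: injD[OF inj_comp_bij])

lemma act_comp: "bij \<tau> \<Longrightarrow> bij \<rho> \<Longrightarrow> act (\<rho> \<circ> \<tau>) D = act \<rho> (act \<tau> D)"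
  by (rule poly_mapping_eqI) (simp add: bij_comp o_assoc)

lemma div_degree_act:
  assumes "bij \<tau>"
  shows "div_degree (act \<tau> D) = div_degree D"
  using subset_UNIV
proof (induction D rule: frag_induction)
  case (one v)
  define w where "w = v \<circ> inv_into UNIV \<tau>"
  have "v = w \<circ> \<tau>"
    using assms unfolding w_def by (simp add: fun_eq_iff inv_into_f_f[OF bij_is_inj])
  then show ?case using act_frag_of[OF assms, of w] by simp
qed (auto simp: act_diff[OF assms] act_0[OF assms])

text \<open>An automorphism of the function field that is semilinear over \<open>\<sigma>\<close>.
  Coordinates need not be fixed, so Galois automorphisms, hyperelliptic involutions and translations
  are all covered.\<close>

definition semiaut :: "('a::field \<Rightarrow> 'f::field) \<Rightarrow> ('a \<Rightarrow> 'a) \<Rightarrow> ('f \<Rightarrow> 'f) \<Rightarrow> bool" where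
  "semiaut emb \<sigma> \<tau> \<longleftrightarrow> field_hom \<sigma> \<and> bij \<sigma> \<and> field_hom \<tau> \<and> bij \<tau> \<and> (\<forall>a. \<tau> (emb a) = emb (\<sigma> a))"

lemma semiaut_comp: "semiaut emb \<sigma> \<tau> \<Longrightarrow> semiaut emb \<sigma>' \<tau>' \<Longrightarrow> semiaut emb (\<sigma> \<circ> \<sigma>') (\<tau> \<circ> \<tau>')"
  by (auto simp: semiaut_def field_hom_def bij_comp)

context func_field
begin

lemma semiaut_points:
  assumes "semiaut emb \<sigma> \<tau>"
  shows "v \<circ> \<tau> \<in> P \<longleftrightarrow> v \<in> P"
proof
  let ?r = "inv_into UNIV \<tau>"
  have t: "field_hom \<tau>" "bij \<tau>" "bij \<sigma>" "\<And>a. \<tau> (emb a) = emb (\<sigma> a)" using assms by (auto simp: semiaut_def)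
  interpret t: fld_hom \<tau> by unfold_locales fact
  have rt: "?r (\<tau> h) = h" "\<tau> (?r h) = h" for h
    using t(2) by (auto simp: inv_into_f_f[OF bij_is_inj] f_inv_into_f[of h \<tau> UNIV] bij_is_surj)
  show "v \<circ> \<tau> \<in> P" if "v \<in> P"
    using that t by (intro points_comp) auto
  show "v \<in> P" if "v \<circ> \<tau> \<in> P"
  proof -
    have "(v \<circ> \<tau>) \<circ> ?r \<in> P"
    proof (rule points_comp[OF that])
      show "field_hom ?r" unfolding field_hom_def
        by (metis rt t.one t.add t.mult)
      show "bij ?r" using t(2) by (rule bij_imp_bij_inv)
      show "\<exists>c. ?r (emb a) = emb c" for a
      proof -
        obtain c where "\<sigma> c = a" using t(3) by (metis bij_pointE)
        then show ?thesis using t(4)[of c] rt by metis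
      qed
    qed
    moreover have "(v \<circ> \<tau>) \<circ> ?r = v" using rt by (auto simp: fun_eq_iff)
    ultimately show ?thesis by simp
  qed
qed

lemma semiaut_hasval:
  assumes "semiaut emb \<sigma> \<tau>" "v \<circ> \<tau> = w"
  shows "hasval w h a \<longleftrightarrow> hasval v (\<tau> h) (\<sigma> a)"
proof -
  have t: "field_hom \<tau>" "\<And>a. \<tau> (emb a) = emb (\<sigma> a)" using assms by (auto simp: semiaut_def)
  interpret t: fld_hom \<tau> by unfold_locales (fact t(1))
  have "w (h - emb a) = v (\<tau> h - emb (\<sigma> a))" using assms(2) t(2) by auto
  moreover have "h - emb a = 0 \<longleftrightarrow> \<tau> h - emb (\<sigma> a) = 0"
    using t.eq_0_iff[of "h - emb a"] t(2) by simp
  ultimately show ?thesis unfolding hasval_def vpos_def by simp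
qed

text \<open>The divisor of a nonzero function; finiteness of its support is established in
  \<open>finite_support\<close>. Like \<open>principal\<close> and \<open>Div0\<close> it involves
  neither \<open>x\<close> nor \<open>y\<close>, so results from different models of the curve can
  be combined.\<close>

definition pdiv :: "'f \<Rightarrow> 'f divisor" where
  "pdiv h = Abs_poly_mapping (\<lambda>v. if v \<in> P then v h else 0)"

definition principal :: "'f divisor \<Rightarrow> bool" where
  "principal D \<longleftrightarrow> (\<exists>h. h \<noteq> 0 \<and> D = pdiv h)"

definition Div0 :: "'f divisor \<Rightarrow> bool" where
  "Div0 D \<longleftrightarrow> Poly_Mapping.keys D \<subseteq> P \<and> div_degree D = 0"

lemma Div0_0: "Div0 0" and Div0_add: "Div0 D \<Longrightarrow> Div0 E \<Longrightarrow> Div0 (D + E)"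
  and Div0_uminus: "Div0 D \<Longrightarrow> Div0 (- D)"
  and Div0_diff: "Div0 D \<Longrightarrow> Div0 E \<Longrightarrow> Div0 (D - E)"
  using keys_add[of D E] keys_diff[of D E] by (auto simp: Div0_def)

lemma Div0_frag: "v \<in> P \<Longrightarrow> w \<in> P \<Longrightarrow> Div0 (frag_of v - frag_of w)"
  using keys_diff[of "frag_of v" "frag_of w"] by (auto simp: Div0_def keys_frag_of)

lemma Div0_sum: "(\<And>i. i \<in> A \<Longrightarrow> Div0 (g i)) \<Longrightarrow> Div0 (sum g A)"
  by (induction A rule: infinite_finite_induct) (auto simp: Div0_0 Div0_add)

lemma Div0_act:
  assumes "semiaut emb \<sigma> \<tau>" "Div0 D"
  shows "Div0 (act \<tau> D)"
proof -
  have "bij \<tau>" using assms(1) by (simp add: semiaut_def)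
  note t = this
  have "v \<in> P" if "v \<in> Poly_Mapping.keys (act \<tau> D)" for v
  proof -
    have "v \<circ> \<tau> \<in> Poly_Mapping.keys D" using that unfolding in_keys_iff lookup_act[OF t] .
    then have "v \<circ> \<tau> \<in> P" using assms(2) unfolding Div0_def by blast
    then show ?thesis unfolding semiaut_points[OF assms(1)] .
  qed
  then show ?thesis using assms(2) div_degree_act[OF t] unfolding Div0_def by auto
qed

end

section \<open>Divisors of functions: finite support, degree zero, values at Weierstrass
  points\<close>

context odd_model
begin

lemma finite_over: "finite {v \<in> P. hasval v x c}"
proof -
  obtain q where q: "q \<in> P" "hasval q x c" using ex_point by blast
  have "{v \<in> P. hasval v x c} \<subseteq> {q, q \<circ> bar}"
  proof
    fix v assume "v \<in> {v \<in> P. hasval v x c}"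
    then have v: "v \<in> P" "0 < v (x - emb c)" using over_hasval by auto
    show "v \<in> {q, q \<circ> bar}" using v_x_minus_c[OF q v(1)] v(2) by (auto split: if_splits)
  qed
  then show ?thesis by (rule finite_subset) auto
qed

text \<open>With \<open>h = (p + q y) / r\<close>, an affine zero or pole lies over a root of
  \<open>r\<close> or of the norm \<open>p^2 - q^2 f\<close>: elsewhere both conjugates are integral
  with a unit as product.\<close>

lemma finite_support:
  assumes "h \<noteq> 0"
  shows "finite {v \<in> P. v h \<noteq> 0}"
proof -
  obtain p q r where r: "r \<noteq> 0" "h * ev r = ev p + ev q * y" using repr by blast
  have pq: "p \<noteq> 0 \<or> q \<noteq> 0" using r assms by auto
  let ?n = "p ^ 2 - q ^ 2 * f"
  have n: "?n \<noteq> 0" using pq by (rule norm_neq_0)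
  have "{v \<in> P. v h \<noteq> 0} \<subseteq> insert pinf (\<Union>c\<in>{c. poly (r * ?n) c = 0}. {v \<in> P. hasval v x c})"
  proof
    fix v assume "v \<in> {v \<in> P. v h \<noteq> 0}"
    then have v: "v \<in> P" "v h \<noteq> 0" by auto
    show "v \<in> insert pinf (\<Union>c\<in>{c. poly (r * ?n) c = 0}. {v \<in> P. hasval v x c})"
    proof (cases "v x < 0")
      case True
      then show ?thesis using pinf_eqI v by simp
    next
      case False
      then obtain c where c: "hasval v x c" using point_cases[OF v(1)] by blast
      have "poly (r * ?n) c = 0"
      proof (rule ccontr)
        assume "poly (r * ?n) c \<noteq> 0"
        then have nz: "poly r c \<noteq> 0" "poly ?n c \<noteq> 0" by auto
        have vr: "v (ev r) = 0" and vn: "v (ev ?n) = 0"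
          using hasval_unit[OF v(1) hasval_ev[OF v(1) c] nz(1)]
            hasval_unit[OF v(1) hasval_ev[OF v(1) c] nz(2)] by simp_all
        have yv: "vnn v y"
        proof -
          obtain s where s: "s ^ 2 = poly f c" using nonzero_sqrt by blast
          show ?thesis using ordinary_point_y[OF v(1) c s] hasval_vnn[OF v(1)] by blast
        qed
        have evv: "vnn v (ev k)" for k using hasval_vnn[OF v(1) hasval_ev[OF v(1) c]] .
        have vnn_mult: "vnn v (g * k)" if "vnn v g" "vnn v k" for g k
        proof (cases "g = 0 \<or> k = 0")
          case False
          then have "v (g * k) = v g + v k" by (intro v_mult[OF v(1)]) auto
          then show ?thesis using that False unfolding vnn_def by linarith
        qed (auto simp: vnn_def)
        have mq: "ev (- q) = - ev q" using ev_diff[of 0 q] by simp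
        have 1: "vnn v (ev p + ev q * y)" "vnn v (ev p + ev (- q) * y)"
          by (intro vnn_add[OF v(1)] vnn_mult evv yv)+
        have 2: "ev p + ev q * y \<noteq> 0" "ev p + ev (- q) * y \<noteq> 0"
          using ev_y_eq_0[of p q] ev_y_eq_0[of p "- q"] pq unfolding neg_equal_0_iff_equal by blast+
        have "(ev p + ev q * y) * (ev p + ev (- q) * y) = ev ?n"
          using ev_y_norm[of p q] by (simp add: mq)
        then have "v (ev p + ev q * y) + v (ev p + ev (- q) * y) = 0"
          using v_mult[OF v(1) 2] vn by simp
        then have "v (h * ev r) = 0" using 1 2 unfolding vnn_def r(2) by auto
        then show False using v assms r(1) vr by (simp add: v_mult)
      qed
      then show ?thesis using c v by blast
    qed
  qed
  moreover have "r * ?n \<noteq> 0" using r(1) n by (simp only: mult_eq_0_iff) simp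
  then have "finite {c. poly (r * ?n) c = 0}" by (rule poly_roots_finite)
  then have "finite (insert pinf (\<Union>c\<in>{c. poly (r * ?n) c = 0}. {v \<in> P. hasval v x c}))"
    using finite_over by (intro finite.insertI finite_UN_I)
  ultimately show ?thesis by (rule finite_subset)
qed

lemma lookup_pdiv:
  assumes "h \<noteq> 0"
  shows "Poly_Mapping.lookup (pdiv h) v = (if v \<in> P then v h else 0)"
proof -
  have "{v. (if v \<in> P then v h else 0) \<noteq> 0} = {v \<in> P. v h \<noteq> 0}" by auto
  then show ?thesis unfolding pdiv_def using finite_support[OF assms]
    by (subst lookup_Abs_poly_mapping) auto
qed

lemma pdiv_mult: "h \<noteq> 0 \<Longrightarrow> k \<noteq> 0 \<Longrightarrow> pdiv (h * k) = pdiv h + pdiv k"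
  by (rule poly_mapping_eqI) (simp add: lookup_pdiv lookup_add v_mult)

lemma pdiv_emb: "a \<noteq> 0 \<Longrightarrow> pdiv (emb a) = 0"
  by (rule poly_mapping_eqI) (simp add: lookup_pdiv)

lemma pdiv_1: "pdiv 1 = 0"
  using pdiv_emb[of 1] by simp

lemma pdiv_inverse: "h \<noteq> 0 \<Longrightarrow> pdiv (inverse h) = - pdiv h"
  using pdiv_mult[of h "inverse h"] by (simp add: pdiv_1 eq_neg_iff_add_eq_0 add.commute)

lemma pdiv_divide: "h \<noteq> 0 \<Longrightarrow> k \<noteq> 0 \<Longrightarrow> pdiv (h / k) = pdiv h - pdiv k"
  by (simp add: divide_inverse pdiv_mult pdiv_inverse)

lemma keys_pdiv: "h \<noteq> 0 \<Longrightarrow> Poly_Mapping.keys (pdiv h) \<subseteq> P"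
  by (auto simp: in_keys_iff lookup_pdiv split: if_splits)

lemma act_pdiv:
  assumes "semiaut emb \<sigma> \<tau>" "h \<noteq> 0"
  shows "act \<tau> (pdiv h) = pdiv (\<tau> h)"
proof -
  have t: "bij \<tau>" "field_hom \<tau>" using assms by (auto simp: semiaut_def)
  interpret t: fld_hom \<tau> by unfold_locales (fact t(2))
  show ?thesis using assms(2) t semiaut_points[OF assms(1)]
    by (intro poly_mapping_eqI) (simp add: lookup_pdiv)
qed

lemma semiaut_bar: "semiaut emb id bar"
  using bar by (simp add: semiaut_def field_hom_def)

lemma pdiv_x_minus_c:
  assumes "q \<in> P" "hasval q x c"
  shows "pdiv (x - emb c) = frag_of q + frag_of (q \<circ> bar) - (frag_of pinf + frag_of pinf)"
proof (rule poly_mapping_eqI)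
  fix v
  show "Poly_Mapping.lookup (pdiv (x - emb c)) v =
    Poly_Mapping.lookup (frag_of q + frag_of (q \<circ> bar) - (frag_of pinf + frag_of pinf)) v"
  proof (cases "v \<in> P")
    case True
    then show ?thesis using v_x_minus_c[OF assms True] x_neq_emb[OF assms(1)]
      by (simp add: lookup_pdiv lookup_add lookup_minus)
  next
    case False
    then have "v \<noteq> q" "v \<noteq> q \<circ> bar" "v \<noteq> pinf" using pinf(1) assms(1) points_bar[OF assms(1)] by auto
    then show ?thesis using False x_neq_emb[OF assms(1)] by (simp add: lookup_pdiv lookup_add lookup_minus)
  qed
qed

text \<open>For \<open>x - c\<close> the divisor is explicit, and splitting into linear factors
  extends this to all rational functions of \<open>x\<close>. In general the norm
  \<open>h * bar h\<close> has degree zero, which is twice the degree of \<open>h\<close>, as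
  \<open>bar\<close> preserves degrees.\<close>

lemma div_degree_pdiv:
  assumes "h \<noteq> 0"
  shows "div_degree (pdiv h) = 0"
proof -
  have lin: "div_degree (pdiv (x - emb c)) = 0" for c
    using ex_point[of c] pdiv_x_minus_c by auto
  have ev: "div_degree (pdiv (ev p)) = 0" if "p \<noteq> 0" for p
    using that
  proof (induction "degree p" arbitrary: p)
    case 0
    then obtain c where "p = [:c:]" by (metis degree_eq_zeroE)
    then show ?case using 0 by (simp add: pdiv_emb)
  next
    case (Suc n)
    then obtain c where "poly p c = 0" using alg_closed_imp_poly_has_root[of p] by auto
    then obtain q where q: "p = [:- c, 1:] * q" by (metis poly_eq_0_iff_dvd dvdE)
    have q0: "q \<noteq> 0" using Suc.prems q by auto
    then have "degree q = n"
      using Suc.hyps(2) unfolding q by (subst (asm) degree_mult_eq) auto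
    then have "div_degree (pdiv (ev q)) = 0" using Suc.hyps(1)[of q] q0 by auto
    moreover have "ev p = (x - emb c) * ev q" unfolding q ev_mult by simp
    ultimately show ?case using pdiv_mult[of "x - emb c" "ev q"] lin q0 x_neq_emb[OF pinf(1)] by simp
  qed
  have fixed: "div_degree (pdiv A) = 0" if A: "bar A = A" "A \<noteq> 0" for A
  proof -
    obtain p r where "r \<noteq> 0" "A = ev p / ev r" using bar_fixed_repr[OF A(1)] by blast
    then show ?thesis using A(2) by (auto simp: pdiv_divide ev)
  qed
  have "div_degree (pdiv (h * bar h)) = 0"
    using assms by (intro fixed) (auto simp: mult.commute)
  moreover have "div_degree (pdiv (bar h)) = div_degree (pdiv h)"
    using act_pdiv[OF semiaut_bar assms] div_degree_act[OF bij_bar] by metis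
  ultimately show ?thesis using pdiv_mult[of h "bar h"] assms by simp
qed

lemma principal_Div0: "principal D \<Longrightarrow> Div0 D"
  by (auto simp: principal_def Div0_def div_degree_pdiv dest: keys_pdiv)

lemma principal_pdiv: "h \<noteq> 0 \<Longrightarrow> principal (pdiv h)"
  by (auto simp: principal_def)

lemma principal_0: "principal 0"
  using principal_pdiv[of 1] by (simp add: pdiv_1)

lemma principal_add: "principal D \<Longrightarrow> principal E \<Longrightarrow> principal (D + E)"
  unfolding principal_def by (metis pdiv_mult mult_eq_0_iff)

lemma principal_uminus: "principal D \<Longrightarrow> principal (- D)"
  unfolding principal_def by (metis pdiv_inverse inverse_nonzero_iff_nonzero)

lemma principal_diff: "principal D \<Longrightarrow> principal E \<Longrightarrow> principal (D - E)"
  using principal_add[of D "- E"] principal_uminus[of E] by simp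

lemma principal_act: "semiaut emb \<sigma> \<tau> \<Longrightarrow> principal D \<Longrightarrow> principal (act \<tau> D)"
proof -
  assume s: "semiaut emb \<sigma> \<tau>" and "principal D"
  then obtain h where h: "h \<noteq> 0" "D = pdiv h" by (auto simp: principal_def)
  interpret t: fld_hom \<tau> using s by unfold_locales (simp add: semiaut_def)
  show ?thesis using act_pdiv[OF s h(1)] h by (simp add: principal_pdiv)
qed

lemma fixed_even: "w \<in> W \<Longrightarrow> bar A = A \<Longrightarrow> A \<noteq> 0 \<Longrightarrow> even (w A)"
  using W_ramified by (auto simp: ramified_def)

lemma W_points: "w \<in> W \<Longrightarrow> w \<in> P"
  using W_ramified by (auto simp: ramified_def)

text \<open>The value is the quotient of the leading coefficients at infinity; over a finite
  \<open>c\<close>, equal powers of \<open>x - c\<close> cancel from numerator and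
  denominator.\<close>

lemma fixed_unit_value:
  assumes "w \<in> W" "bar A = A" "A \<noteq> 0" "w A = 0"
  shows "\<exists>a. hasval w A a"
proof -
  obtain p r where pr: "r \<noteq> 0" "A = ev p / ev r" using bar_fixed_repr[OF assms(2)] by blast
  have p0: "p \<noteq> 0" using pr assms by auto
  have w: "w \<in> P" using assms W_points by blast
  show ?thesis
  proof (cases "w x < 0")
    case True
    have deg: "degree p = degree r"
      using True pr p0 w assms(4) by (simp add: v_divide v_ev_inf)
    let ?a = "lead_coeff p / lead_coeff r"
    have "hasval w A ?a"
    proof (cases "p = smult ?a r")
      case True
      have "A - emb ?a = 0" using pr(1) unfolding pr(2) by (subst True) simp
      then show ?thesis by (simp only: hasval_def vpos_def simp_thms)
    next
      case False
      let ?q = "p - smult ?a r"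
      have q0: "?q \<noteq> 0" using False by simp
      have le: "degree ?q \<le> degree r" using deg by (intro degree_diff_le) (auto intro: degree_smult_le)
      have "coeff ?q (degree r) = 0" using deg pr(1) by simp
      then have "degree ?q \<noteq> degree r" using q0 by (metis leading_coeff_0_iff)
      then have lt: "degree ?q < degree r" using le by simp
      have "A - emb ?a = ev ?q / ev r" using pr by (simp add: field_simps)
      moreover have "0 < w (ev ?q / ev r)"
      proof -
        have "w (ev ?q / ev r) = (int (degree ?q) - int (degree r)) * w x"
          using q0 pr(1) w \<open>w x < 0\<close> by (simp add: v_divide v_ev_inf algebra_simps del: ev_diff ev_smult)
        then show ?thesis using lt \<open>w x < 0\<close> by (simp add: mult_neg_neg)
      qed
      ultimately show ?thesis by (simp only: hasval_def vpos_def) simp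
    qed
    then show ?thesis by blast
  next
    case False
    then obtain c where c: "hasval w x c" using point_cases[OF w] by blast
    obtain p1 where p1: "p = [:- c, 1:] ^ order c p * p1" "\<not> [:- c, 1:] dvd p1"
      using order_decomp[OF p0] by blast
    obtain r1 where r1: "r = [:- c, 1:] ^ order c r * r1" "\<not> [:- c, 1:] dvd r1"
      using order_decomp[OF pr(1)] by blast
    have "0 < w (x - emb c)" using c over_hasval[OF w] by simp
    then have "order c p = order c r"
      using pr p0 w assms(4) c by (simp add: v_divide v_ev)
    moreover have "ev ([:- c, 1:] ^ order c r) \<noteq> 0" by (simp del: ev_pCons ev_power)
    ultimately have "A = ev p1 / ev r1"
      unfolding pr(2) by (subst p1(1), subst r1(1)) (simp add: ev_mult del: ev_power)
    moreover have "poly r1 c \<noteq> 0" using r1(2) by (simp add: poly_eq_0_iff_dvd)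
    ultimately show ?thesis using hasval_divide[OF w hasval_ev[OF w c] hasval_ev[OF w c]] by blast
  qed
qed

text \<open>In \<open>h = A + B * y\<close> the second summand has odd order, so it vanishes at
  \<open>w\<close> and the value is that of \<open>A\<close>.\<close>

lemma unit_value:
  assumes "w \<in> W" "h \<noteq> 0" "w h = 0"
  shows "\<exists>a. a \<noteq> 0 \<and> hasval w h a"
proof -
  have w: "w \<in> P" and ram: "ramified w" using assms W_points W_ramified by blast+
  obtain A B where AB: "bar A = A" "bar B = B" "h = A + B * y" using decompose by blast
  have odd_By: "odd (w B + w y)" if "B \<noteq> 0"
    using ram AB(2) that by (auto simp: ramified_def)
  have A0: "A \<noteq> 0"
  proof
    assume "A = 0"
    then have "h = B * y" and "B \<noteq> 0" using AB(3) assms(2) by auto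
    then have "w B + w y = 0" using assms(3) w by (simp add: v_mult)
    then show False using odd_By[OF \<open>B \<noteq> 0\<close>] by (metis even_zero)
  qed
  have vA: "w A = 0 \<and> vpos w (B * y)"
  proof (cases "B = 0")
    case False
    have "min (w A) (w B + w y) = 0" using ramified_min[OF ram AB(1,2) A0 False] AB assms(3) by simp
    moreover have "w B + w y \<noteq> 0" using odd_By[OF False] by (metis even_zero)
    ultimately have "w A = 0" "0 < w B + w y" by linarith+
    then show ?thesis using False w by (simp add: vpos_def v_mult)
  qed (use AB assms in \<open>auto simp: vpos_def\<close>)
  obtain a where "hasval w A a" using fixed_unit_value[OF assms(1) AB(1) A0] vA by blast
  then have a: "hasval w h a" unfolding AB(3)
    using hasval_add[OF w, of A a "B * y" 0] vA by (simp add: hasval_0[OF w])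
  have "a \<noteq> 0" using a assms by (auto simp: hasval_def vpos_def)
  then show ?thesis using a by blast
qed

text \<open>Subtract the value at infinity: a nonzero difference would have no poles but a zero,
  hence a divisor of positive degree.\<close>

lemma pdiv_0_const:
  assumes "h \<noteq> 0" "pdiv h = 0"
  shows "\<exists>a. h = emb a"
proof -
  have v0: "v h = 0" if "v \<in> P" for v
    using lookup_pdiv[OF assms(1), of v] assms(2) that by simp
  have "pinf \<in> W" by (simp add: W_def)
  then obtain a where a: "hasval pinf h a" using unit_value assms(1) v0[OF pinf(1)] by blast
  have "h - emb a = 0"
  proof (rule ccontr)
    assume nz: "h - emb a \<noteq> 0"
    let ?D = "pdiv (h - emb a)"
    have nn: "0 \<le> Poly_Mapping.lookup ?D v" for v
    proof -
      have "vnn v (h + emb (- a))" if "v \<in> P"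
        using that assms v0[OF that] vnn_emb[OF that] by (intro vnn_add) (auto simp: vnn_def)
      then show ?thesis using nz by (auto simp: lookup_pdiv vnn_def)
    qed
    have pos: "0 < Poly_Mapping.lookup ?D pinf"
      using a nz pinf(1) by (simp add: lookup_pdiv hasval_def vpos_def)
    have "0 < div_degree ?D" unfolding div_degree_def
      using pos nn by (intro sum_pos2[of _ pinf]) (auto simp: in_keys_iff)
    then show False using div_degree_pdiv[OF nz] by simp
  qed
  then show ?thesis by auto
qed

text \<open>For a single point this is the divisor of \<open>x - c\<close>, and both sides are
  additive. In degree zero it says that the hyperelliptic involution acts as -1 on the
  Jacobian.\<close>

lemma norm_divisor:
  assumes "Poly_Mapping.keys D \<subseteq> P"
  shows "\<exists>u. u \<noteq> 0 \<and> bar u = u \<and>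
    D + act bar D = pdiv u + frag_cmul (2 * div_degree D) (frag_of pinf)"
  using assms
proof (induction D rule: frag_induction)
  case zero
  show ?case by (rule exI[of _ 1]) (simp add: pdiv_1 act_0[OF bij_bar])
next
  case (one q)
  have "act bar (frag_of ((q \<circ> bar) \<circ> bar)) = frag_of (q \<circ> bar)" by (rule act_frag_of[OF bij_bar])
  moreover have "(q \<circ> bar) \<circ> bar = q" by (simp add: fun_eq_iff)
  ultimately have ab: "act bar (frag_of q) = frag_of (q \<circ> bar)" by simp
  have two_pinf: "frag_cmul 2 (frag_of pinf) = frag_of pinf + frag_of pinf"
    by (rule poly_mapping_eqI) (simp add: lookup_add)
  show ?case
  proof (cases "q = pinf")
    case True
    have "pinf \<circ> bar = pinf" using W_bar[of pinf] by (simp add: W_def)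
    then show ?thesis using True ab two_pinf by (intro exI[of _ 1]) (simp add: pdiv_1)
  next
    case False
    then obtain c where c: "hasval q x c" using point_cases[OF one] pinf_eqI[OF one] by blast
    show ?thesis using pdiv_x_minus_c[OF one c] ab two_pinf x_neq_emb[OF one]
      by (intro exI[of _ "x - emb c"]) simp
  qed
next
  case (diff D E)
  then obtain u w where u: "u \<noteq> 0" "bar u = u"
      "D + act bar D = pdiv u + frag_cmul (2 * div_degree D) (frag_of pinf)"
    and w: "w \<noteq> 0" "bar w = w" "E + act bar E = pdiv w + frag_cmul (2 * div_degree E) (frag_of pinf)"
    by blast
  have "(D - E) + act bar (D - E) = (D + act bar D) - (E + act bar E)"
    by (simp add: act_diff[OF bij_bar])
  also have "\<dots> = pdiv (u / w) + frag_cmul (2 * div_degree (D - E)) (frag_of pinf)"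
    unfolding u(3) w(3) using u w
    by (intro poly_mapping_eqI) (simp add: pdiv_divide lookup_add lookup_minus algebra_simps)
  finally show ?case using u w by (intro exI[of _ "u / w"]) simp
qed

lemma norm_divisor0: "Div0 D \<Longrightarrow> \<exists>u. u \<noteq> 0 \<and> bar u = u \<and> D + act bar D = pdiv u"
  using norm_divisor[of D] by (auto simp: Div0_def)

end

section \<open>Two-torsion\<close>

lemma interpolation:
  fixes t :: "'a::field \<Rightarrow> 'a"
  assumes "finite C"
  shows "\<exists>r. (\<forall>c\<in>C. poly r c = t c) \<and> (r = 0 \<or> degree r < card C)"
  using assms
proof (induction C rule: finite_induct)
  case (insert a C)
  then obtain r where r: "\<And>c. c \<in> C \<Longrightarrow> poly r c = t c" "r = 0 \<or> degree r < card C" by blast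
  let ?L = "\<Prod>c\<in>C. [:- c, 1:]"
  have La: "poly ?L a \<noteq> 0" using insert.hyps by (auto simp: poly_prod)
  have Lc: "poly ?L c = 0" if "c \<in> C" for c
    unfolding poly_prod using insert.hyps that by (intro prod_zero) auto
  have Ld: "degree ?L = card C"
    using insert.hyps by (subst degree_prod_eq_sum_degree) auto
  let ?r = "r + smult ((t a - poly r a) / poly ?L a) ?L"
  have "poly ?r c = t c" if "c \<in> insert a C" for c
    using that r(1) La Lc by auto
  moreover have "degree ?r \<le> card C"
    using r(2) Ld degree_smult_le[of _ ?L] by (intro degree_add_le) auto
  then have "degree ?r < card (insert a C)" using insert.hyps by simp
  ultimately show ?case by blast
qed (auto intro: exI[of _ 0])

lemma prod_linear_dvd:
  fixes p :: "'a::field poly"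
  assumes "finite C" "\<And>c. c \<in> C \<Longrightarrow> poly p c = 0"
  shows "(\<Prod>c\<in>C. [:- c, 1:]) dvd p"
  using assms
proof (induction C rule: finite_induct)
  case (insert a C)
  then obtain q where q: "p = (\<Prod>c\<in>C. [:- c, 1:]) * q" by (auto elim!: dvdE)
  have "poly (\<Prod>c\<in>C. [:- c, 1:]) a \<noteq> 0" using insert.hyps by (auto simp: poly_prod)
  then have "poly q a = 0" using insert.prems[of a] q by auto
  then have "[:- a, 1:] dvd q" by (simp add: poly_eq_0_iff_dvd)
  then show ?case
    unfolding prod.insert[OF insert.hyps] q by (subst mult.commute) (intro mult_dvd_mono dvd_refl)
qed simp

lemma squarefree_decomposition:
  fixes p :: "'a::alg_closed_field poly"
  assumes "p \<noteq> 0"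
  shows "\<exists>k s C. k \<noteq> 0 \<and> s \<noteq> 0 \<and> finite C \<and> p = smult k (s ^ 2 * (\<Prod>c\<in>C. [:- c, 1:]))"
  using assms
proof (induction "degree p" arbitrary: p)
  case 0
  then obtain k where "p = [:k:]" by (metis degree_eq_zeroE)
  then show ?case using 0 by (intro exI[of _ k] exI[of _ 1] exI[of _ "{}"]) auto
next
  case (Suc n)
  then obtain a where "poly p a = 0" using alg_closed_imp_poly_has_root[of p] by auto
  then obtain q where q: "p = [:- a, 1:] * q" by (metis poly_eq_0_iff_dvd dvdE)
  have q0: "q \<noteq> 0" using Suc.prems q by auto
  then have "degree q = n"
    using Suc.hyps(2) unfolding q by (subst (asm) degree_mult_eq) auto
  then obtain k s C where IH: "k \<noteq> 0" "s \<noteq> 0" "finite C" "q = smult k (s ^ 2 * (\<Prod>c\<in>C. [:- c, 1:]))"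
    using Suc.hyps(1)[of q] q0 by blast
  show ?case
  proof (cases "a \<in> C")
    case True
    have "p = smult k (([:- a, 1:] * s) ^ 2 * (\<Prod>c\<in>C - {a}. [:- c, 1:]))"
      unfolding q IH(4) prod.remove[OF IH(3) True] by (simp add: power2_eq_square mult_ac del: mult_pCons_left mult_pCons_right)
    moreover have "[:- a, 1:] * s \<noteq> 0" using IH(2) by (simp only: mult_eq_0_iff) simp
    ultimately show ?thesis using IH(1,3) by blast
  next
    case False
    have "p = smult k (s ^ 2 * (\<Prod>c\<in>insert a C. [:- c, 1:]))"
      unfolding q IH(4) prod.insert[OF IH(3) False] by (simp add: mult_ac del: mult_pCons_left mult_pCons_right)
    then show ?thesis using IH by blast
  qed
qed

text \<open>Descent on the sum of the degrees, with \<open>degree a \<le> degree c\<close> by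
  symmetry. If \<open>c\<close> is squarefree, \<open>a\<close> has a square root \<open>r\<close>
  modulo \<open>c\<close> by interpolation at the roots of \<open>c\<close>. Then
  \<open>r^2 - a = c * b'\<close> with \<open>degree b' < degree c\<close>, and the conic for
  \<open>a\<close>, \<open>b'\<close> is smaller.\<close>

lemma conic_solution_aux:
  fixes a c :: "'a::alg_closed_field poly"
  assumes "a \<noteq> 0" "c \<noteq> 0" "degree a + degree c = n"
  shows "\<exists>X Y Z. (X \<noteq> 0 \<or> Y \<noteq> 0 \<or> Z \<noteq> 0) \<and> X ^ 2 = a * Y ^ 2 + c * Z ^ 2"
  using assms
proof (induction n arbitrary: a c rule: less_induct)
  case (less n)
  have main: "\<exists>X Y Z. (X \<noteq> 0 \<or> Y \<noteq> 0 \<or> Z \<noteq> 0) \<and> X ^ 2 = a * Y ^ 2 + c * Z ^ 2"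
    if a0: "a \<noteq> 0" and c0: "c \<noteq> 0" and n: "degree a + degree c = n" and le: "degree a \<le> degree c" for a c :: "'a poly"
  proof -
    obtain k s C where c: "k \<noteq> 0" "s \<noteq> 0" "finite C" "c = smult k (s ^ 2 * (\<Prod>c\<in>C. [:- c, 1:]))"
      using squarefree_decomposition[OF c0] by blast
    let ?L = "\<Prod>c\<in>C. [:- c, 1:]"
    have Ld: "degree ?L = card C" using c(3) by (subst degree_prod_eq_sum_degree) auto
    have L0: "?L \<noteq> 0" using c(3) prod_zero_iff[of C "\<lambda>c. [:- c, 1:]"] by auto
    have dc: "degree c = 2 * degree s + card C"
      using c L0 Ld by (simp add: degree_mult_eq degree_power_eq)
    consider "degree s > 0" | "degree s = 0" "C = {}" | "degree s = 0" "C \<noteq> {}" by blast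
    then show ?thesis
    proof cases
      case 1
      \<comment> \<open>A nonconstant square factor \<open>s^2\<close> of \<open>c\<close> is
        removed; multiplying \<open>X\<close> and \<open>Y\<close> by \<open>s\<close> restores
        it.\<close>
      have "degree a + degree (smult k ?L) < n" using 1 n dc c(1) Ld by simp
      then obtain X Y Z where "X \<noteq> 0 \<or> Y \<noteq> 0 \<or> Z \<noteq> 0" "X ^ 2 = a * Y ^ 2 + smult k ?L * Z ^ 2"
        using less.IH[of _ a "smult k ?L"] a0 c(1) L0 by (metis smult_eq_0_iff)
      moreover from this(2) have "(s * X) ^ 2 = a * (s * Y) ^ 2 + c * Z ^ 2"
        unfolding c(4) power_mult_distrib by (simp add: algebra_simps)
      ultimately show ?thesis using c(2) by (metis mult_eq_0_iff)
    next
      case 2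
      then have "degree c = 0" using dc by simp
      then obtain e where e: "c = [:e:]" by (metis degree_eq_zeroE)
      obtain t where "t ^ 2 = e" using nth_root_exists[of 2 e] by auto
      then have "[:t:] ^ 2 = a * 0 ^ 2 + c * 1 ^ 2" using e by (simp add: power2_eq_square)
      then show ?thesis by (metis one_neq_zero)
    next
      case 3
      have "\<exists>t. \<forall>z. t z ^ 2 = poly a z"
        using nth_root_exists[of 2] by (intro choice) auto
      then obtain t where t: "\<And>z. t z ^ 2 = poly a z" by blast
      obtain r where r: "\<And>z. z \<in> C \<Longrightarrow> poly r z = t z" "r = 0 \<or> degree r < card C"
        using interpolation[OF c(3), of t] by blast
      have "?L dvd r ^ 2 - a" using r(1) t by (intro prod_linear_dvd c(3)) auto
      moreover obtain s0 where s0: "s = [:s0:]" "s0 \<noteq> 0" using 3(1) c(2) by (metis degree_eq_zeroE pCons_eq_0_iff)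
      have "c = smult (k * s0 ^ 2) ?L" unfolding c(4) s0 by (simp add: power2_eq_square mult_ac)
      ultimately have "c dvd r ^ 2 - a" using c(1) s0 by (simp add: smult_dvd_iff)
      then obtain b' where b': "r ^ 2 - a = c * b'" by (elim dvdE)
      show ?thesis
      proof (cases "b' = 0")
        case True
        then have "r ^ 2 = a * 1 ^ 2 + c * 0 ^ 2" using b' by simp
        then show ?thesis by (metis one_neq_zero)
      next
        case False
        have cC: "card C > 0" using 3 c(3) by (simp add: card_gt_0_iff)
        have "degree c + degree b' = degree (r ^ 2 - a)" unfolding b' using c0 False by (simp add: degree_mult_eq)
        also have "\<dots> \<le> max (2 * degree r) (degree a)"
          using degree_power_le[of r 2] by (intro degree_diff_le) auto
        finally have "degree c + degree b' \<le> 2 * degree r \<or> degree c + degree b' \<le> degree a"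
          by (simp only: le_max_iff_disj)
        moreover have "degree r < card C" using r(2) cC by auto
        ultimately have "degree b' < degree c" using cC le dc 3(1) by linarith
        then have "degree a + degree b' < n" using n by simp
        then obtain X Y Z where XYZ: "X \<noteq> 0 \<or> Y \<noteq> 0 \<or> Z \<noteq> 0" "X ^ 2 = a * Y ^ 2 + b' * Z ^ 2"
          using less.IH[of _ a b'] a0 False by blast
        show ?thesis
        proof (cases "Z = 0")
          case True
          then show ?thesis using XYZ by (intro exI[of _ X] exI[of _ Y] exI[of _ 0]) auto
        next
          case Z: False
          \<comment> \<open>Norms from the extension by a square root of \<open>a\<close> are
            multiplicative; this is the product of \<open>X + Y sqrt a\<close> and
            \<open>r + sqrt a\<close>.\<close>
          have "(X * r + a * Y) ^ 2 - a * (X + r * Y) ^ 2 = (X ^ 2 - a * Y ^ 2) * (r ^ 2 - a)"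
            by (simp add: algebra_simps power2_eq_square)
          also have "\<dots> = c * (b' * Z) ^ 2" unfolding b' XYZ(2) by (simp add: algebra_simps power2_eq_square)
          finally have "(X * r + a * Y) ^ 2 = a * (X + r * Y) ^ 2 + c * (b' * Z) ^ 2"
            by (simp add: algebra_simps)
          then show ?thesis using Z False by (metis mult_eq_0_iff)
        qed
      qed
    qed
  qed
  show ?case
  proof (cases "degree a \<le> degree c")
    case True
    then show ?thesis using main less.prems by blast
  next
    case False
    then obtain X Y Z where "X \<noteq> 0 \<or> Y \<noteq> 0 \<or> Z \<noteq> 0" "X ^ 2 = c * Y ^ 2 + a * Z ^ 2"
      using main[of c a] less.prems by auto
    then show ?thesis by (intro exI[of _ X] exI[of _ Z] exI[of _ Y]) (auto simp: add.commute)
  qed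
qed

text \<open>Tsen's theorem for conics, by Legendre's descent.\<close>

lemma conic_solution:
  fixes a c :: "'a::alg_closed_field poly"
  assumes "a \<noteq> 0" "c \<noteq> 0"
  shows "\<exists>X Y Z. (X \<noteq> 0 \<or> Y \<noteq> 0 \<or> Z \<noteq> 0) \<and> X ^ 2 = a * Y ^ 2 + c * Z ^ 2"
  using conic_solution_aux[OF assms refl] .

lemma poly_mapping_half:
  assumes "\<And>v. even (Poly_Mapping.lookup D v)"
  shows "\<exists>E :: 'b \<Rightarrow>\<^sub>0 int. E + E = D"
proof -
  have "finite {v. Poly_Mapping.lookup D v div 2 \<noteq> 0}"
    by (rule finite_subset[OF _ finite_keys[of D]]) (auto simp: in_keys_iff)
  then have "Abs_poly_mapping (\<lambda>v. Poly_Mapping.lookup D v div 2) + Abs_poly_mapping (\<lambda>v. Poly_Mapping.lookup D v div 2) = D"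
    using assms by (intro poly_mapping_eqI) (simp add: lookup_add flip: mult_2)
  then show ?thesis by blast
qed

lemma poly_mapping_double_cancel:
  assumes "D + D = E + (E :: 'b \<Rightarrow>\<^sub>0 int)"
  shows "D = E"
proof (rule poly_mapping_eqI)
  fix v
  have "Poly_Mapping.lookup (D + D) v = Poly_Mapping.lookup (E + E) v" using assms by simp
  then show "Poly_Mapping.lookup D v = Poly_Mapping.lookup E v" by (simp add: lookup_add)
qed

section \<open>The classes \<open>E i\<close> and the two-torsion of the Jacobian\<close>

context odd_model
begin

definition E :: "'i \<Rightarrow> 'f divisor" where
  "E i = frag_of (e i) - frag_of pinf"

lemma Div0_E: "i \<in> I \<Longrightarrow> Div0 (E i)"
  unfolding E_def using e pinf by (intro Div0_frag)

lemma e_bar: "i \<in> I \<Longrightarrow> e i \<circ> bar = e i"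
  using W_bar[of "e i"] by (simp add: W_def)

lemma pinf_bar: "pinf \<circ> bar = pinf"
  using W_bar[of pinf] by (simp add: W_def)

lemma act_bar_E: "i \<in> I \<Longrightarrow> act bar (E i) = E i"
  using act_frag_of[OF bij_bar, of "e i"] act_frag_of[OF bij_bar, of pinf]
  by (simp add: E_def act_diff[OF bij_bar] e_bar pinf_bar)

lemma pdiv_x_b: "i \<in> I \<Longrightarrow> pdiv (x - emb (b i)) = E i + E i"
  using pdiv_x_minus_c[OF e] by (simp add: E_def e_bar)

lemma x_b_nz [simp]: "x - emb c \<noteq> 0"
  using x_neq_emb[OF pinf(1)] by simp

lemma x_ne_emb [simp]: "x \<noteq> emb c"
  using x_neq_emb[OF pinf(1)] by simp

lemma lookup_E:
  assumes "i \<in> I"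
  shows "j \<in> I \<Longrightarrow> Poly_Mapping.lookup (E i) (e j) = (if i = j then 1 else 0)"
    and "Poly_Mapping.lookup (E i) pinf = - 1"
    and "v \<notin> W \<Longrightarrow> Poly_Mapping.lookup (E i) v = 0"
proof -
  show "Poly_Mapping.lookup (E i) (e j) = (if i = j then 1 else 0)" if "j \<in> I"
    using e_inj[OF that assms] e_neq_pinf[OF that] by (auto simp: E_def lookup_minus)
  show "Poly_Mapping.lookup (E i) pinf = - 1"
    using e_neq_pinf[OF assms] by (auto simp: E_def lookup_minus)
  show "Poly_Mapping.lookup (E i) v = 0" if "v \<notin> W"
    using that assms by (auto simp: E_def lookup_minus W_def)
qed

lemma lookup_sum_E:
  assumes "S \<subseteq> I"
  shows "j \<in> I \<Longrightarrow> Poly_Mapping.lookup (\<Sum>i\<in>S. E i) (e j) = (if j \<in> S then 1 else 0)"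
    and "Poly_Mapping.lookup (\<Sum>i\<in>S. E i) pinf = - int (card S)"
    and "v \<notin> W \<Longrightarrow> Poly_Mapping.lookup (\<Sum>i\<in>S. E i) v = 0"
proof -
  have S: "finite S" using assms fin finite_subset by blast
  have i: "i \<in> I" if "i \<in> S" for i using that assms by auto
  show "Poly_Mapping.lookup (\<Sum>i\<in>S. E i) (e j) = (if j \<in> S then 1 else 0)" if "j \<in> I"
  proof -
    have "Poly_Mapping.lookup (\<Sum>i\<in>S. E i) (e j) = (\<Sum>i\<in>S. if i = j then 1 else 0)"
      unfolding lookup_sum using lookup_E(1)[OF i that] by (intro sum.cong) auto
    then show ?thesis using S by simp
  qed
  show "Poly_Mapping.lookup (\<Sum>i\<in>S. E i) pinf = - int (card S)"
    unfolding lookup_sum using lookup_E(2)[OF i] by simp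
  show "Poly_Mapping.lookup (\<Sum>i\<in>S. E i) v = 0" if "v \<notin> W"
    unfolding lookup_sum using lookup_E(3)[OF i that] by simp
qed

text \<open>Up to squares \<open>m\<close> is a product of distinct factors \<open>x - c\<close>.
  Over a value that is not a branch value such a factor has a simple zero, contradicting evenness,
  so every \<open>c\<close> is some \<open>b i\<close>, where \<open>x - b i\<close> has divisor
  \<open>2 * E i\<close>.\<close>

lemma even_divisor:
  assumes m: "bar m = m" "m \<noteq> 0" and D: "D + D = pdiv m"
  shows "\<exists>A S. A \<noteq> 0 \<and> bar A = A \<and> S \<subseteq> I \<and> D = (\<Sum>i\<in>S. E i) + pdiv A"
proof -
  obtain p r where pr: "r \<noteq> 0" "m = ev p / ev r" using bar_fixed_repr[OF m(1)] by blast
  have p0: "p \<noteq> 0" using pr m by auto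
  obtain k s C where d: "k \<noteq> 0" "s \<noteq> 0" "finite C" "p * r = smult k (s ^ 2 * (\<Prod>c\<in>C. [:- c, 1:]))"
    using squarefree_decomposition[of "p * r"] p0 pr(1) by auto
  let ?L = "\<Prod>c\<in>C. [:- c, 1:]"
  have L0: "?L \<noteq> 0" using d(3) prod_zero_iff[of C "\<lambda>c. [:- c, 1:]"] by auto
  \<comment> \<open>Modulo squares the fraction \<open>p / r\<close> is the polynomial
    \<open>p * r\<close>, whose squarefree part is known.\<close>
  have "m * ev r ^ 2 = ev (p * r)" using pr by (simp add: power2_eq_square)
  then have mr: "m * ev r ^ 2 = emb k * ev s ^ 2 * ev ?L" unfolding d(4) by (simp del: ev_prod)
  have CI: "C \<subseteq> b ` I"
  proof
    fix c assume c: "c \<in> C"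
    show "c \<in> b ` I"
    proof (rule ccontr)
      assume "c \<notin> b ` I"
      then have nz: "poly f c \<noteq> 0" using fin by (auto simp: poly_f)
      obtain q where q: "q \<in> P" "hasval q x c" using ex_point by blast
      obtain t where t: "t ^ 2 = poly f c" using nonzero_sqrt by blast
      then have t0: "t \<noteq> 0" "- t \<noteq> 0" "(- t) ^ 2 = poly f c" using nz by auto
      have q1: "q (x - emb c) = 1"
        using ordinary_point_y[OF q t] ordinary_point[OF q _ t t0(1)] ordinary_point[OF q _ t0(3,2)] by blast
      have qL: "q (ev ?L) = 1" using v_ev[OF q L0] q1 order_prod_linear[OF d(3), of id c] c by simp
      have "q (m * ev r ^ 2) = q m + 2 * q (ev r)"
        using v_mult[OF q(1) m(2), of "ev r ^ 2"] v_power[OF q(1), of "ev r" 2] pr(1) by simp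
      moreover have "q (emb k * ev s ^ 2 * ev ?L) = 2 * q (ev s) + 1"
        using q d L0 qL by (simp add: v_mult v_power del: ev_prod)
      moreover have "Poly_Mapping.lookup (D + D) q = q m" unfolding D using m q by (simp add: lookup_pdiv)
      then have "q m = 2 * Poly_Mapping.lookup D q" by (simp add: lookup_add)
      ultimately have "2 * Poly_Mapping.lookup D q + 2 * q (ev r) = 2 * q (ev s) + 1" using mr by simp
      then show False by presburger
    qed
  qed
  define S where "S = {i \<in> I. b i \<in> C}"
  have SI: "S \<subseteq> I" by (auto simp: S_def)
  have bS: "C = b ` S" using CI by (auto simp: S_def)
  have injS: "inj_on b S" using inj_b SI by (rule inj_on_subset)
  have evL: "ev ?L = (\<Prod>i\<in>S. x - emb (b i))"
    unfolding bS using injS by (simp add: prod.reindex)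
  have finS: "finite S" using SI fin finite_subset by blast
  have pL: "pdiv (\<Prod>i\<in>T. x - emb (b i)) = (\<Sum>i\<in>T. E i) + (\<Sum>i\<in>T. E i)" if "finite T" "T \<subseteq> I" for T
    using that
  proof (induction T rule: finite_induct)
    case (insert i T)
    then have "pdiv (\<Prod>i\<in>insert i T. x - emb (b i)) = pdiv (x - emb (b i)) + pdiv (\<Prod>i\<in>T. x - emb (b i))"
      unfolding prod.insert[OF insert.hyps] by (intro pdiv_mult) auto
    then show ?case using insert pdiv_x_b[of i] by (simp add: add_ac)
  qed (simp add: pdiv_1)
  have "D + D + (pdiv (ev r) + pdiv (ev r)) = pdiv (m * ev r ^ 2)"
    using pdiv_mult[OF m(2), of "ev r * ev r"] pdiv_mult[of "ev r" "ev r"] pr(1)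
    by (simp add: D power2_eq_square)
  also have "\<dots> = pdiv (ev s) + pdiv (ev s) + ((\<Sum>i\<in>S. E i) + (\<Sum>i\<in>S. E i))"
    unfolding mr evL unfolding power2_eq_square pL[OF finS SI, symmetric]
    using d(1,2) finS pdiv_mult[of "emb k * (ev s * ev s)" "\<Prod>i\<in>S. x - emb (b i)"]
      pdiv_mult[of "emb k" "ev s * ev s"] pdiv_mult[of "ev s" "ev s"] pdiv_emb[of k]
    by simp
  finally have "(D + pdiv (ev r)) + (D + pdiv (ev r)) = (pdiv (ev s) + (\<Sum>i\<in>S. E i)) + (pdiv (ev s) + (\<Sum>i\<in>S. E i))"
    by (simp add: algebra_simps)
  then have "D + pdiv (ev r) = pdiv (ev s) + (\<Sum>i\<in>S. E i)" by (rule poly_mapping_double_cancel)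
  then have "D = (\<Sum>i\<in>S. E i) + pdiv (ev s / ev r)"
    using d pr by (simp add: pdiv_divide algebra_simps)
  then show ?thesis using SI d pr by (intro exI[of _ "ev s / ev r"] exI[of _ S]) auto
qed

text \<open>An application of Hilbert 90: \<open>h = k / bar k\<close> with \<open>k = 1 + h\<close>.\<close>

lemma hilbert90_divisor:
  assumes h: "h * bar h = 1" "h \<noteq> - 1" and u: "bar u = u" "u \<noteq> 0" and D: "D + D = pdiv (h * u)"
  shows "\<exists>A S. A \<noteq> 0 \<and> bar A = A \<and> S \<subseteq> I \<and> D = (\<Sum>i\<in>S. E i) + pdiv A + pdiv (1 + h)"
proof -
  define k where "k = 1 + h"
  have h0: "h \<noteq> 0" using h by auto
  have k0: "k \<noteq> 0" unfolding k_def using h(2) by (metis add.commute add_eq_0_iff)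
  then have bk0: "bar k \<noteq> 0" using bar.eq_0_iff by blast
  have "h * bar k = k" unfolding k_def using h by (simp add: algebra_simps)
  then have 1: "pdiv h = pdiv k - pdiv (bar k)" using pdiv_mult[OF h0 bk0] by simp
  \<comment> \<open>From \<open>h = k / bar k\<close> follows
    \<open>h * u / k^2 = u / (k * bar k)\<close>, which is invariant under \<open>bar\<close>. So
    \<open>D\<close> minus the divisor of \<open>k\<close> falls under
    \<open>even_divisor\<close>.\<close>
  have 2: "pdiv (u / (k * bar k)) = pdiv u - (pdiv k + pdiv (bar k))"
    using u k0 bk0 by (simp add: pdiv_divide pdiv_mult)
  have "(D - pdiv k) + (D - pdiv k) = (D + D) - (pdiv k + pdiv k)"
    by (simp add: algebra_simps)
  also have "\<dots> = pdiv (u / (k * bar k))"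
    unfolding D pdiv_mult[OF h0 u(2)] 1 2 by (simp add: algebra_simps)
  finally have "(D - pdiv k) + (D - pdiv k) = pdiv (u / (k * bar k))" .
  moreover have "bar (u / (k * bar k)) = u / (k * bar k)" using u by (simp add: mult.commute)
  moreover have "u / (k * bar k) \<noteq> 0" using u k0 bk0 by simp
  ultimately obtain A S where "A \<noteq> 0" "bar A = A" "S \<subseteq> I" "D - pdiv k = (\<Sum>i\<in>S. E i) + pdiv A"
    using even_divisor by blast
  then show ?thesis unfolding k_def[symmetric] by (intro exI[of _ A] exI[of _ S]) (auto simp: algebra_simps)
qed

lemma norm_scale:
  assumes "n \<noteq> 0" "u \<noteq> 0" "pdiv n = pdiv u + pdiv u"
  shows "\<exists>s. s \<noteq> 0 \<and> n = (emb s * u) ^ 2"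
proof -
  have "pdiv (n / u ^ 2) = 0" using assms by (simp add: pdiv_divide pdiv_mult power2_eq_square)
  moreover have "n / u ^ 2 \<noteq> 0" using assms by simp
  ultimately obtain c where c: "n / u ^ 2 = emb c" using pdiv_0_const by blast
  obtain s where s: "s ^ 2 = c" using nonzero_sqrt by blast
  have "n = emb c * u ^ 2" using c assms(2) by (simp add: field_simps)
  then have n: "n = (emb s * u) ^ 2" using s by (simp add: power_mult_distrib flip: emb.power)
  then have "s \<noteq> 0" using assms(1) by auto
  then show ?thesis using n by blast
qed

text \<open>Let \<open>h\<close> have divisor \<open>2 * D\<close> and \<open>u\<close> divisor
  \<open>D + bar D\<close>. Then the norm of \<open>h\<close> and \<open>u^2\<close> have the same
  divisor, so a constant multiple of \<open>u\<close> turns \<open>h / u\<close> into a function of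
  norm 1 and Hilbert 90 applies.\<close>

lemma two_torsion:
  assumes D: "Div0 D" "principal (D + D)"
  shows "\<exists>S. S \<subseteq> I \<and> principal (D - (\<Sum>i\<in>S. E i))"
proof -
  obtain h where h: "h \<noteq> 0" "D + D = pdiv h" using D(2) by (auto simp: principal_def)
  obtain u where u: "u \<noteq> 0" "bar u = u" "D + act bar D = pdiv u" using norm_divisor0[OF D(1)] by blast
  have "pdiv (h * bar h) = pdiv h + act bar (pdiv h)"
    using h act_pdiv[OF semiaut_bar] by (simp add: pdiv_mult)
  also have "\<dots> = pdiv u + pdiv u"
    unfolding u(3)[symmetric] h(2)[symmetric] by (simp add: act_add[OF bij_bar] algebra_simps)
  finally obtain s where s: "s \<noteq> 0" "h * bar h = (emb s * u) ^ 2" using norm_scale[of "h * bar h" u] h u by auto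
  \<comment> \<open>The constant is determined up to sign; the sign is chosen so that
    \<open>1 + h / (t u)\<close> does not vanish.\<close>
  obtain t where t: "t \<noteq> 0" "h * bar h = (emb t * u) ^ 2" "h / (emb t * u) \<noteq> - 1"
  proof (cases "h / (emb s * u) = - 1")
    case True
    have "h / (emb (- s) * u) = - (h / (emb s * u))" by simp
    then have "h / (emb (- s) * u) = 1" using True by simp
    moreover have "(1::'f) \<noteq> - 1"
    proof
      assume "(1::'f) = - 1"
      then have "(2::'f) = 0" by (metis add.right_inverse one_add_one)
      then show False using two_F by simp
    qed
    ultimately show ?thesis using that[of "- s"] s by simp
  qed (use that s in blast)
  let ?u = "emb t * u"
  have "h / ?u * bar (h / ?u) = 1"
  proof -
    have "h / ?u * bar (h / ?u) = (h * bar h) / ?u ^ 2" using u by (simp add: power2_eq_square)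
    then show ?thesis using t u by simp
  qed
  moreover have "bar ?u = ?u" "?u \<noteq> 0" using u t by auto
  moreover have "D + D = pdiv (h / ?u * ?u)" using h t u by simp
  ultimately obtain A S where AS: "A \<noteq> 0" "S \<subseteq> I" "D = (\<Sum>i\<in>S. E i) + pdiv A + pdiv (1 + h / ?u)"
    using hilbert90_divisor[OF _ t(3)] by blast
  have "1 + h / ?u \<noteq> 0" using t(3) by (metis add.commute add_eq_0_iff)
  then have "principal (D - (\<Sum>i\<in>S. E i))"
    unfolding AS(3) using AS(1) by (simp add: principal_add principal_pdiv)
  then show ?thesis using AS(2) by blast
qed

text \<open>A function with such a divisor satisfies \<open>bar h = h\<close> or
  \<open>bar h = - h\<close>. So \<open>h\<close> or \<open>h / y\<close> is rational in
  \<open>x\<close>, with even order on all of \<open>W\<close>, while \<open>y\<close> has odd order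
  at every point of \<open>W\<close>. This detects when sums of the \<open>E i\<close> are
  nontrivial.\<close>

lemma parity:
  assumes "principal D" "Poly_Mapping.keys D \<subseteq> W" "w \<in> W" "w' \<in> W"
  shows "even (Poly_Mapping.lookup D w) \<longleftrightarrow> even (Poly_Mapping.lookup D w')"
proof -
  obtain h where h: "h \<noteq> 0" "D = pdiv h" using assms(1) by (auto simp: principal_def)
  have "act bar D = D"
  proof (rule poly_mapping_eqI)
    fix v :: "'f \<Rightarrow> int"
    have "(v \<circ> bar) \<circ> bar = v" by (simp add: fun_eq_iff)
    then have "v \<circ> bar \<in> W \<longleftrightarrow> v \<in> W" using W_bar[of v] W_bar[of "v \<circ> bar"] by auto
    then show "Poly_Mapping.lookup (act bar D) v = Poly_Mapping.lookup D v"
      unfolding lookup_act[OF bij_bar] using W_bar[of v] assms(2) in_keys_iff[of v D] in_keys_iff[of "v \<circ> bar" D]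
      by (cases "v \<in> W") auto
  qed
  then have "pdiv (bar h / h) = 0"
    using h act_pdiv[OF semiaut_bar h(1)] by (simp add: pdiv_divide)
  then obtain c where "bar h / h = emb c" using pdiv_0_const[of "bar h / h"] h by auto
  then have bh: "bar h = emb c * h" using h by (simp add: field_simps)
  then have "bar (bar h) = emb c * (emb c * h)" by simp
  then have "emb (c * c) = 1" using h(1) by simp
  then have "c * c = 1" using emb.eq_iff[of "c * c" 1] by (simp del: emb.eq_iff)
  then have c: "c = 1 \<or> c = - 1" by (simp add: square_eq_1_iff)
  have lk: "Poly_Mapping.lookup D v = v h" if "v \<in> W" for v
    using that h W_points by (simp add: lookup_pdiv)
  show ?thesis
  proof (cases "c = 1")
    case True
    then show ?thesis using bh h assms fixed_even lk by simp
  next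
    case False
    then have "bar (h / y) = h / y" using c bh by simp
    then have ev: "even (v (h / y))" if "v \<in> W" for v using fixed_even[OF that] h by simp
    have "odd (v h)" if "v \<in> W" for v
    proof -
      have "v h = v (h / y) + v y" using v_mult[OF W_points[OF that], of "h / y" y] h by simp
      then show ?thesis using ev[OF that] W_ramified[OF that] by (simp add: ramified_def)
    qed
    then show ?thesis using lk assms by simp
  qed
qed

end

section \<open>The Kummer map\<close>

lemma sum_zero_parity:
  fixes l a k :: int
  assumes "l + a + k = 0" "even a"
  shows "odd l \<longleftrightarrow> odd k"
  using assms by presburger

lemma divide_mult_self: "(c::'a::field) \<noteq> 0 \<Longrightarrow> c / (a * c) = inverse a"
  by (simp add: divide_inverse)

context odd_model
begin

lemma hasval_bar:
  assumes "w \<in> W" "hasval w h a"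
  shows "hasval w (bar h) a"
proof -
  have "vpos w (bar (h - emb a))"
    using assms W_bar[OF assms(1)] vpos_bar[of w "h - emb a"] by (simp only: hasval_def)
  then show ?thesis by (simp add: hasval_def)
qed

lemma v_bar: "w \<in> W \<Longrightarrow> w (bar h) = w h"
  using W_bar[of w] by (metis comp_apply)

text \<open>The subset \<open>S\<close> is read off from the signs of \<open>g = h / u\<close> at
  the Weierstrass points. \<open>D\<close> avoids these points, so Hilbert 90 relates membership in
  \<open>S\<close> to the parity of the order of \<open>k = 1 + g\<close>.\<close>

lemma two_torsion_even:
  assumes D: "Div0 D" "\<And>w. w \<in> W \<Longrightarrow> Poly_Mapping.lookup D w = 0"
    and h: "h \<noteq> 0" "D + D = pdiv h" and u: "u \<noteq> 0" "bar u = u"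
    and n: "h * bar h = u ^ 2" and inf: "hasval pinf (h / u) 1"
  shows "\<exists>S. S \<subseteq> I \<and> even (card S) \<and> principal (D - (\<Sum>i\<in>S. E i)) \<and>
    (\<forall>j\<in>I. (hasval (e j) (h / u) 1 \<longrightarrow> j \<notin> S) \<and> (hasval (e j) (h / u) (- 1) \<longrightarrow> j \<in> S))"
proof -
  define g where "g = h / u"
  define k where "k = 1 + g"
  have pinfW: "pinf \<in> W" by (simp add: W_def)
  have g0: "g \<noteq> 0" using h u by (simp add: g_def)
  have n1: "g * bar g = 1"
  proof -
    have "g * bar g = (h * bar h) / u ^ 2" using u by (simp add: g_def power2_eq_square)
    then show ?thesis using n u by simp
  qed
  have one_v: "hasval v 1 1" if "v \<in> P" for v using hasval_emb[OF that, of 1] by simp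
  have one_one: "(1::'a) + 1 \<noteq> 0" using two by simp
  have kinf: "hasval pinf k (1 + 1)"
    unfolding k_def g_def using inf pinf(1) one_v by (intro hasval_add) auto
  have k0: "k \<noteq> 0" and kinf0: "pinf k = 0"
    using hasval_unit[OF pinf(1) kinf one_one] by auto
  have gm: "g \<noteq> - 1" using k0 by (auto simp: k_def)
  have "D + D = pdiv (g * u)" using h u by (simp add: g_def)
  from hilbert90_divisor[OF n1 gm u(2,1) this] obtain A S where
    A: "A \<noteq> 0" "bar A = A" and S: "S \<subseteq> I" and DS: "D = (\<Sum>i\<in>S. E i) + pdiv A + pdiv k"
    unfolding k_def by blast
  have lk: "Poly_Mapping.lookup (\<Sum>i\<in>S. E i) w + w A + w k = 0" if "w \<in> W" for w
  proof -
    have "Poly_Mapping.lookup D w = Poly_Mapping.lookup (\<Sum>i\<in>S. E i) w + w A + w k"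
      unfolding DS using A k0 W_points[OF that] by (simp add: lookup_add lookup_pdiv)
    then show ?thesis using D(2)[OF that] by simp
  qed
  \<comment> \<open>At infinity \<open>k\<close> has value 2 and is a unit, so the size of
    \<open>S\<close> equals the order of \<open>A\<close>, which is even because \<open>A\<close> is
    rational in \<open>x\<close>.\<close>
  have "- int (card S) + pinf A = 0" using lk[OF pinfW] lookup_sum_E(2)[OF S] kinf0 by simp
  then have "even (card S)" using fixed_even[OF pinfW A(2,1)] by auto
  moreover have "principal (D - (\<Sum>i\<in>S. E i))"
    unfolding DS using A(1) k0 by (simp add: principal_add principal_pdiv)
  moreover have "(hasval (e j) g 1 \<longrightarrow> j \<notin> S) \<and> (hasval (e j) g (- 1) \<longrightarrow> j \<in> S)" if j: "j \<in> I" for j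
  proof -
    have jW: "e j \<in> W" and jP: "e j \<in> P" using j e by (auto simp: W_def)
    have par: "j \<in> S \<longleftrightarrow> odd (e j k)"
      using sum_zero_parity[OF lk[OF jW] fixed_even[OF jW A(2,1)]] lookup_sum_E(1)[OF S j]
      by (simp split: if_splits)
    have "even (e j k)" if "hasval (e j) g 1"
    proof -
      have "hasval (e j) k (1 + 1)" unfolding k_def using that one_v[OF jP] jP by (intro hasval_add)
      then have "e j k = 0" using hasval_unit[OF jP _ one_one] by blast
      then show ?thesis by simp
    qed
    moreover have "odd (e j k)" if "hasval (e j) g (- 1)"
    proof -
      \<comment> \<open>Where \<open>g\<close> is -1, \<open>1 - g\<close> is a unit with value 2.
        Since \<open>bar g = 1 / g\<close>, the quotient \<open>(1 - g) / (1 + g)\<close> is negated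
        by \<open>bar\<close>; it is \<open>y\<close> times a rational function of \<open>x\<close>,
        hence of odd order.\<close>
      have "hasval (e j) (1 - g) (1 - - 1)" using that one_v[OF jP] jP by (intro hasval_diff)
      then have g1: "1 - g \<noteq> 0 \<and> e j (1 - g) = 0" using hasval_unit[OF jP, of "1 - g" "1 - - 1"] one_one by simp
      have bg: "bar g = inverse g" using n1 g0 by (metis inverse_unique)
      have "bar ((1 - g) / k) = (1 - inverse g) / (1 + inverse g)" unfolding k_def by (simp add: bg)
      also have "\<dots> = (g - 1) / (g + 1)"
      proof -
        have "1 - inverse g = (g - 1) / g" "1 + inverse g = (g + 1) / g" using g0 by (simp_all add: field_simps)
        then show ?thesis using g0 by simp
      qed
      also have "\<dots> = - ((1 - g) / k)" unfolding k_def by (simp add: add.commute minus_divide_left)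
      finally have "bar ((1 - g) / k) = - ((1 - g) / k)" .
      from bar_neg_repr[OF this] have "even (e j ((1 - g) / k / y))"
        using g1 k0 by (intro fixed_even[OF jW]) auto
      moreover have "e j ((1 - g) / k / y) = e j ((1 - g) / k) - e j y"
        using g1 k0 by (intro v_divide[OF jP]) auto
      moreover have "e j ((1 - g) / k) = - e j k"
        using g1 k0 v_divide[OF jP, of "1 - g" k] by simp
      ultimately show ?thesis using e_y[OF j] by simp
    qed
    ultimately show ?thesis using par by blast
  qed
  ultimately show ?thesis using S unfolding g_def by blast
qed

text \<open>The conic yields \<open>k = X + Y y\<close> with norm \<open>(x - b i) * Z^2\<close>, so
  at the Weierstrass points \<open>k\<close> has the parity of \<open>E i\<close>. Elsewhere the
  orders at a point and its conjugate have equal parity, and a product \<open>M\<close> of factors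
  \<open>x - c\<close> corrects the odd ones.\<close>

lemma ex_half:
  assumes i: "i \<in> I"
  shows "\<exists>Q k. Div0 Q \<and> k \<noteq> 0 \<and> Q + Q = E i + pdiv k"
proof -
  obtain X Y Z where XYZ: "X \<noteq> 0 \<or> Y \<noteq> 0 \<or> Z \<noteq> 0" "X ^ 2 = f * Y ^ 2 + [:- b i, 1:] * Z ^ 2"
    using conic_solution[OF f_nz, of "[:- b i, 1:]"] by auto
  have XY: "X \<noteq> 0 \<or> Y \<noteq> 0"
  proof (rule ccontr)
    assume "\<not> ?thesis"
    then have "[:- b i, 1:] * Z ^ 2 = 0" using XYZ(2) by simp
    then have "Z = 0" by (simp only: mult_eq_0_iff power_eq_0_iff) simp
    then show False using XYZ(1) \<open>\<not> (X \<noteq> 0 \<or> Y \<noteq> 0)\<close> by simp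
  qed
  have nn: "X ^ 2 - Y ^ 2 * f = [:- b i, 1:] * Z ^ 2" unfolding XYZ(2) by (simp add: mult.commute)
  then have Z0: "Z \<noteq> 0" using norm_neq_0[OF XY] by auto
  define k where "k = ev X + ev Y * y"
  have k0: "k \<noteq> 0" using ev_y_eq_0[of X Y] XY by (auto simp: k_def)
  have "k * bar k = ev (X ^ 2 - Y ^ 2 * f)" unfolding k_def using ev_y_norm[of X Y] by simp
  then have kn: "k * bar k = (x - emb (b i)) * ev Z ^ 2" unfolding nn by (simp only: ev_mult ev_power) simp
  have vk: "v k + v (bar k) = v (x - emb (b i)) + 2 * v (ev Z)" if "v \<in> P" for v
  proof -
    have "v (k * bar k) = v ((x - emb (b i)) * ev Z ^ 2)" using kn by simp
    then show ?thesis using that k0 Z0 by (simp add: v_mult v_power)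
  qed
  \<comment> \<open>The values of \<open>x\<close> over which \<open>k\<close> has odd order away
    from the Weierstrass points.\<close>
  define C where "C = {c. c \<notin> b ` I \<and> (\<exists>v\<in>P. hasval v x c \<and> odd (v k))}"
  have "C \<subseteq> (\<lambda>v. THE c. hasval v x c) ` {v \<in> P. v k \<noteq> 0}"
  proof
    fix c assume "c \<in> C"
    then obtain v where v: "v \<in> P" "hasval v x c" "odd (v k)" by (auto simp: C_def)
    have "(THE c. hasval v x c) = c"
      using v hasval_unique[OF v(1)] by (intro the_equality) auto
    moreover have "v k \<noteq> 0" using v(3) by (metis even_zero)
    ultimately show "c \<in> (\<lambda>v. THE c. hasval v x c) ` {v \<in> P. v k \<noteq> 0}" using v(1) by force
  qed
  then have finC: "finite C" by (rule finite_subset) (rule finite_imageI[OF finite_support[OF k0]])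
  let ?L = "\<Prod>c\<in>C. [:- c, 1:]"
  have L0: "?L \<noteq> 0" using finC prod_zero_iff[of C "\<lambda>c. [:- c, 1:]"] by auto
  define M where "M = ev ?L"
  have M0: "M \<noteq> 0" "bar M = M" using L0 by (simp_all add: M_def del: ev_prod)
  have par: "even (v (k * M) - Poly_Mapping.lookup (E i) v)" if v: "v \<in> P" for v
    using v
  proof (cases rule: point_over)
    case inf
    have w: "v \<in> W" by (simp add: W_def inf)
    have "2 * v k = - 2 + 2 * v (ev Z)" using vk[OF v] v_bar[OF w, of k] pinf_x inf by simp
    then have "v k = v (ev Z) - 1" by simp
    then have "odd (v k)" using fixed_even[OF w, of "ev Z"] Z0 by simp
    moreover have "even (v M)" using fixed_even[OF w] M0 by blast
    ultimately show ?thesis using v_mult[OF v k0 M0(1)] lookup_E(2)[OF i] inf by simp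
  next
    case (branch j)
    have w: "v \<in> W" using branch by (simp add: W_def)
    have "2 * v k = (if j = i then 2 else 0) + 2 * v (ev Z)"
      using vk[OF v] v_bar[OF w, of k] e_x[OF branch(1) i] branch(2) by simp
    then have "v k = (if j = i then 1 else 0) + v (ev Z)" by (simp split: if_splits)
    then have "even (v k) \<longleftrightarrow> j \<noteq> i" using fixed_even[OF w, of "ev Z"] Z0 by simp
    moreover have "even (v M)" using fixed_even[OF w] M0 by blast
    ultimately show ?thesis using v_mult[OF v k0 M0(1)] lookup_E(1)[OF i branch(1)] branch(2) by auto
  next
    case (ordinary c s)
    have vW: "v \<notin> W"
    proof
      assume "v \<in> W"
      then consider "v = pinf" | j where "j \<in> I" "v = e j" by (auto simp: W_def)
      then show False
      proof cases
        case 1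
        then show False using not_both_cases[OF pinf] ordinary(2) by auto
      next
        case 2
        then show False using hasval_unique[OF v ordinary(2), of "b j"] e(2)[OF 2(1)] ordinary(1) by auto
      qed
    qed
    have "hasval v (x - emb (b i)) (c - b i)" using ordinary v by (intro hasval_diff hasval_emb)
    moreover have "c - b i \<noteq> 0" using ordinary(1) i by auto
    ultimately have "v (x - emb (b i)) = 0" using hasval_unit[OF v] by blast
    then have vb: "even (v k) \<longleftrightarrow> even (v (bar k))"
      using vk[OF v] by (metis add_0 dvd_triv_left even_add)
    have "c \<in> C \<longleftrightarrow> odd (v k)"
    proof
      assume "c \<in> C"
      then obtain v' where v': "v' \<in> P" "hasval v' x c" "odd (v' k)" by (auto simp: C_def)
      have "0 < v' (x - emb c)" using over_hasval[OF v'(1)] v'(2) by simp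
      then have "v' = v \<or> v' = v \<circ> bar" using v_x_minus_c[OF v ordinary(2) v'(1)] by (auto split: if_splits)
      then show "odd (v k)" using v'(3) vb by auto
    qed (use ordinary v in \<open>auto simp: C_def\<close>)
    moreover have "v M = (if c \<in> C then 1 else 0)"
      unfolding M_def v_ev[OF v ordinary(2) L0] ordinary_point[OF v ordinary(2,5,3,4)]
      using order_prod_linear[OF finC, of id c] by simp
    ultimately show ?thesis using v_mult[OF v k0 M0(1)] lookup_E(3)[OF i vW] by auto
  qed
  have kM0: "k * M \<noteq> 0" using k0 M0 by simp
  have "even (Poly_Mapping.lookup (E i - pdiv (k * M)) v)" for v
  proof (cases "v \<in> P")
    case True
    then show ?thesis using par[OF True] lookup_pdiv[OF kM0] by (simp add: lookup_minus)
  next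
    case False
    then have "v \<notin> Poly_Mapping.keys (E i)" using Div0_E[OF i] by (auto simp: Div0_def)
    then show ?thesis using False lookup_pdiv[OF kM0] by (simp add: lookup_minus in_keys_iff)
  qed
  then obtain Q where Q: "Q + Q = E i - pdiv (k * M)" using poly_mapping_half by blast
  have "Div0 (Q + Q)" unfolding Q using Div0_E[OF i] principal_Div0[OF principal_pdiv[OF kM0]]
    by (rule Div0_diff)
  then have "Div0 Q" by (auto simp: Div0_def subset_eq in_keys_iff lookup_add)
  moreover have "Q + Q = E i + pdiv (inverse (k * M))" unfolding Q using pdiv_inverse[OF kM0] by simp
  ultimately show ?thesis using kM0 inverse_nonzero_iff_nonzero by blast
qed

text \<open>The last condition serves the point at infinity, where the constant
  \<open>\<kappa>\<close> of \<open>hasval_ratio\<close> is a square root of -1. Galois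
  automorphisms over \<open>K\<close> satisfy it, because \<open>K\<close> contains the image of the
  complex numbers.\<close>

definition compatible :: "('a \<Rightarrow> 'a) \<Rightarrow> ('f \<Rightarrow> 'f) \<Rightarrow> bool" where
  "compatible \<sigma> \<tau> \<longleftrightarrow> semiaut emb \<sigma> \<tau> \<and> \<tau> x = x \<and> \<tau> y = y \<and> (\<forall>i\<in>I. \<sigma> (b i) = b i) \<and>
     (\<forall>s. s ^ 2 = - 1 \<longrightarrow> \<sigma> s = s)"

context
  fixes \<sigma> \<tau> assumes comp: "compatible \<sigma> \<tau>"
begin

lemma semi: "semiaut emb \<sigma> \<tau>" and tau_x [simp]: "\<tau> x = x" and tau_y [simp]: "\<tau> y = y"
  and sigma_b: "i \<in> I \<Longrightarrow> \<sigma> (b i) = b i" and sigma_i: "s ^ 2 = - 1 \<Longrightarrow> \<sigma> s = s"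
  and bij_tau: "bij \<tau>" and tau_emb: "\<tau> (emb a) = emb (\<sigma> a)"
  using comp by (auto simp: compatible_def semiaut_def)

lemma W_tau:
  assumes "w \<in> W"
  shows "w \<circ> \<tau> = w"
proof -
  consider "w = pinf" | i where "i \<in> I" "w = e i" using assms by (auto simp: W_def)
  then show ?thesis
  proof cases
    case 1
    have "pinf \<circ> \<tau> \<in> P" using semiaut_points[OF semi] pinf by simp
    then show ?thesis using 1 pinf_eqI[of "pinf \<circ> \<tau>"] pinf by simp
  next
    case 2
    have "e i \<circ> \<tau> \<in> P" using semiaut_points[OF semi] e 2 by simp
    moreover have "hasval (e i \<circ> \<tau>) x (b i)"
      using semiaut_hasval[OF semi refl, of "e i" x "b i"] e[OF 2(1)] sigma_b[OF 2(1)] by simp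
    ultimately show ?thesis using e_eqI[OF _ 2(1), of "e i \<circ> \<tau>"] 2(2) by simp
  qed
qed

lemma act_E: "i \<in> I \<Longrightarrow> act \<tau> (E i) = E i"
  using act_frag_of[OF bij_tau, of "e i"] act_frag_of[OF bij_tau, of pinf] W_tau[of "e i"] W_tau[of pinf]
  by (simp add: E_def act_diff[OF bij_tau] W_def)

lemma bar_tau: "bar (\<tau> h) = \<tau> (bar h)"
proof -
  interpret t: fld_hom \<tau> using semi by unfold_locales (simp add: semiaut_def)
  have "(\<lambda>h. bar (\<tau> h)) = (\<lambda>h. \<tau> (bar h))"
    using generated tau_emb
    by (intro field_hom_eq_on_gen[of _ _ "range emb \<union> {x, y}"]) (auto simp: field_hom_def)
  then show ?thesis by metis
qed

text \<open>At a Weierstrass point \<open>g\<close> and \<open>bar g\<close> take the same value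
  \<open>\<kappa>\<close>, and \<open>\<tau> g\<close> takes the value
  \<open>\<sigma> \<kappa>\<close> there because \<open>\<tau>\<close> fixes the point.\<close>

lemma hasval_ratio:
  assumes w: "w \<in> W" and g: "g \<noteq> 0" "w g = 0" and n: "hasval w (g * bar g) c"
  shows "\<exists>\<kappa>. \<kappa> \<noteq> 0 \<and> \<kappa> ^ 2 = c \<and> hasval w (\<tau> g / g) (\<sigma> \<kappa> / \<kappa>)"
proof -
  have wP: "w \<in> P" using W_points[OF w] .
  obtain \<kappa> where k: "\<kappa> \<noteq> 0" "hasval w g \<kappa>" using unit_value[OF w g] by blast
  have "hasval w (g * bar g) (\<kappa> * \<kappa>)" using k(2) hasval_bar[OF w k(2)] wP by (intro hasval_mult)
  then have "\<kappa> * \<kappa> = c" using hasval_unique[OF wP] n by blast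
  moreover have "hasval w (\<tau> g) (\<sigma> \<kappa>)" using semiaut_hasval[OF semi W_tau[OF w]] k(2) by blast
  then have "hasval w (\<tau> g / g) (\<sigma> \<kappa> / \<kappa>)" using k wP by (intro hasval_divide)
  ultimately show ?thesis using k(1) by (auto simp: power2_eq_square)
qed


text \<open>The Kummer map: the class of \<open>\<tau> Q - Q\<close> is read off from the values of \<open>\<tau> g / g\<close> at the
  Weierstrass points, where \<open>g\<close> has norm \<open>1 / (x - b i)\<close>.\<close>

lemma kummer:
  assumes i: "i \<in> I" and Q: "Div0 Q" "k \<noteq> 0" "Q + Q = E i + pdiv k"
  shows "\<exists>S. S \<subseteq> I \<and> even (card S) \<and> principal (act \<tau> Q - Q - (\<Sum>j\<in>S. E j)) \<and>
    (\<forall>j\<in>I - {i}. \<forall>r. r ^ 2 = b j - b i \<longrightarrow> (\<sigma> r = r \<longrightarrow> j \<notin> S) \<and> (\<sigma> r = - r \<longrightarrow> j \<in> S))"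
proof -
  interpret t: fld_hom \<tau> using semi by unfold_locales (simp add: semiaut_def)
  interpret s: fld_hom \<sigma> using semi by unfold_locales (simp add: semiaut_def)
  let ?X = "x - emb (b i)"
  have tX: "\<tau> ?X = ?X" using tau_emb sigma_b[OF i] by simp
  have bX: "bar ?X = ?X" by simp
  obtain u0 where u0: "u0 \<noteq> 0" "bar u0 = u0" "Q + act bar Q = pdiv u0" using norm_divisor0[OF Q(1)] by blast
  have bk0: "bar k \<noteq> 0" and kk0: "k * bar k \<noteq> 0" using Q(2) by auto
  have "act bar (Q + Q) = E i + pdiv (bar k)"
    unfolding Q(3) using act_bar_E[OF i] act_pdiv[OF semiaut_bar Q(2)] by (simp add: act_add[OF bij_bar])
  then have 1: "act bar Q + act bar Q = E i + pdiv (bar k)" by (simp add: act_add[OF bij_bar])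
  \<comment> \<open>The divisor is \<open>2 * Q + 2 * bar Q\<close>, twice that of
    \<open>u0\<close>. Rescaling \<open>u0\<close> to \<open>u\<close> makes the function equal to
    \<open>u^2\<close>, so that \<open>g = k / u\<close> has norm exactly
    \<open>1 / (x - b i)\<close>.\<close>
  have "pdiv (?X * (k * bar k)) = pdiv ?X + (pdiv k + pdiv (bar k))"
    unfolding pdiv_mult[OF x_b_nz kk0] pdiv_mult[OF Q(2) bk0] ..
  also have "\<dots> = (E i + pdiv k) + (E i + pdiv (bar k))" unfolding pdiv_x_b[OF i] by (simp add: algebra_simps)
  also have "\<dots> = pdiv u0 + pdiv u0" unfolding Q(3)[symmetric] 1[symmetric] u0(3)[symmetric] by (simp add: algebra_simps)
  finally have "pdiv (?X * (k * bar k)) = pdiv u0 + pdiv u0" .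
  moreover have "?X * (k * bar k) \<noteq> 0" using kk0 x_b_nz[of "b i"] by (simp only: mult_eq_0_iff) simp
  ultimately obtain c where c: "c \<noteq> 0" "?X * (k * bar k) = (emb c * u0) ^ 2"
    using norm_scale u0(1) by blast
  define u where "u = emb c * u0"
  have u: "u \<noteq> 0" "bar u = u" "?X * (k * bar k) = u ^ 2" "Q + act bar Q = pdiv u"
    using c u0 by (simp_all add: u_def pdiv_mult pdiv_emb)
  define g where "g = k / u"
  have g0: "g \<noteq> 0" using Q(2) u by (simp add: g_def)
  have gn: "g * bar g = inverse ?X"
  proof -
    have "g * bar g = (k * bar k) / u ^ 2" using u by (simp add: g_def power2_eq_square)
    also have "\<dots> = inverse ?X" unfolding u(3)[symmetric] using kk0 by (rule divide_mult_self)
    finally show ?thesis .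
  qed
  define D where "D = act \<tau> Q - Q"
  have D0: "Div0 D" unfolding D_def using Div0_act[OF semi Q(1)] Q(1) by (rule Div0_diff)
  have DW: "Poly_Mapping.lookup D w = 0" if "w \<in> W" for w
    unfolding D_def lookup_minus lookup_act[OF bij_tau] W_tau[OF that] by simp
  define h where "h = \<tau> k / k"
  define u' where "u' = \<tau> u / u"
  have h0: "h \<noteq> 0" and u'0: "u' \<noteq> 0" using Q(2) u(1) by (simp_all add: h_def u'_def)
  have bu': "bar u' = u'" using u(2) by (simp add: u'_def bar_tau)
  have DD: "D + D = pdiv h"
  proof -
    have "D + D = act \<tau> (Q + Q) - (Q + Q)" by (simp add: D_def act_add[OF bij_tau] algebra_simps)
    also have "\<dots> = pdiv (\<tau> k) - pdiv k"
      unfolding Q(3) act_add[OF bij_tau] act_E[OF i] act_pdiv[OF semi Q(2)] by simp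
    finally show ?thesis using Q(2) by (simp add: h_def pdiv_divide)
  qed
  have hu: "h / u' = \<tau> g / g" using u Q(2) by (simp add: h_def u'_def g_def)
  have nh: "h * bar h = u' ^ 2"
  proof -
    have "(\<tau> g / g) * bar (\<tau> g / g) = \<tau> (g * bar g) / (g * bar g)" by (simp add: bar_tau)
    also have "\<dots> = 1" unfolding gn t.inverse tX using x_b_nz[of "b i"] by (metis divide_self inverse_nonzero_iff_nonzero)
    finally have "(h / u') * bar (h / u') = 1" unfolding hu .
    then show ?thesis using u'0 bu' by (simp add: power2_eq_square)
  qed
  have inf: "hasval pinf (h / u') 1"
  proof -
    have W: "pinf \<in> W" by (simp add: W_def)
    obtain m where m: "card I = 2 * m + 1" using odd_card by (auto elim: oddE)
    \<comment> \<open>A uniformizer at infinity, fixed by \<open>\<tau>\<close> and negated by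
      \<open>bar\<close>. Since \<open>g\<close> also has order 1 there, \<open>g / z\<close> is a
      unit with the same ratio \<open>\<tau> g / g\<close>.\<close>
    define z where "z = y / ?X ^ (m + 1)"
    have z0: "z \<noteq> 0" using x_b_nz[of "b i"] by (simp add: z_def del: x_b_nz)
    have tz: "\<tau> z = z" unfolding z_def t.divide t.power tX by simp
    have bz: "bar z = - z" unfolding z_def bar.divide bar.power bX by simp
    have "pinf z = pinf y - pinf (?X ^ (m + 1))"
      unfolding z_def using x_b_nz[of "b i"] by (intro v_divide[OF pinf(1) y_nz]) (simp only: power_eq_0_iff, simp)
    also have "\<dots> = - int (card I) + 2 * int (m + 1)"
      unfolding v_power[OF pinf(1) x_b_nz] pinf_x pinf_y by simp
    finally have "pinf z = 1" using m by simp
    moreover have "pinf g = 1"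
    proof -
      have "pinf g + pinf (bar g) = pinf (inverse ?X)"
        using gn v_mult[OF pinf(1) g0, of "bar g"] g0 by simp
      then show ?thesis using v_bar[OF W, of g] v_inverse[OF pinf(1) x_b_nz] pinf_x by simp
    qed
    ultimately have gz: "g / z \<noteq> 0" "pinf (g / z) = 0" using g0 z0 v_divide[OF pinf(1)] by auto
    \<comment> \<open>The minus sign comes from \<open>bar z = - z\<close>. The rest is a product of
      quotients of linear functions of \<open>x\<close>, each with value 1 at infinity, so the norm
      has value -1.\<close>
    have "(g / z) * bar (g / z) = - (inverse ?X / z ^ 2)"
      using gn by (simp add: bz power2_eq_square flip: gn)
    also have "inverse ?X / z ^ 2 = ?X ^ card I / y ^ 2"
    proof -
      have "inverse ?X * (?X ^ (m + 1)) ^ 2 = ?X ^ card I"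
      proof -
        have "(?X ^ (m + 1)) ^ 2 = ?X * ?X ^ card I" 
        proof -
          have "(m + 1) * 2 = Suc (2 * m + 1)" by simp
          then show ?thesis unfolding m by (metis power_mult power_Suc)
        qed
        then show ?thesis using x_b_nz[of "b i"] by (simp add: mult.assoc[symmetric] del: x_b_nz)
      qed
      then show ?thesis unfolding z_def power_divide by (simp add: divide_divide_eq_right)
    qed
    also have "\<dots> = (\<Prod>j\<in>I. ?X / (x - emb (b j)))"
      unfolding y_square ev_f prod_dividef by simp
    finally have ng: "(g / z) * bar (g / z) = - (\<Prod>j\<in>I. ?X / (x - emb (b j)))" .
    have "hasval pinf (?X / (x - emb (b j))) 1" for j
    proof -
      let ?Y = "x - emb (b j)"
      have "?X / ?Y - emb 1 = emb (b j - b i) * inverse ?Y"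
        using x_b_nz[of "b j"] by (simp add: field_simps)
      moreover have "vpos pinf (inverse ?Y * emb (b j - b i))"
        using v_inverse[OF pinf(1) x_b_nz] pinf_x
        by (intro vpos_mult[OF pinf(1)] vnn_emb[OF pinf(1)]) (simp add: vpos_def)
      ultimately show ?thesis unfolding hasval_def by (simp only: mult.commute)
    qed
    then have "hasval pinf (\<Prod>j\<in>T. ?X / (x - emb (b j))) 1" for T
      using hasval_emb[OF pinf(1), of 1] hasval_mult[OF pinf(1), of _ 1 _ 1]
      by (induction T rule: infinite_finite_induct) (simp_all del: times_divide_eq_left times_divide_eq_right)
    then have "hasval pinf ((g / z) * bar (g / z)) (- 1)"
      unfolding ng by (rule hasval_uminus[OF pinf(1)])
    then obtain \<kappa> where k: "\<kappa> \<noteq> 0" "\<kappa> ^ 2 = - 1" "hasval pinf (\<tau> (g / z) / (g / z)) (\<sigma> \<kappa> / \<kappa>)"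
      using hasval_ratio[OF W gz] by blast
    have "\<tau> (g / z) / (g / z) = \<tau> g / g" using z0 by (simp add: tz)
    then show ?thesis using k sigma_i[OF k(2)] unfolding hu by simp
  qed
  from two_torsion_even[OF D0 DW h0 DD u'0 bu' nh inf] obtain S where
    S: "S \<subseteq> I" "even (card S)" "principal (D - (\<Sum>i\<in>S. E i))"
      "\<And>j. j \<in> I \<Longrightarrow> hasval (e j) (h / u') 1 \<Longrightarrow> j \<notin> S"
      "\<And>j. j \<in> I \<Longrightarrow> hasval (e j) (h / u') (- 1) \<Longrightarrow> j \<in> S"
    by blast
  have "(\<sigma> r = r \<longrightarrow> j \<notin> S) \<and> (\<sigma> r = - r \<longrightarrow> j \<in> S)" if j: "j \<in> I" "j \<noteq> i" and r: "r ^ 2 = b j - b i" for j r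
  proof -
    have W: "e j \<in> W" and P: "e j \<in> P" using j e by (auto simp: W_def)
    have d: "b j - b i \<noteq> 0" using j i inj_b by (auto simp: inj_on_def)
    have "hasval (e j) ?X (b j - b i)" using e[OF j(1)] by (intro hasval_diff hasval_emb)
    then have val: "hasval (e j) (g * bar g) (inverse (b j - b i))"
      unfolding gn using d P by (intro hasval_inverse)
    have "e j (g * bar g) = 0" using hasval_unit[OF P val] d by simp
    then have "e j g + e j (bar g) = 0" using v_mult[OF P g0, of "bar g"] g0 by simp
    then have "e j g = 0" using v_bar[OF W, of g] by simp
    then obtain \<kappa> where k: "\<kappa> \<noteq> 0" "\<kappa> ^ 2 = inverse (b j - b i)" "hasval (e j) (\<tau> g / g) (\<sigma> \<kappa> / \<kappa>)"
      using hasval_ratio[OF W g0 _ val] by blast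
    have r0: "r \<noteq> 0" using r d by auto
    \<comment> \<open>The value of \<open>g\<close> at \<open>e j\<close> is \<open>1 / r\<close> up
      to sign, so \<open>\<sigma> \<kappa> / \<kappa>\<close> records whether
      \<open>\<sigma>\<close> fixes or negates \<open>r\<close>.\<close>
    have "(\<kappa> * r) ^ 2 = 1" using k(2) r d by (simp add: power_mult_distrib)
    then have "\<kappa> * r = 1 \<or> \<kappa> * r = - 1" by (simp add: power2_eq_1_iff)
    then have kr: "\<kappa> = inverse r \<or> \<kappa> = - inverse r" using r0
      by (metis eq_divide_eq inverse_eq_divide minus_divide_left)
    have "\<sigma> r = r \<Longrightarrow> \<sigma> \<kappa> / \<kappa> = 1" "\<sigma> r = - r \<Longrightarrow> \<sigma> \<kappa> / \<kappa> = - 1"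
      using kr r0 by auto
    then show ?thesis using k(3) S(4,5)[OF j(1)] unfolding hu by metis
  qed
  then show ?thesis using S(1,2,3) unfolding D_def by blast
qed

end

end

section \<open>The action on four-torsion\<close>

context odd_model
begin

lemma principal_sum: "(\<And>i. i \<in> A \<Longrightarrow> principal (g i)) \<Longrightarrow> principal (sum g A)"
  by (induction A rule: infinite_finite_induct) (auto intro: principal_0 principal_add)

lemma keys_sum_E: "S \<subseteq> I \<Longrightarrow> Poly_Mapping.keys (\<Sum>i\<in>S. E i) \<subseteq> W"
  using lookup_sum_E(3) by (auto simp: in_keys_iff)

lemma e_W: "i \<in> I \<Longrightarrow> e i \<in> W" and pinf_W: "pinf \<in> W"
  by (auto simp: W_def)

definition four_torsion :: "'f divisor \<Rightarrow> bool" where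
  "four_torsion D \<longleftrightarrow> Div0 D \<and> principal (D + D + (D + D))"

lemma half_four_torsion:
  assumes "i \<in> I" "Div0 Q" "k \<noteq> 0" "Q + Q = E i + pdiv k"
  shows "four_torsion Q"
proof -
  have "Q + Q + (Q + Q) = (E i + E i) + (pdiv k + pdiv k)" unfolding assms(4) by (simp add: algebra_simps)
  also have "principal \<dots>" unfolding pdiv_x_b[OF assms(1), symmetric]
    using assms(3) by (intro principal_add principal_pdiv) simp_all
  finally show ?thesis using assms(2) by (simp add: four_torsion_def)
qed

context
  fixes \<sigma> \<tau> assumes comp: "compatible \<sigma> \<tau>"
begin

lemma sigma_sqrt:
  assumes "i \<in> I" "j \<in> I" "r ^ 2 = b j - b i"
  shows "\<sigma> r = r \<or> \<sigma> r = - r"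
proof -
  interpret s: fld_hom \<sigma> using semi[OF comp] by unfold_locales (simp add: semiaut_def)
  have "(\<sigma> r) ^ 2 = \<sigma> (r ^ 2)" by simp
  also have "\<dots> = r ^ 2" unfolding assms(3) using sigma_b[OF comp] assms by simp
  finally show ?thesis by (simp add: power2_eq_iff)
qed

text \<open>Four-torsion is generated by halves of the \<open>E i\<close> together with the
  \<open>E i\<close>: \<open>2 * D\<close> is equivalent to a sum of some \<open>E i\<close>, and
  subtracting the corresponding halves leaves two-torsion. The action is trivial on both kinds of
  generators.\<close>

lemma act_four_torsion_trivial:
  assumes sq: "\<And>i j r. i \<in> I \<Longrightarrow> j \<in> I \<Longrightarrow> i \<noteq> j \<Longrightarrow> r ^ 2 = b j - b i \<Longrightarrow> \<sigma> r = r"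
    and D: "four_torsion D"
  shows "principal (act \<tau> D - D)"
proof -
  have bij: "bij \<tau>" by (rule bij_tau[OF comp])
  have act_sum_E: "act \<tau> (\<Sum>i\<in>S. E i) = (\<Sum>i\<in>S. E i)" if "S \<subseteq> I" for S
  proof -
    have "finite S" using that fin finite_subset by blast
    then show ?thesis using that
      by (induction S rule: finite_induct) (simp_all add: act_0[OF bij] act_add[OF bij] act_E[OF comp])
  qed
  have half: "principal (act \<tau> Q - Q)" if i: "i \<in> I" and Q: "Div0 Q" "k \<noteq> 0" "Q + Q = E i + pdiv k" for i Q k
  proof -
    obtain S where S: "S \<subseteq> I" "even (card S)" "principal (act \<tau> Q - Q - (\<Sum>j\<in>S. E j))"
      "\<And>j r. j \<in> I - {i} \<Longrightarrow> r ^ 2 = b j - b i \<Longrightarrow> \<sigma> r = r \<Longrightarrow> j \<notin> S"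
      using kummer[OF comp i Q] by blast
    have "j \<notin> S" if j: "j \<in> I - {i}" for j
    proof -
      obtain r where r: "r ^ 2 = b j - b i" using nonzero_sqrt by blast
      then have "\<sigma> r = r" using sq i j by auto
      then show ?thesis using S(4)[OF j r] by simp
    qed
    \<comment> \<open>The Kummer map gives no information at \<open>i\<close> itself; the even size
      of \<open>S\<close> decides it.\<close>
    then have "S \<subseteq> {i}" using S(1) by auto
    then have "S = {}" using S(2) by (metis card.empty card_1_singleton_iff odd_one subset_singletonD One_nat_def)
    then show ?thesis using S(3) by simp
  qed
  have "principal ((D + D) + (D + D))" "Div0 (D + D)" using D by (auto simp: four_torsion_def Div0_add)
  then obtain S where S: "S \<subseteq> I" "principal (D + D - (\<Sum>i\<in>S. E i))" using two_torsion by blast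
  have finS: "finite S" using S(1) fin finite_subset by blast
  have "\<forall>i\<in>S. \<exists>Qk. Div0 (fst Qk) \<and> snd Qk \<noteq> 0 \<and> fst Qk + fst Qk = E i + pdiv (snd Qk)"
    using ex_half S(1) by (simp add: split_paired_Ex) blast
  then obtain q where q: "\<And>i. i \<in> S \<Longrightarrow> Div0 (fst (q i)) \<and> snd (q i) \<noteq> 0 \<and>
      fst (q i) + fst (q i) = E i + pdiv (snd (q i))" by (metis bchoice)
  define Q where "Q = (\<Sum>i\<in>S. fst (q i))"
  have "Q + Q = (\<Sum>i\<in>S. E i) + (\<Sum>i\<in>S. pdiv (snd (q i)))"
    unfolding Q_def sum.distrib[symmetric] using q by (intro sum.cong) auto
  then have eq: "(D - Q) + (D - Q) = (D + D - (\<Sum>i\<in>S. E i)) - (\<Sum>i\<in>S. pdiv (snd (q i)))"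
    by (simp add: algebra_simps)
  have "principal (\<Sum>i\<in>S. pdiv (snd (q i)))" using q by (intro principal_sum principal_pdiv) auto
  with S(2) have "principal ((D - Q) + (D - Q))" unfolding eq by (rule principal_diff)
  moreover have "Div0 (D - Q)" using D q unfolding Q_def four_torsion_def by (intro Div0_diff Div0_sum) auto
  ultimately obtain T where T: "T \<subseteq> I" "principal (D - Q - (\<Sum>i\<in>T. E i))" using two_torsion by blast
  define R where "R = D - Q - (\<Sum>i\<in>T. E i)"
  have actQ: "act \<tau> Q - Q = (\<Sum>i\<in>S. act \<tau> (fst (q i)) - fst (q i))"
    unfolding Q_def using finS
    by (induction S rule: finite_induct) (simp_all add: act_0[OF bij] act_add[OF bij])
  have "principal (act \<tau> Q - Q)" unfolding actQ using q half S(1) by (intro principal_sum) blast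
  moreover have pR: "principal R" unfolding R_def by (rule T(2))
  have "principal (act \<tau> R - R)" by (rule principal_diff[OF principal_act[OF semi[OF comp] pR] pR])
  moreover have "act \<tau> D - D = (act \<tau> Q - Q) + (act \<tau> R - R)"
  proof -
    have "D = Q + R + (\<Sum>i\<in>T. E i)" by (simp add: R_def)
    then show ?thesis by (simp add: act_add[OF bij] act_sum_E[OF T(1)])
  qed
  ultimately show ?thesis using principal_add by simp
qed

text \<open>For a half \<open>Q\<close> of \<open>E i\<close>, trivial action makes the sum of the
  \<open>E j\<close> over \<open>S\<close> principal. Its coefficient at infinity is even, so by
  \<open>parity\<close> no \<open>j\<close> lies in \<open>S\<close>.\<close>

lemma act_four_torsion_trivialD:
  assumes "\<And>D. four_torsion D \<Longrightarrow> principal (act \<tau> D - D)"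
    and ij: "i \<in> I" "j \<in> I" "i \<noteq> j" and r: "r ^ 2 = b j - b i"
  shows "\<sigma> r = r"
proof -
  obtain Q k where Q: "Div0 Q" "k \<noteq> 0" "Q + Q = E i + pdiv k" using ex_half[OF ij(1)] by blast
  obtain S where S: "S \<subseteq> I" "even (card S)" "principal (act \<tau> Q - Q - (\<Sum>j\<in>S. E j))"
    "\<And>j r. j \<in> I - {i} \<Longrightarrow> r ^ 2 = b j - b i \<Longrightarrow> \<sigma> r = - r \<Longrightarrow> j \<in> S"
    using kummer[OF comp ij(1) Q] by blast
  have "principal (act \<tau> Q - Q)" using assms(1) half_four_torsion[OF ij(1) Q] by blast
  from principal_diff[OF this S(3)] have "principal (\<Sum>j\<in>S. E j)" by simp
  then have "even (Poly_Mapping.lookup (\<Sum>j\<in>S. E j) (e j)) \<longleftrightarrow> even (Poly_Mapping.lookup (\<Sum>j\<in>S. E j) pinf)"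
    using keys_sum_E[OF S(1)] e_W[OF ij(2)] pinf_W by (intro parity)
  then have "j \<notin> S" using lookup_sum_E[OF S(1)] ij(2) S(2) by (auto split: if_splits)
  then have "\<sigma> r \<noteq> - r" using S(4)[of j r] ij r by auto
  then show ?thesis using sigma_sqrt[OF ij(1,2) r] by blast
qed

text \<open>Now \<open>2 * Q\<close> plus the sum over \<open>S\<close> is principal, hence so is
  \<open>E i\<close> plus that sum. Its coefficient at infinity, \<open>- 1 - card S\<close>, is
  odd, so by \<open>parity\<close> every \<open>j\<close> other than \<open>i\<close> lies in
  \<open>S\<close>.\<close>

lemma act_four_torsion_negD:
  assumes "\<And>D. four_torsion D \<Longrightarrow> principal (act \<tau> D + D)"
    and ij: "i \<in> I" "j \<in> I" "i \<noteq> j" and r: "r ^ 2 = b j - b i"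
  shows "\<sigma> r = - r"
proof -
  obtain Q k where Q: "Div0 Q" "k \<noteq> 0" "Q + Q = E i + pdiv k" using ex_half[OF ij(1)] by blast
  obtain S where S: "S \<subseteq> I" "even (card S)" "principal (act \<tau> Q - Q - (\<Sum>j\<in>S. E j))"
    "\<And>j r. j \<in> I - {i} \<Longrightarrow> r ^ 2 = b j - b i \<Longrightarrow> \<sigma> r = r \<Longrightarrow> j \<notin> S"
    using kummer[OF comp ij(1) Q] by blast
  let ?D = "E i + (\<Sum>j\<in>S. E j)"
  have "principal (act \<tau> Q + Q)" using assms(1) half_four_torsion[OF ij(1) Q] by blast
  from principal_diff[OF this S(3)] have "principal ((Q + Q) + (\<Sum>j\<in>S. E j))" by (simp add: algebra_simps)
  from principal_diff[OF this principal_pdiv[OF Q(2)]] have "principal ?D" unfolding Q(3) by (simp add: algebra_simps)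
  moreover have "Poly_Mapping.keys ?D \<subseteq> W"
    using keys_add[of "E i" "\<Sum>j\<in>S. E j"] keys_sum_E[OF S(1)] lookup_E(3)[OF ij(1)] by (auto simp: in_keys_iff)
  ultimately have "even (Poly_Mapping.lookup ?D (e j)) \<longleftrightarrow> even (Poly_Mapping.lookup ?D pinf)"
    using e_W[OF ij(2)] pinf_W by (intro parity)
  then have "j \<in> S" using lookup_sum_E[OF S(1)] lookup_E[OF ij(1)] ij S(2) by (auto simp: lookup_add split: if_splits)
  then have "\<sigma> r \<noteq> r" using S(4)[of j r] ij r by auto
  then show ?thesis using sigma_sqrt[OF ij(1,2) r] by blast
qed

end

lemma bar_minus_one: "Div0 D \<Longrightarrow> principal (act bar D + D)"
  using norm_divisor0[of D] by (auto simp: principal_pdiv add.commute)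

end

section \<open>The Jacobian\<close>

context odd_model
begin

lemma carrier_div0 [simp]: "carrier (div0_group emb) = {D. Div0 D}"
  and mult_div0 [simp]: "monoid.mult (div0_group emb) = (+)"
  and one_div0 [simp]: "one (div0_group emb) = 0"
  by (auto simp: div0_group_def Div0_def)

lemma comm_group_div0: "comm_group (div0_group emb)"
proof (rule comm_groupI)
  fix D assume "D \<in> carrier (div0_group emb)"
  then show "\<exists>E\<in>carrier (div0_group emb). E \<otimes>\<^bsub>div0_group emb\<^esub> D = \<one>\<^bsub>div0_group emb\<^esub>"
    using Div0_uminus[of D] by (intro bexI[of _ "- D"]) auto
qed (auto simp: Div0_add Div0_0 algebra_simps)

lemma principal_divisors_eq: "principal_divisors emb = {D. principal D}"
proof (intro Set.equalityI Set.subsetI)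
  fix D assume "D \<in> principal_divisors emb"
  then obtain h where h: "h \<noteq> 0" "Div0 D" "\<And>v. v \<in> P \<Longrightarrow> Poly_Mapping.lookup D v = v h"
    by (auto simp: principal_divisors_def)
  have "D = pdiv h"
    using h by (intro poly_mapping_eqI) (auto simp: lookup_pdiv Div0_def in_keys_iff)
  then show "D \<in> {D. principal D}" using h(1) by (simp add: principal_pdiv)
next
  fix D assume "D \<in> {D. principal D}"
  then obtain h where "h \<noteq> 0" "D = pdiv h" by (auto simp: principal_def)
  then show "D \<in> principal_divisors emb"
    using principal_Div0[OF principal_pdiv[of h]] by (auto simp: principal_divisors_def lookup_pdiv)
qed

interpretation G: comm_group "div0_group emb" by (rule comm_group_div0)

lemma inv_div0: "Div0 D \<Longrightarrow> inv\<^bsub>div0_group emb\<^esub> D = - D"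
  by (rule G.inv_equality) (auto simp: Div0_uminus)

lemma normal_principal: "principal_divisors emb \<lhd> div0_group emb"
proof -
  have "subgroup (principal_divisors emb) (div0_group emb)"
    unfolding principal_divisors_eq using principal_Div0 principal_add principal_0 inv_div0 principal_uminus
    by unfold_locales auto
  then show ?thesis by (rule G.subgroup_imp_normal)
qed

interpretation N: normal "principal_divisors emb" "div0_group emb" by (rule normal_principal)

lemma div_class_eq:
  assumes "Div0 D" "Div0 D'"
  shows "div_class emb D = div_class emb D' \<longleftrightarrow> principal (D - D')"
proof
  assume "div_class emb D = div_class emb D'"
  then have "D \<in> principal_divisors emb #>\<^bsub>div0_group emb\<^esub> D'"
    using G.rcos_self[OF _ N.subgroup_axioms, of D] assms by (simp add: div_class_def)
  then show "principal (D - D')"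
    by (auto simp: r_coset_def principal_divisors_eq)
next
  assume "principal (D - D')"
  then have "D \<in> principal_divisors emb #>\<^bsub>div0_group emb\<^esub> D'"
    by (auto simp: r_coset_def principal_divisors_eq intro!: exI[of _ "D - D'"])
  then show "div_class emb D = div_class emb D'"
    unfolding div_class_def using G.repr_independence[OF _ _ N.subgroup_axioms] assms by simp
qed

lemma carrier_jacobian: "carrier (jacobian emb) = div_class emb ` {D. Div0 D}"
  by (simp add: jacobian_def carrier_FactGroup div_class_def image_def)

lemma one_jacobian: "\<one>\<^bsub>jacobian emb\<^esub> = div_class emb 0"
  unfolding jacobian_def div_class_def using G.coset_mult_one[OF N.subset] by simp

lemma inv_jacobian: "Div0 D \<Longrightarrow> inv\<^bsub>jacobian emb\<^esub> div_class emb D = div_class emb (- D)"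
  unfolding jacobian_def div_class_def using N.inv_FactGroup N.rcos_inv inv_div0 carrier_jacobian
  by (simp add: jacobian_def div_class_def)

lemma pow_jacobian:
  "Div0 D \<Longrightarrow> div_class emb D [^]\<^bsub>jacobian emb\<^esub> (n::nat) = div_class emb (D [^]\<^bsub>div0_group emb\<^esub> n)"
  unfolding jacobian_def div_class_def using N.FactGroup_pow[of D n] by simp

lemma torsion_4: "torsion emb 4 = div_class emb ` {D. four_torsion D}"
proof -
  have "D [^]\<^bsub>div0_group emb\<^esub> (4::nat) = D + D + (D + D)" for D
    by (simp add: numeral_eq_Suc algebra_simps)
  then have "div_class emb D \<in> torsion emb 4 \<longleftrightarrow> principal (D + D + (D + D))" if "Div0 D" for D
    using that pow_jacobian[OF that, of 4] div_class_eq[of "D + D + (D + D)" 0]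
    by (auto simp: torsion_def carrier_jacobian one_jacobian Div0_add Div0_0)
  moreover have "torsion emb 4 \<subseteq> div_class emb ` {D. Div0 D}"
    using carrier_jacobian by (auto simp: torsion_def)
  ultimately show ?thesis by (auto simp: four_torsion_def)
qed

lemma torsion_2: "torsion emb 2 = div_class emb ` {D. Div0 D \<and> principal (D + D)}"
proof -
  have "D [^]\<^bsub>div0_group emb\<^esub> (2::nat) = D + D" for D
    by (simp add: numeral_eq_Suc algebra_simps)
  then have "div_class emb D \<in> torsion emb 2 \<longleftrightarrow> principal (D + D)" if "Div0 D" for D
    using that pow_jacobian[OF that, of 2] div_class_eq[of "D + D" 0]
    by (auto simp: torsion_def carrier_jacobian one_jacobian Div0_add Div0_0)
  moreover have "torsion emb 2 \<subseteq> div_class emb ` {D. Div0 D}"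
    using carrier_jacobian by (auto simp: torsion_def)
  ultimately show ?thesis by auto
qed

lemma torsion_2_subset_4: "torsion emb 2 \<subseteq> torsion emb 4"
  unfolding torsion_2 torsion_4 by (auto simp: four_torsion_def principal_add)

text \<open>A class is a coset, and \<open>act\<close> maps principal divisors onto principal
  divisors because the automorphism is bijective. \<open>x0\<close>, \<open>y0\<close> are the
  coordinates defining the Galois action; they may differ from those of the model.\<close>

lemma galois_act_class:
  assumes "semiaut emb \<sigma> (extend_aut emb x0 y0 \<sigma>)" "Div0 D"
  shows "galois_act emb x0 y0 \<sigma> (div_class emb D) = div_class emb (act (extend_aut emb x0 y0 \<sigma>) D)"
proof -
  define \<tau> where "\<tau> = extend_aut emb x0 y0 \<sigma>"
  have s: "semiaut emb \<sigma> \<tau>" using assms by (simp add: \<tau>_def)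
  then have bij: "bij \<tau>" by (simp add: semiaut_def)
  interpret t: fld_hom \<tau> using s by unfold_locales (simp add: semiaut_def)
  have dc: "div_class emb D = {M + D | M. principal M}" for D
    by (auto simp: div_class_def r_coset_def principal_divisors_eq)
  have sur: "\<exists>M'. principal M' \<and> act \<tau> M' = M" if M: "principal M" for M
  proof -
    obtain h where h: "h \<noteq> 0" "M = pdiv h" using M by (auto simp: principal_def)
    obtain k where k: "\<tau> k = h" using bij by (metis bij_pointE)
    then have "k \<noteq> 0" using h by auto
    then show ?thesis using act_pdiv[OF s, of k] k h principal_pdiv by blast
  qed
  have "galois_act emb x0 y0 \<sigma> (div_class emb D) = act \<tau> ` {M + D | M. principal M}"
    unfolding galois_act_def dc \<tau>_def act_def ..
  also have "\<dots> = {M + act \<tau> D | M. principal M}"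
  proof (intro Set.equalityI Set.subsetI)
    fix X assume "X \<in> act \<tau> ` {M + D | M. principal M}"
    then obtain M where "principal M" "X = act \<tau> M + act \<tau> D" by (auto simp: act_add[OF bij])
    then show "X \<in> {M + act \<tau> D | M. principal M}" using principal_act[OF s] by blast
  next
    fix X assume "X \<in> {M + act \<tau> D | M. principal M}"
    then obtain M where M: "principal M" "X = M + act \<tau> D" by auto
    then obtain M' where M': "principal M'" "act \<tau> M' = M" using sur by blast
    then have "X = act \<tau> (M' + D)" using M(2) by (simp add: act_add[OF bij])
    then show "X \<in> act \<tau> ` {M + D | M. principal M}" using M'(1) by blast
  qed
  also have "\<dots> = div_class emb (act \<tau> D)" unfolding dc ..
  finally show ?thesis unfolding \<tau>_def .
qed

context
  fixes \<sigma> x0 y0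
  assumes s0: "semiaut emb \<sigma> (extend_aut emb x0 y0 \<sigma>)"
begin

abbreviation "\<tau>0 \<equiv> extend_aut emb x0 y0 \<sigma>"

lemma galois_act_trivial_iff:
  "Div0 D \<Longrightarrow> galois_act emb x0 y0 \<sigma> (div_class emb D) = div_class emb D \<longleftrightarrow> principal (act \<tau>0 D - D)"
  using galois_act_class[OF s0] div_class_eq Div0_act[OF s0] by simp

lemma galois_act_neg_iff:
  "Div0 D \<Longrightarrow> galois_act emb x0 y0 \<sigma> (div_class emb D) = inv\<^bsub>jacobian emb\<^esub> (div_class emb D)
    \<longleftrightarrow> principal (act \<tau>0 D + D)"
  using galois_act_class[OF s0] div_class_eq[of "act \<tau>0 D" "- D"] Div0_act[OF s0] inv_jacobian Div0_uminus by simp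

lemma galois_act_carrier:
  "C \<in> carrier (jacobian emb) \<Longrightarrow> galois_act emb x0 y0 \<sigma> C \<in> carrier (jacobian emb)"
  using galois_act_class[OF s0] Div0_act[OF s0] by (auto simp: carrier_jacobian)

text \<open>\<open>same\<close> bridges the automorphism \<open>\<tau>0\<close> that defines the
  Galois action and the \<open>\<tau>\<close> that fixes the coordinates of the model: they need to
  agree only on divisor classes.\<close>

lemma galois_act_torsion_4:
  assumes comp: "compatible \<sigma> \<tau>" and same: "\<And>D. Div0 D \<Longrightarrow> principal (act \<tau>0 D - act \<tau> D)"
  shows "(\<forall>C\<in>torsion emb 4. galois_act emb x0 y0 \<sigma> C = C) \<longleftrightarrow>
      (\<forall>i\<in>I. \<forall>j\<in>I. \<forall>r. i \<noteq> j \<longrightarrow> r ^ 2 = b j - b i \<longrightarrow> \<sigma> r = r)"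
    and "(\<forall>C\<in>torsion emb 4. galois_act emb x0 y0 \<sigma> C = inv\<^bsub>jacobian emb\<^esub> C) \<Longrightarrow>
      (\<forall>i\<in>I. \<forall>j\<in>I. \<forall>r. i \<noteq> j \<longrightarrow> r ^ 2 = b j - b i \<longrightarrow> \<sigma> r = - r)"
proof -
  have D0: "Div0 D" if "four_torsion D" for D using that by (simp add: four_torsion_def)
  have triv: "principal (act \<tau>0 D - D) \<longleftrightarrow> principal (act \<tau> D - D)" if "Div0 D" for D
    using principal_diff[OF _ same[OF that], of "act \<tau>0 D - D"]
      principal_add[OF _ same[OF that], of "act \<tau> D - D"] by auto
  have neg: "principal (act \<tau>0 D + D) \<longleftrightarrow> principal (act \<tau> D + D)" if "Div0 D" for D
    using principal_diff[OF _ same[OF that], of "act \<tau>0 D + D"]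
      principal_add[OF _ same[OF that], of "act \<tau> D + D"] by (auto simp: algebra_simps)
  have "(\<forall>C\<in>torsion emb 4. galois_act emb x0 y0 \<sigma> C = C) \<longleftrightarrow>
      (\<forall>D. four_torsion D \<longrightarrow> principal (act \<tau> D - D))"
    unfolding torsion_4 using galois_act_trivial_iff triv D0 by auto
  also have "\<dots> \<longleftrightarrow> (\<forall>i\<in>I. \<forall>j\<in>I. \<forall>r. i \<noteq> j \<longrightarrow> r ^ 2 = b j - b i \<longrightarrow> \<sigma> r = r)"
    using act_four_torsion_trivial[OF comp] act_four_torsion_trivialD[OF comp] by blast
  finally show "(\<forall>C\<in>torsion emb 4. galois_act emb x0 y0 \<sigma> C = C) \<longleftrightarrow>
      (\<forall>i\<in>I. \<forall>j\<in>I. \<forall>r. i \<noteq> j \<longrightarrow> r ^ 2 = b j - b i \<longrightarrow> \<sigma> r = r)" .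
  assume "\<forall>C\<in>torsion emb 4. galois_act emb x0 y0 \<sigma> C = inv\<^bsub>jacobian emb\<^esub> C"
  then have "principal (act \<tau> D + D)" if "four_torsion D" for D
    unfolding torsion_4 using galois_act_neg_iff neg D0 that by auto
  then show "\<forall>i\<in>I. \<forall>j\<in>I. \<forall>r. i \<noteq> j \<longrightarrow> r ^ 2 = b j - b i \<longrightarrow> \<sigma> r = - r"
    using act_four_torsion_negD[OF comp] by blast
qed

end

end

section \<open>Changes of coordinates\<close>

context
  fixes F :: "'a::field set" assumes F: "is_subfield F"
begin

lemma sf_diff: "a \<in> F \<Longrightarrow> c \<in> F \<Longrightarrow> a - c \<in> F" and sf_mult: "a \<in> F \<Longrightarrow> c \<in> F \<Longrightarrow> a * c \<in> F"
  and sf_inverse: "a \<in> F \<Longrightarrow> inverse a \<in> F" and sf_0: "0 \<in> F" and sf_1: "1 \<in> F"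
  using F by (auto simp: is_subfield_def)

lemma sf_add: "a \<in> F \<Longrightarrow> c \<in> F \<Longrightarrow> a + c \<in> F"
  using sf_diff[of a "0 - c"] sf_diff[of 0 c] sf_0 by simp

lemma sf_uminus: "a \<in> F \<Longrightarrow> - a \<in> F"
  using sf_diff[of 0 a] sf_0 by simp

lemma sf_divide: "a \<in> F \<Longrightarrow> c \<in> F \<Longrightarrow> a / c \<in> F"
  unfolding divide_inverse by (intro sf_mult sf_inverse)

lemma sf_power: "a \<in> F \<Longrightarrow> a ^ n \<in> F"
  by (induction n) (auto intro: sf_1 sf_mult)

end

lemma cff_x_not_const:
  assumes "curve_function_field f emb x y"
  shows "x \<notin> range emb"
proof
  interpret e: fld_hom emb using assms by unfold_locales (simp add: curve_function_field_def)
  assume "x \<in> range emb"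
  then obtain c where "x = emb c" by auto
  then have "poly (map_poly emb [:- c, 1:]) x = 0" by simp
  then have "[:- c, 1:] = 0" using assms unfolding curve_function_field_def by blast
  then show False by simp
qed

lemma cff_change:
  fixes emb :: "'a::alg_closed_field \<Rightarrow> 'f::field"
  assumes cff: "curve_function_field f emb x y" and x': "x' \<notin> range emb"
    and y': "y' ^ 2 = poly (map_poly emb f') x'"
    and gen: "x \<in> field_gen (range emb \<union> {x', y'})" "y \<in> field_gen (range emb \<union> {x', y'})"
  shows "curve_function_field f' emb x' y'"
proof -
  have hom: "field_hom emb" using cff by (simp add: curve_function_field_def)
  let ?G = "field_gen (range emb \<union> {x', y'})"
  have "range emb \<subseteq> ?G" using field_gen_subset[of "range emb \<union> {x', y'}"] by blast
  then have "range emb \<union> {x, y} \<subseteq> ?G" using gen by blast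
  then have "field_gen (range emb \<union> {x, y}) \<subseteq> ?G" by (rule field_gen_minimal[OF _ is_subfield_field_gen])
  moreover have "field_gen (range emb \<union> {x, y}) = UNIV" using cff unfolding curve_function_field_def by blast
  ultimately have "?G = UNIV" by blast
  moreover have "p = 0" if "poly (map_poly emb p) x' = 0" for p
    by (rule field_hom_transcendental[OF hom x' that])
  ultimately show ?thesis using hom y' unfolding curve_function_field_def by blast
qed

text \<open>The constant \<open>s\<close> absorbs a sign so that the new equation is monic. The
  translation \<open>c\<close> is free; it is used to place a chosen branch point at 0.\<close>

locale even_model =
  fixes I :: "'i set" and j0 :: 'i and \<alpha> :: "'i \<Rightarrow> 'a::alg_closed_field" and emb :: "'a \<Rightarrow> 'f::field"
    and x y :: 'f and s c :: 'a and m :: nat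
  assumes cff: "curve_function_field (\<Prod>i\<in>insert j0 I. [:- \<alpha> i, 1:]) emb x y"
    and fin: "finite I" and card: "card I = 2 * m + 1" and j0: "j0 \<notin> I"
    and inj: "inj_on \<alpha> (insert j0 I)" and two: "(2::'a) \<noteq> 0" and s: "s ^ 2 = - 1"
begin

text \<open>The change of coordinates moving the Weierstrass point \<open>\<alpha> j0\<close> to infinity.\<close>

definition "prod0 = (\<Prod>l\<in>I. \<alpha> j0 - \<alpha> l)"
definition "x' = - emb prod0 / (x - emb (\<alpha> j0)) - emb c"
definition "y' = emb (s * prod0 ^ m) * y / (x - emb (\<alpha> j0)) ^ (m + 1)"
definition "\<beta> i = prod0 / (\<alpha> j0 - \<alpha> i) - c"

sublocale emb: fld_hom emb
  using cff by unfold_locales (simp add: curve_function_field_def)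

lemma prod0_nz: "prod0 \<noteq> 0"
  using fin inj j0 by (auto simp: prod0_def inj_on_def)

lemma s_nz: "s \<noteq> 0"
  using s by auto

lemma X_nz: "x - emb a \<noteq> 0"
  using cff_x_not_const[OF cff] by auto

lemma x_eq: "x = emb (\<alpha> j0) - emb prod0 / (x' + emb c)"
  using X_nz[of "\<alpha> j0"] prod0_nz by (simp add: x'_def)

lemma \<alpha>_neq: "i \<in> I \<Longrightarrow> \<alpha> j0 - \<alpha> i \<noteq> 0"
  using inj j0 by (auto simp: inj_on_def)

lemma odd: "odd_model I \<beta> emb x' y'"
proof
  let ?X = "x - emb (\<alpha> j0)"
  have x'_nc: "x' \<notin> range emb"
  proof
    assume "x' \<in> range emb"
    then obtain a where "x' = emb a" by auto
    then have "x = emb (\<alpha> j0 - prod0 / (a + c))" using x_eq by simp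
    then show False using cff_x_not_const[OF cff] by blast
  qed
  have y2: "y ^ 2 = ?X * (\<Prod>i\<in>I. x - emb (\<alpha> i))"
  proof -
    have "map_poly emb (\<Prod>i\<in>insert j0 I. [:- \<alpha> i, 1:]) = (\<Prod>i\<in>insert j0 I. [:- emb (\<alpha> i), 1:])"
      by simp
    then show ?thesis using cff fin j0 unfolding curve_function_field_def
      by (simp add: poly_prod left_diff_distrib)
  qed
  have x'b: "x' - emb (\<beta> i) = - emb prod0 * (x - emb (\<alpha> i)) / (?X * emb (\<alpha> j0 - \<alpha> i))" if "i \<in> I" for i
  proof -
    have "emb (\<alpha> j0 - \<alpha> i) \<noteq> 0" using \<alpha>_neq[OF that] by (simp del: emb.diff)
    moreover have "x - emb (\<alpha> i) = ?X + emb (\<alpha> j0 - \<alpha> i)" by simp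
    moreover have "x' - emb (\<beta> i) = - emb prod0 / ?X - emb prod0 / emb (\<alpha> j0 - \<alpha> i)"
      by (simp add: x'_def \<beta>_def)
    moreover have "- p / X - p / a = - p * (X + a) / (X * a)" if "X \<noteq> 0" "a \<noteq> 0" for p X a :: 'f
      using that by (simp add: field_simps)
    ultimately show ?thesis using X_nz[of "\<alpha> j0"] by (simp only:)
  qed
  have "(\<Prod>i\<in>I. x' - emb (\<beta> i)) = (\<Prod>i\<in>I. - emb prod0 * (x - emb (\<alpha> i)) / (?X * emb (\<alpha> j0 - \<alpha> i)))"
    using x'b by (intro prod.cong) auto
  \<comment> \<open>The denominators \<open>\<alpha> j0 - \<alpha> i\<close> multiply to
    \<open>prod0\<close>, which leaves an even power of it, while \<open>card I\<close> minus signs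
    leave one sign.\<close>
  also have "\<dots> = (- emb prod0) ^ card I * (\<Prod>i\<in>I. x - emb (\<alpha> i)) / (?X ^ card I * emb prod0)"
    unfolding prod_dividef prod.distrib prod_constant prod0_def emb.prod ..
  also have "\<dots> = - (emb prod0 ^ (2 * m)) * (\<Prod>i\<in>I. x - emb (\<alpha> i)) / ?X ^ (2 * m + 1)"
    unfolding card using prod0_nz by (simp add: power_add)
  also have "\<dots> = - (emb prod0 ^ (2 * m)) * y ^ 2 / (?X ^ (m + 1)) ^ 2"
  proof -
    have t: "(?X ^ (m + 1)) ^ 2 = ?X ^ (2 * m + 1) * ?X"
    proof -
      have "(m + 1) * 2 = Suc (2 * m + 1)" by simp
      then show ?thesis by (metis power_mult power_Suc2)
    qed
    have "a * (X * p) / (u * X) = a * p / u" if "X \<noteq> 0" for a p u X :: 'f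
      using that by simp
    from this[OF X_nz, symmetric] show ?thesis unfolding y2 t .
  qed
  also have "\<dots> = y' ^ 2"
  proof -
    have "y' ^ 2 = emb (s ^ 2) * emb prod0 ^ (2 * m) * y ^ 2 / (?X ^ (m + 1)) ^ 2"
      unfolding y'_def power_divide power_mult_distrib by (simp add: power_mult_distrib power_mult[symmetric] mult.commute[of m 2])
    then show ?thesis unfolding s by simp
  qed
  finally have y'2: "y' ^ 2 = poly (map_poly emb (\<Prod>i\<in>I. [:- \<beta> i, 1:])) x'"
    by (simp add: poly_prod)
  let ?G = "field_gen (range emb \<union> {x', y'})"
  note sf = is_subfield_field_gen[of "range emb \<union> {x', y'}"]
  have G: "emb a \<in> ?G" "x' \<in> ?G" "y' \<in> ?G" for a using field_gen_subset[of "range emb \<union> {x', y'}"] by auto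
  have xG: "x \<in> ?G" by (subst x_eq) (intro sf_diff sf_divide sf_add G sf)
  have y_eq: "y = y' * ?X ^ (m + 1) / emb (s * prod0 ^ m)"
    using X_nz[of "\<alpha> j0"] prod0_nz s_nz by (simp add: y'_def)
  have "y' * ?X ^ (m + 1) / emb (s * prod0 ^ m) \<in> ?G"
    by (intro sf_divide sf_mult sf_power sf_diff G xG sf)
  then have yG: "y \<in> ?G" unfolding y_eq[symmetric] .
  show "curve_function_field (\<Prod>i\<in>I. [:- \<beta> i, 1:]) emb x' y'"
    by (rule cff_change[OF cff x'_nc y'2 xG yG])
  show "inj_on \<beta> I"
  proof (rule inj_onI)
    fix i j assume ij: "i \<in> I" "j \<in> I" "\<beta> i = \<beta> j"
    then have "\<alpha> j0 - \<alpha> i = \<alpha> j0 - \<alpha> j" using prod0_nz \<alpha>_neq by (simp add: \<beta>_def field_simps)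
    then show "i = j" using inj ij j0 by (auto simp: inj_on_def)
  qed
  show "finite I" "odd (card I)" "(2::'a) \<noteq> 0" using fin card two by auto
qed

text \<open>This is the reason for the factor \<open>prod0\<close> in the new abscissa: the
  difference of \<open>prod0 / (\<alpha> j0 - \<alpha> j)\<close> and
  \<open>prod0 / (\<alpha> j0 - \<alpha> i)\<close> is a polynomial, the \<open>\<gamma>\<close> of
  the even case.\<close>

lemma beta_diff: "i \<in> I \<Longrightarrow> j \<in> I \<Longrightarrow> i \<noteq> j \<Longrightarrow> \<beta> j - \<beta> i = (\<alpha> j - \<alpha> i) * (\<Prod>l\<in>I - {i, j}. \<alpha> j0 - \<alpha> l)"
proof -
  assume ij: "i \<in> I" "j \<in> I" "i \<noteq> j"
  have "prod0 = (\<alpha> j0 - \<alpha> i) * ((\<alpha> j0 - \<alpha> j) * (\<Prod>l\<in>I - {i, j}. \<alpha> j0 - \<alpha> l))"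
  proof -
    have "prod0 = (\<alpha> j0 - \<alpha> i) * (\<Prod>l\<in>I - {i}. \<alpha> j0 - \<alpha> l)"
      unfolding prod0_def by (rule prod.remove[OF fin ij(1)])
    also have "(\<Prod>l\<in>I - {i}. \<alpha> j0 - \<alpha> l) = (\<alpha> j0 - \<alpha> j) * (\<Prod>l\<in>I - {i} - {j}. \<alpha> j0 - \<alpha> l)"
      using fin ij by (intro prod.remove) auto
    also have "I - {i} - {j} = I - {i, j}" by auto
    finally show ?thesis .
  qed
  then have "prod0 / (\<alpha> j0 - \<alpha> j) = (\<alpha> j0 - \<alpha> i) * (\<Prod>l\<in>I - {i, j}. \<alpha> j0 - \<alpha> l)"
    "prod0 / (\<alpha> j0 - \<alpha> i) = (\<alpha> j0 - \<alpha> j) * (\<Prod>l\<in>I - {i, j}. \<alpha> j0 - \<alpha> l)"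
    using \<alpha>_neq[OF ij(1)] \<alpha>_neq[OF ij(2)] by simp_all
  then show ?thesis unfolding \<beta>_def by (simp add: algebra_simps)
qed

end

text \<open>The translation by \<open>(0, 0)\<close> is a product of two involutions with rational quotient, and each of them
  acts as \<open>-1\<close>.\<close>

lemma translation_acts_trivially:
  fixes emb :: "'a::alg_closed_field \<Rightarrow> 'f::field" and b :: "'i \<Rightarrow> 'a"
  assumes O: "odd_model {i0, k, l} b emb x y" and ne: "i0 \<noteq> k" "i0 \<noteq> l" "k \<noteq> l" and b0: "b i0 = 0"
    and T: "semiaut emb id T" "T x = emb (b k * b l) / x" "T y = - (emb (b k * b l) * y / x ^ 2)"
    and D: "func_field.Div0 emb D"
  shows "func_field.principal emb (act T D - D)"
proof -
  interpret O: odd_model "{i0, k, l}" b emb x y by fact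
  note One_nat_def [simp del]
  have bk: "b k \<noteq> 0" and bl: "b l \<noteq> 0" and bkl: "b k \<noteq> b l"
    using O.inj_b ne b0 by (auto simp: inj_on_def)
  have x0: "x \<noteq> 0" using O.x_b_nz[of 0] by simp
  have y2: "y ^ 2 = x * ((x - emb (b k)) * (x - emb (b l)))"
    using O.y_square O.ev_f ne b0 by simp
  define S where "S = b k + b l"
  define B where "B = b k * b l"
  have B0: "B \<noteq> 0" using bk bl by (simp add: B_def)
  \<comment> \<open>\<open>z\<close> is fixed and \<open>w = x - B / x\<close> is negated by the
    involution sending \<open>x\<close> to \<open>B / x\<close> and \<open>y\<close> to
    \<open>B * y / x^2\<close>. They are coordinates of the same curve, with a quartic on the right
    hand side.\<close>
  define z where "z = y / x"
  define w where "w = 2 * x - (emb S + z ^ 2)"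
  have z2: "z ^ 2 * x = x ^ 2 - emb S * x + emb B"
  proof -
    have "z ^ 2 * x = (x - emb (b k)) * (x - emb (b l))" using x0 y2 by (simp add: z_def power_divide power2_eq_square)
    then show ?thesis by (simp add: S_def B_def algebra_simps power2_eq_square)
  qed
  have w2: "w ^ 2 = (z ^ 2 + emb S) ^ 2 - 4 * emb B"
  proof -
    have "w ^ 2 = 4 * (x ^ 2 - (z ^ 2 * x) - emb S * x) + (z ^ 2 + emb S) ^ 2"
      by (simp add: w_def power2_eq_square algebra_simps)
    also have "\<dots> = (z ^ 2 + emb S) ^ 2 - 4 * emb B" unfolding z2 by (simp add: algebra_simps)
    finally show ?thesis .
  qed
  have two: "(2::'a) \<noteq> 0" by (rule O.two)
  have four: "(4::'a) \<noteq> 0"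
  proof -
    have "(4::'a) = 2 * 2" by simp
    then show ?thesis using two by (metis mult_eq_0_iff)
  qed
  \<comment> \<open>The quartic is \<open>(z^2 + S - 2 * t) * (z^2 + S + 2 * t)\<close> with roots
    \<open>p\<close>, \<open>- p\<close>, \<open>q\<close>, \<open>- q\<close>. They are distinct
    since \<open>(p * q)^2 = (b k - b l)^2\<close> and \<open>p^2 - q^2 = 4 * t\<close>.\<close>
  obtain t where t: "t ^ 2 = B" using O.nonzero_sqrt by blast
  have t0: "t \<noteq> 0" using t B0 by auto
  obtain p where p: "p ^ 2 = 2 * t - S" using O.nonzero_sqrt by blast
  obtain q where q: "q ^ 2 = - (2 * t) - S" using O.nonzero_sqrt by blast
  have SB: "S ^ 2 - 4 * B = (b k - b l) ^ 2" by (simp add: S_def B_def power2_eq_square algebra_simps)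
  have "(p * q) ^ 2 = S ^ 2 - 4 * t ^ 2" unfolding power_mult_distrib p q by (simp add: power2_eq_square algebra_simps)
  also have "\<dots> \<noteq> 0" unfolding t SB using bkl by simp
  finally have p0: "p \<noteq> 0" and q0: "q \<noteq> 0" by auto
  have pq: "p ^ 2 \<noteq> q ^ 2"
  proof
    assume "p ^ 2 = q ^ 2"
    then have "4 * t = 0" unfolding p q by (simp add: algebra_simps)
    then show False using four t0 by simp
  qed
  have neg: "a \<noteq> - a" if "a \<noteq> 0" for a :: 'a
  proof
    assume "a = - a"
    then have "2 * a = 0" by (metis add.right_inverse mult_2)
    then show False using that two by simp
  qed
  have pq': "p \<noteq> q" "p \<noteq> - q" "- p \<noteq> q" using pq by auto
  obtain s :: 'a where s: "s ^ 2 = - 1" using O.nonzero_sqrt by blast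
  define \<alpha> :: "nat \<Rightarrow> 'a" where "\<alpha> j = (if j = 0 then p else if j = 1 then - p else if j = 2 then q else - q)" for j
  have J: "insert 0 {1, 2, 3} = {0, 1, 2, 3 :: nat}" by simp
  let ?f = "\<Prod>i\<in>insert 0 {1, 2, 3}. [:- \<alpha> i, 1:]"
  have zw: "w ^ 2 = poly (map_poly emb ?f) z"
  proof -
    have "poly (map_poly emb ?f) z = (\<Prod>i\<in>insert 0 {1, 2, 3}. z - emb (\<alpha> i))"
      unfolding O.emb.mp_prod poly_prod by (intro prod.cong) simp_all
    also have "\<dots> = (z - emb p) * ((z + emb p) * ((z - emb q) * (z + emb q)))"
      by (simp add: \<alpha>_def)
    also have "\<dots> = (z ^ 2 - emb (p ^ 2)) * (z ^ 2 - emb (q ^ 2))"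
    proof -
      have "(z - a) * (z + a) = z ^ 2 - a ^ 2" for a
        by (simp add: power2_eq_square algebra_simps)
      then show ?thesis by (simp only: mult.assoc[symmetric] O.emb.power)
    qed
    also have "\<dots> = (z ^ 2 + emb S) ^ 2 - 4 * emb (t ^ 2)"
      unfolding p q by (simp add: power2_eq_square algebra_simps)
    finally show ?thesis unfolding w2 t ..
  qed
  let ?G = "field_gen (range emb \<union> {z, w})"
  note sf = is_subfield_field_gen[of "range emb \<union> {z, w}"]
  have G: "emb a \<in> ?G" "z \<in> ?G" "w \<in> ?G" for a using field_gen_subset[of "range emb \<union> {z, w}"] by auto
  have x_eq: "x = (w + (emb S + z ^ 2)) / 2" using O.two_F by (simp add: w_def)
  have twoG: "2 \<in> ?G" using G(1)[of 2] by simp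
  have xG: "x \<in> ?G" by (subst x_eq) (intro sf_divide sf_add sf_power G sf twoG)
  have y_eq: "y = z * x" using x0 by (simp add: z_def)
  have yG: "y \<in> ?G" by (subst y_eq) (intro sf_mult G xG sf)
  have z_nc: "z \<notin> range emb"
  proof
    assume "z \<in> range emb"
    then obtain a where "y = emb a * x" using y_eq by auto
    then have "O.ev [:0, - a:] + O.ev 1 * y = 0" by simp
    from O.ev_y_eq_0[OF this] show False by simp
  qed
  have cff2: "curve_function_field ?f emb z w"
    by (rule cff_change[OF O.curve z_nc zw xG yG])
  interpret Z: even_model "{1, 2, 3 :: nat}" 0 \<alpha> emb z w s 0 1
  proof
    show "curve_function_field ?f emb z w" by fact
    show "inj_on \<alpha> (insert 0 {1, 2, 3})"
      using neg[OF p0] neg[OF q0] pq' by (auto simp: inj_on_def \<alpha>_def)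
  qed (use two s in auto)
  interpret R: odd_model "{1, 2, 3 :: nat}" Z.\<beta> emb Z.x' Z.y' by (rule Z.odd)
  \<comment> \<open>The hyperelliptic involution of the second double cover, the one given by
    \<open>z\<close>; moving a root of the quartic to infinity makes it available as
    \<open>R.bar\<close>.\<close>
  have Rz: "R.bar z = z"
    by (subst (1 2) Z.x_eq) (simp only: R.bar.diff R.bar.divide R.bar.add R.bar_emb R.bar_x)
  have w_eq: "w = Z.y' * (z - emb p) ^ 2 / emb (s * Z.prod0)"
  proof -
    have zy: "Z.y' = emb (s * Z.prod0) * w / (z - emb p) ^ 2"
      unfolding Z.y'_def by (simp only: \<alpha>_def power_one_right one_add_one simp_thms if_True)
    have nz: "(z - emb p) ^ 2 \<noteq> 0" "emb (s * Z.prod0) \<noteq> 0"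
      using Z.X_nz[of p] Z.prod0_nz Z.s_nz by (simp_all only: power_eq_0_iff O.emb.eq_0_iff mult_eq_0_iff simp_thms)
    have "a * w' / d * d / a = w'" if "d \<noteq> 0" "a \<noteq> 0" for a d w' :: 'f
      using that by simp
    from this[OF nz, of w, symmetric] show ?thesis unfolding zy[symmetric] .
  qed
  have Rw: "R.bar w = - w"
  proof -
    have "R.bar w = R.bar (Z.y' * (z - emb p) ^ 2 / emb (s * Z.prod0))" by (rule arg_cong[OF w_eq])
    also have "\<dots> = - (Z.y' * (z - emb p) ^ 2 / emb (s * Z.prod0))"
      by (simp only: R.bar.divide R.bar.mult R.bar.power R.bar.diff R.bar_y Rz R.bar_emb mult_minus_left minus_divide_left)
    also have "\<dots> = - w" unfolding w_eq[symmetric] ..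
    finally show ?thesis .
  qed
  have Rx: "R.bar x = emb B / x"
  proof -
    have "R.bar x = R.bar ((w + (emb S + z ^ 2)) / 2)" by (rule arg_cong[OF x_eq])
    also have "\<dots> = (- w + (emb S + z ^ 2)) / 2"
      by (simp only: R.bar.divide R.bar.add R.bar.power R.bar_emb Rz Rw R.bar.numeral)
    also have "\<dots> = emb S + z ^ 2 - x" using O.two_F by (simp add: w_def field_simps)
    also have "\<dots> * x = emb B" using z2 by (simp add: algebra_simps power2_eq_square)
    finally show ?thesis using x0 by (simp add: field_simps)
  qed
  have Ry: "R.bar y = emb B * y / x ^ 2"
  proof -
    have "R.bar y = R.bar (z * x)" by (rule arg_cong[OF y_eq])
    also have "\<dots> = z * (emb B / x)" by (simp only: R.bar.mult Rz Rx)
    finally show ?thesis by (simp add: z_def power2_eq_square)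
  qed
  have T_eq: "T = O.bar \<circ> R.bar"
  proof (rule field_hom_eq_on_gen[OF _ _ _ O.generated])
    show "field_hom T" using T by (simp add: semiaut_def)
    show "field_hom (O.bar \<circ> R.bar)" by (simp add: field_hom_def)
    show "T a = (O.bar \<circ> R.bar) a" if "a \<in> range emb \<union> {x, y}" for a
      using that T by (auto simp: semiaut_def Rx Ry B_def)
  qed
  have aD: "act T D = act O.bar (act R.bar D)" unfolding T_eq by (rule act_comp[OF R.bij_bar O.bij_bar])
  have D1: "O.Div0 (act R.bar D)" by (rule O.Div0_act[OF R.semiaut_bar D])
  \<comment> \<open>Each bracket is principal because the involution of any odd model acts as -1,
    and the middle terms cancel.\<close>
  have "O.principal ((act O.bar (act R.bar D) + act R.bar D) - (act R.bar D + D))"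
    using O.bar_minus_one[OF D1] R.bar_minus_one[OF D] by (rule O.principal_diff)
  then show ?thesis unfolding aD by simp
qed

section \<open>The field of definition\<close>

lemma alg_independent_inj:
  fixes h :: "'c::field \<Rightarrow> 'a::field" and \<alpha> :: "'i \<Rightarrow> 'a"
  assumes h: "field_hom h" and ind: "alg_independent h \<alpha> I"
  shows "inj_on \<alpha> I"
proof (rule inj_onI, rule ccontr)
  interpret fld_hom h by unfold_locales fact
  fix i j assume ij: "i \<in> I" "j \<in> I" "\<alpha> i = \<alpha> j" "i \<noteq> j"
  define m where "m k = Poly_Mapping.single k (1::nat)" for k :: 'i
  have keys_m: "Poly_Mapping.keys (m k) = {k}" for k by (simp add: m_def)
  have m_neq: "m i \<noteq> m j"
    using ij(4) keys_m[of i] keys_m[of j] by auto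
  define Q :: "('i, 'c) mpoly" where "Q = Poly_Mapping.single (m i) 1 - Poly_Mapping.single (m j) 1"
  have lk: "Poly_Mapping.lookup Q (m i) = 1" "Poly_Mapping.lookup Q (m j) = - 1"
    "k \<noteq> m i \<Longrightarrow> k \<noteq> m j \<Longrightarrow> Poly_Mapping.lookup Q k = 0" for k
    using m_neq by (simp_all add: Q_def lookup_minus lookup_single)
  have keys: "Poly_Mapping.keys Q = {m i, m j}"
    using lk by (auto simp: in_keys_iff)
  have "mpoly_eval h \<alpha> Q = 0"
    unfolding mpoly_eval_def keys using m_neq lk ij(3) by (simp add: keys_m) (simp add: m_def)
  moreover have "mpoly_vars Q \<subseteq> I"
    unfolding mpoly_vars_def keys using ij by (simp add: keys_m)
  ultimately have "Q = 0" using ind by (simp add: alg_independent_def)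
  then show False using lk(1) by simp
qed

text \<open>Vieta's formula, which places the coefficients of the curve in \<open>K\<close>.\<close>

lemma coeff_prod_linear:
  fixes \<alpha> :: "nat \<Rightarrow> 'a::field"
  shows "coeff (\<Prod>i=1..d. [:- \<alpha> i, 1:]) n = (if n \<le> d then (- 1) ^ (d - n) * elem_sym \<alpha> d (d - n) else 0)"
proof -
  let ?A = "{1..d}"
  have expand: "(\<Prod>i\<in>X. [:- \<alpha> i:]) * (\<Prod>i\<in>?A - X. [:0, 1:]) = monom ((- 1) ^ card X * (\<Prod>i\<in>X. \<alpha> i)) (d - card X)"
    if "X \<subseteq> ?A" for X
  proof -
    have fX: "finite X" using that finite_subset by blast
    have "(\<Prod>i\<in>X. [:- \<alpha> i:]) = [:(- 1) ^ card X * (\<Prod>i\<in>X. \<alpha> i):]"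
      using fX by (induction X rule: finite_induct) (auto simp: one_pCons)
    moreover have "(\<Prod>i\<in>?A - X. [:0, 1:]) = monom (1::'a) (d - card X)"
      using fX that by (simp add: card_Diff_subset monom_altdef)
    ultimately show ?thesis by (simp add: smult_monom)
  qed
  have "(\<Prod>i=1..d. [:- \<alpha> i, 1:]) = (\<Prod>i\<in>?A. [:- \<alpha> i:] + [:0, 1:])" by simp
  also have "\<dots> = (\<Sum>X\<in>Pow ?A. (\<Prod>i\<in>X. [:- \<alpha> i:]) * (\<Prod>i\<in>?A - X. [:0, 1:]))"
    by (rule prod_add) simp
  also have "\<dots> = (\<Sum>X\<in>Pow ?A. monom ((- 1) ^ card X * (\<Prod>i\<in>X. \<alpha> i)) (d - card X))"
    by (intro sum.cong expand) auto
  finally have c: "coeff (\<Prod>i=1..d. [:- \<alpha> i, 1:]) n =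
      (\<Sum>X\<in>Pow ?A. if d - card X = n then (- 1) ^ card X * (\<Prod>i\<in>X. \<alpha> i) else 0)"
    by (simp add: coeff_sum)
  have cX: "card X \<le> d" if "X \<subseteq> ?A" for X using card_mono[OF _ that] by simp
  show ?thesis
  proof (cases "n \<le> d")
    case False
    then show ?thesis unfolding c by (auto intro!: sum.neutral)
  next
    case True
    have "(\<Sum>X\<in>Pow ?A. if d - card X = n then (- 1) ^ card X * (\<Prod>i\<in>X. \<alpha> i) else 0)
      = (\<Sum>X | X \<subseteq> ?A \<and> card X = d - n. (- 1) ^ (d - n) * (\<Prod>i\<in>X. \<alpha> i))"
    proof (rule sum.mono_neutral_cong_right)
      have eqv: "d - card X = n \<longleftrightarrow> card X = d - n" if "X \<subseteq> ?A" for X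
        using cX[OF that] True by linarith
      show "\<forall>X\<in>Pow ?A - {X. X \<subseteq> ?A \<and> card X = d - n}.
          (if d - card X = n then (- 1) ^ card X * (\<Prod>i\<in>X. \<alpha> i) else 0) = 0"
        using eqv by auto
      show "(if d - card X = n then (- 1) ^ card X * (\<Prod>i\<in>X. \<alpha> i) else 0) = (- 1) ^ (d - n) * (\<Prod>i\<in>X. \<alpha> i)"
        if "X \<in> {X. X \<subseteq> ?A \<and> card X = d - n}" for X
        using eqv[of X] that by auto
    qed auto
    then show ?thesis unfolding c elem_sym_def using True by (simp add: sum_distrib_left)
  qed
qed

lemma field_hom_complex_char_0:
  fixes h :: "complex \<Rightarrow> 'a::field"
  assumes "field_hom h" "n > 0"
  shows "(of_nat n :: 'a) \<noteq> 0"
proof -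
  interpret fld_hom h by unfold_locales fact
  have "h (of_nat n) = of_nat n" by (induction n) auto
  then show ?thesis using eq_0_iff[of "of_nat n"] assms(2) by simp
qed

text \<open>Fixing the coordinate ratios means that \<open>\<sigma>\<close> changes the coordinate
  vector only by a scalar. By equivariance these are coordinates of the conjugate class, and classes
  are determined by their projective coordinates.\<close>

lemma coord_field_fixed_iff:
  assumes \<sigma>: "\<sigma> \<in> galois_group K" and pj: "projective_jacobian K emb x y N \<phi>"
    and T: "T \<subseteq> carrier (jacobian emb)" "\<And>C. C \<in> T \<Longrightarrow> galois_act emb x y \<sigma> C \<in> carrier (jacobian emb)"
  shows "(\<forall>a\<in>coord_field K N \<phi> T. \<sigma> a = a) \<longleftrightarrow> (\<forall>C\<in>T. galois_act emb x y \<sigma> C = C)"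
proof -
  have hom: "field_hom \<sigma>" and fixK: "\<And>a. a \<in> K \<Longrightarrow> \<sigma> a = a" using \<sigma> by (auto simp: galois_group_def)
  interpret s: fld_hom \<sigma> by unfold_locales fact
  have nz: "proj_nonzero N (\<phi> C)" and eqv: "proj_eq N (\<phi> (galois_act emb x y \<sigma> C)) (\<lambda>i. \<sigma> (\<phi> C i))" if "C \<in> T" for C
    using pj T(1) that \<sigma> unfolding projective_jacobian_def Let_def by blast+
  have inj: "C = D" if "C \<in> carrier (jacobian emb)" "D \<in> carrier (jacobian emb)" "proj_eq N (\<phi> C) (\<phi> D)" for C D
    using pj that unfolding projective_jacobian_def Let_def by blast
  let ?S = "K \<union> {\<phi> C i / \<phi> C j | C i j. C \<in> T \<and> i \<le> N \<and> j \<le> N \<and> \<phi> C j \<noteq> 0}"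
  show ?thesis
  proof
    assume fixed: "\<forall>a\<in>coord_field K N \<phi> T. \<sigma> a = a"
    show "\<forall>C\<in>T. galois_act emb x y \<sigma> C = C"
    proof
      fix C assume C: "C \<in> T"
      obtain j where j: "j \<le> N" "\<phi> C j \<noteq> 0" using nz[OF C] by (auto simp: proj_nonzero_def)
      obtain c where c: "c \<noteq> 0" "\<And>i. i \<le> N \<Longrightarrow> \<phi> (galois_act emb x y \<sigma> C) i = c * \<sigma> (\<phi> C i)"
        using eqv[OF C] by (auto simp: proj_eq_def)
      have ratio: "\<sigma> (\<phi> C i) = (\<sigma> (\<phi> C j) / \<phi> C j) * \<phi> C i" if i: "i \<le> N" for i
      proof -
        have "\<phi> C i / \<phi> C j \<in> ?S" using C i j by blast
        then have "\<phi> C i / \<phi> C j \<in> coord_field K N \<phi> T" unfolding coord_field_def using field_gen_subset[of ?S] by blast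
        then have "\<sigma> (\<phi> C i) / \<sigma> (\<phi> C j) = \<phi> C i / \<phi> C j" using fixed by (metis s.divide)
        then show ?thesis using j(2) by (simp add: field_simps)
      qed
      let ?c = "c * (\<sigma> (\<phi> C j) / \<phi> C j)"
      have "\<phi> (galois_act emb x y \<sigma> C) i = ?c * \<phi> C i" if i: "i \<le> N" for i
        unfolding c(2)[OF i] by (subst ratio[OF i]) (simp only: mult.assoc)
      moreover have "?c \<noteq> 0" using c(1) j(2) by simp
      ultimately have "proj_eq N (\<phi> (galois_act emb x y \<sigma> C)) (\<phi> C)"
        unfolding proj_eq_def by blast
      then show "galois_act emb x y \<sigma> C = C" using inj T C by blast
    qed
  next
    assume fixed: "\<forall>C\<in>T. galois_act emb x y \<sigma> C = C"
    have "\<sigma> a = a" if a: "a \<in> ?S" for a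
    proof -
      consider "a \<in> K" | C i j where "C \<in> T" "i \<le> N" "j \<le> N" "\<phi> C j \<noteq> 0" "a = \<phi> C i / \<phi> C j"
        using a by blast
      then show ?thesis
      proof cases
        case 2
        obtain c where c: "c \<noteq> 0" "\<And>i. i \<le> N \<Longrightarrow> \<phi> C i = c * \<sigma> (\<phi> C i)"
          using eqv[OF 2(1)] fixed 2(1) by (auto simp: proj_eq_def)
        have "\<phi> C i / \<phi> C j = (c * \<sigma> (\<phi> C i)) / (c * \<sigma> (\<phi> C j))" using c(2) 2(2,3) by metis
        also have "\<dots> = \<sigma> (\<phi> C i) / \<sigma> (\<phi> C j)" using c(1) by simp
        finally show ?thesis unfolding 2(5) s.divide by (rule sym)
      qed (rule fixK)
    qed
    then have "?S \<subseteq> {a. \<sigma> a = a}" by blast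
    then have "coord_field K N \<phi> T \<subseteq> {a. \<sigma> a = a}"
      unfolding coord_field_def by (rule field_gen_minimal[OF _ field_hom_fixed_subfield[OF hom]])
    then show "\<forall>a\<in>coord_field K N \<phi> T. \<sigma> a = a" by blast
  qed
qed

lemma agree_or_differ:
  "(\<And>j. j \<in> A \<Longrightarrow> (Q j = R j) = (Q a = R a)) \<Longrightarrow> (\<forall>j\<in>A. Q j = R j) \<or> (\<forall>j\<in>A. Q j \<noteq> R j)"
  by blast

text \<open>If \<open>\<pi>\<close> moves \<open>d\<close> to \<open>i0\<close>, the hypothesis for
  \<open>i0\<close> gives \<open>\<pi> i0 = d\<close>. For any other \<open>k\<close> the pairs
  \<open>{\<pi> k, i0}\<close> and \<open>{k, d}\<close> are not equal, so they are complementary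
  and exhaust \<open>{1..d}\<close>; hence \<open>d = 4\<close> and \<open>\<pi>\<close> is a double
  transposition.\<close>

lemma permutation_of_pairs:
  fixes \<pi> :: "nat \<Rightarrow> nat"
  assumes d: "even d" "4 \<le> d" and ran: "\<And>i. i \<in> {1..d} \<Longrightarrow> \<pi> i \<in> {1..d}" and inj: "inj_on \<pi> {1..d}"
    and H: "\<And>i. i \<in> {1..d - 1} \<Longrightarrow> (\<forall>j\<in>{1..d}. (j \<in> {\<pi> i, \<pi> d}) = (j \<in> {i, d})) \<or>
      (\<forall>j\<in>{1..d}. (j \<in> {\<pi> i, \<pi> d}) \<noteq> (j \<in> {i, d}))"
  shows "(\<forall>i\<in>{1..d}. \<pi> i = i) \<or>
    (d = 4 \<and> (\<exists>i0 k l. {i0, k, l} = {1..3} \<and> i0 \<noteq> k \<and> i0 \<noteq> l \<and> k \<noteq> l \<and> \<pi> 4 = i0 \<and> \<pi> i0 = 4 \<and> \<pi> k = l \<and> \<pi> l = k))"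
proof (cases "\<pi> d = d")
  case True
  have "\<pi> i = i" if i: "i \<in> {1..d - 1}" for i
  proof -
    have i': "i \<in> {1..d}" "d \<in> {1..d}" "i \<noteq> d" using i d by auto
    have "(d \<in> {\<pi> i, \<pi> d}) = (d \<in> {i, d})" using True by auto
    then have "\<forall>j\<in>{1..d}. (j \<in> {\<pi> i, \<pi> d}) = (j \<in> {i, d})" using H[OF i] i'(2) by metis
    then have "i \<in> {\<pi> i, \<pi> d}" using i' by auto
    then show ?thesis using True i' by auto
  qed
  then have "\<pi> i = i" if "i \<in> {1..d}" for i using True that by (cases "i = d") auto
  then show ?thesis by blast
next
  case False
  define i0 where "i0 = \<pi> d"
  have dd: "d \<in> {1..d}" using d by auto
  have i0: "i0 \<in> {1..d - 1}" "i0 \<in> {1..d}" "i0 \<noteq> d" using ran[OF dd] False by (auto simp: i0_def)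
  have "(i0 \<in> {\<pi> i0, \<pi> d}) = (i0 \<in> {i0, d})" by (simp add: i0_def)
  then have "\<forall>j\<in>{1..d}. (j \<in> {\<pi> i0, \<pi> d}) = (j \<in> {i0, d})" using H[OF i0(1)] i0(2) by metis
  then have "d \<in> {\<pi> i0, \<pi> d}" using dd by auto
  then have pi0: "\<pi> i0 = d" using False by auto
  have other: "\<pi> k \<noteq> k \<and> {1..d} \<subseteq> {\<pi> k, i0, k, d}" if k: "k \<in> {1..d - 1}" "k \<noteq> i0" for k
  proof -
    have k': "k \<in> {1..d}" "k \<noteq> d" using k d by auto
    have "(i0 \<in> {\<pi> k, \<pi> d}) \<noteq> (i0 \<in> {k, d})" using k i0 by (auto simp: i0_def)
    then have *: "\<forall>j\<in>{1..d}. (j \<in> {\<pi> k, \<pi> d}) \<noteq> (j \<in> {k, d})" using H[OF k(1)] i0(2) by metis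
    have "(k \<in> {\<pi> k, \<pi> d}) \<noteq> (k \<in> {k, d})" using * k'(1) by blast
    then have "\<pi> k \<noteq> k" by auto
    moreover have "j \<in> {\<pi> k, i0, k, d}" if "j \<in> {1..d}" for j
    proof -
      have "(j \<in> {\<pi> k, \<pi> d}) \<noteq> (j \<in> {k, d})" using * that by blast
      then show ?thesis unfolding i0_def by blast
    qed
    ultimately show ?thesis by blast
  qed
  \<comment> \<open>Any index different from \<open>i0\<close> and \<open>d\<close> will do.\<close>
  define k0 :: nat where "k0 = (if i0 = 1 then 2 else 1)"
  have k0: "k0 \<in> {1..d - 1}" "k0 \<noteq> i0" using d by (auto simp: k0_def)
  have "card {1..d} \<le> card {\<pi> k0, i0, k0, d}" using other[OF k0] by (intro card_mono) auto
  also have "\<dots> \<le> 4" by (simp add: card_insert_if)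
  finally have d4: "d = 4" using d by simp
  have "i0 = 1 \<or> i0 = 2 \<or> i0 = 3" using i0(1) d4 by auto
  then obtain k l where kl: "{i0, k, l} = {1..3}" "i0 \<noteq> k" "i0 \<noteq> l" "k \<noteq> l"
  proof -
    have s: "{1..3} = {1, 2, 3::nat}" by auto
    assume "i0 = 1 \<or> i0 = 2 \<or> i0 = 3" and *: "\<And>k l. {i0, k, l} = {1..3} \<Longrightarrow> i0 \<noteq> k \<Longrightarrow> i0 \<noteq> l \<Longrightarrow> k \<noteq> l \<Longrightarrow> thesis"
    from this(1) show thesis
    proof (elim disjE)
      assume "i0 = 1"
      then show thesis using *[of 2 3] unfolding s by simp
    next
      assume "i0 = 2"
      then show thesis using *[of 1 3] unfolding s by (simp add: insert_commute)
    next
      assume "i0 = 3"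
      then show thesis using *[of 1 2] unfolding s by (simp add: insert_commute)
    qed
  qed
  have in3: "k \<in> {1..3}" "l \<in> {1..3}" using kl(1) by auto
  have swap: "\<pi> k = l" if kl: "{i0, k, l} = {1..3}" "i0 \<noteq> k" and in3: "k \<in> {1..3}" for k l
  proof -
    have k4: "k \<in> {1..d}" using in3 d4 by auto
    have "\<pi> k \<noteq> \<pi> d" "\<pi> k \<noteq> \<pi> i0" using inj_onD[OF inj _ k4 dd] inj_onD[OF inj _ k4 i0(2)] kl(2) in3 d4 by auto
    moreover have "\<pi> k \<noteq> k" using other[of k] in3 kl(2) d4 by auto
    moreover have "\<pi> k \<in> {1..4}" using ran[OF k4] d4 by simp
    moreover have "{1..4} = insert 4 {1..3::nat}" by auto
    ultimately have "\<pi> k \<in> {i0, k, l}" "\<pi> k \<noteq> i0" "\<pi> k \<noteq> k"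
      unfolding kl(1) pi0 i0_def[symmetric] using d4 by auto
    then show ?thesis by blast
  qed
  have "\<pi> k = l" using swap[OF kl(1,2) in3(1)] .
  moreover have "\<pi> l = k" using swap[of l k] kl in3 by (simp add: insert_commute)
  moreover have "\<pi> 4 = i0" using d4 by (simp add: i0_def)
  moreover have "\<pi> i0 = 4" using pi0 d4 by simp
  ultimately show ?thesis using d4 kl by blast
qed

section \<open>How two-torsion classes record the branch points\<close>

context odd_model
begin

lemma E_torsion_2: "i \<in> I \<Longrightarrow> div_class emb (E i) \<in> torsion emb 2"
proof -
  assume i: "i \<in> I"
  have "principal (E i + E i)" unfolding pdiv_x_b[OF i, symmetric] by (rule principal_pdiv) simp
  then show ?thesis unfolding torsion_2 using Div0_E[OF i] by blast
qed

lemma act_E_moved: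
  assumes s: "semiaut emb \<sigma> \<tau>" "\<tau> x = x" and ij: "i \<in> I" "j \<in> I" "\<sigma> (b i) = b j"
  shows "act \<tau> (E i) = E j"
proof -
  have bij: "bij \<tau>" using s by (simp add: semiaut_def)
  have "e j \<circ> \<tau> \<in> P" using semiaut_points[OF s(1)] e(1)[OF ij(2)] by simp
  moreover have "hasval (e j \<circ> \<tau>) x (b i)"
    using semiaut_hasval[OF s(1) refl, of "e j" x "b i"] e(2)[OF ij(2)] s(2) ij(3) by simp
  ultimately have ej: "e j \<circ> \<tau> = e i" using e_eqI[OF _ ij(1)] by blast
  have "pinf \<circ> \<tau> \<in> P" using semiaut_points[OF s(1)] pinf by simp
  then have pi: "pinf \<circ> \<tau> = pinf" using pinf_eqI[of "pinf \<circ> \<tau>"] pinf s(2) by simp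
  show ?thesis
    using act_frag_of[OF bij, of "e j"] act_frag_of[OF bij, of pinf] unfolding ej pi
    by (simp add: E_def act_diff[OF bij])
qed

text \<open>For distinct indices the difference has coefficient 1 at \<open>e j\<close> and 0 at
  infinity, against \<open>parity\<close>.\<close>

lemma E_class_inj:
  assumes ij: "i \<in> I" "j \<in> I" "principal (E j - E i)"
  shows "i = j"
proof (rule ccontr)
  assume ne: "i \<noteq> j"
  have "Poly_Mapping.keys (E j - E i) \<subseteq> W"
  proof
    fix v assume v: "v \<in> Poly_Mapping.keys (E j - E i)"
    show "v \<in> W"
    proof (rule ccontr)
      assume "v \<notin> W"
      then have "Poly_Mapping.lookup (E j - E i) v = 0"
        using lookup_E(3)[OF ij(1)] lookup_E(3)[OF ij(2)] by (simp add: lookup_minus)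
      then show False using v by (simp add: in_keys_iff)
    qed
  qed
  then have "even (Poly_Mapping.lookup (E j - E i) (e j)) \<longleftrightarrow> even (Poly_Mapping.lookup (E j - E i) pinf)"
    using ij(3) e_W[OF ij(2)] pinf_W by (intro parity)
  then show False using lookup_E[OF ij(1)] lookup_E[OF ij(2)] ij ne by (simp add: lookup_minus)
qed

lemma inv_torsion_2:
  assumes "C \<in> torsion emb 2"
  shows "inv\<^bsub>jacobian emb\<^esub> C = C"
proof -
  obtain D where D: "Div0 D" "principal (D + D)" "C = div_class emb D" using assms by (auto simp: torsion_2)
  have "principal (- D - D)" using principal_uminus[OF D(2)] by simp
  then show ?thesis unfolding D(3) using div_class_eq[OF Div0_uminus[OF D(1)] D(1)] inv_jacobian[OF D(1)] by simp
qed

end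

section \<open>Models of the curve adapted to a Galois automorphism\<close>

locale curve_setting =
  fixes d :: nat and \<iota> :: "complex \<Rightarrow> 'a::alg_closed_field" and \<alpha> :: "nat \<Rightarrow> 'a" and K :: "'a set"
    and emb :: "'a \<Rightarrow> 'f::field" and x y :: 'f
  assumes d3: "3 \<le> d" and hom_\<iota>: "field_hom \<iota>" and inj: "inj_on \<alpha> {1..d}" and K: "K = sym_field \<iota> \<alpha> d"
    and cff: "curve_function_field (\<Prod>i=1..d. [:- \<alpha> i, 1:]) emb x y"
begin

declare One_nat_def [simp del]

definition "g = genus d"
definition "n = 2 * g + 1"

lemma d_cases: "d = n \<or> d = Suc n"
  using d3 by (simp add: n_def g_def genus_def) presburger

sublocale iota: fld_hom \<iota> by unfold_locales (rule hom_\<iota>)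

lemma two: "(2::'a) \<noteq> 0"
  using field_hom_complex_char_0[OF hom_\<iota>, of 2] by simp

sublocale F0: func_field "\<Prod>i=1..d. [:- \<alpha> i, 1:]" emb x y
proof
  show "q = 0" if "p ^ 2 = q ^ 2 * (\<Prod>i=1..d. [:- \<alpha> i, 1:])" for p q
    using prod_linear_nonsquare[OF _ inj _ that] d3 by simp
qed (rule cff)

lemma K_subfield: "is_subfield K"
  unfolding K sym_field_def by (rule is_subfield_field_gen)

lemma iota_K: "\<iota> z \<in> K" and elem_sym_K: "k \<le> d \<Longrightarrow> elem_sym \<alpha> d k \<in> K"
  using field_gen_subset[of "range \<iota> \<union> elem_sym \<alpha> d ` {..d}"] unfolding K sym_field_def by auto

definition "s0 = \<iota> \<i>"

lemma s0: "s0 ^ 2 = - 1" "s0 \<in> K"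
proof -
  have "s0 ^ 2 = \<iota> (\<i> ^ 2)" unfolding s0_def by (simp only: iota.power)
  then show "s0 ^ 2 = - 1" by simp
qed (simp add: s0_def iota_K)

context
  fixes \<sigma> assumes gal: "\<sigma> \<in> galois_group K"
begin

lemma sigma_hom: "field_hom \<sigma>" and sigma_bij: "bij \<sigma>" and sigma_K: "a \<in> K \<Longrightarrow> \<sigma> a = a"
  using gal by (auto simp: galois_group_def)

interpretation s: fld_hom \<sigma> by unfold_locales (rule sigma_hom)

lemma sigma_sqrt_m1: "s ^ 2 = - 1 \<Longrightarrow> \<sigma> s = s"
proof -
  assume "s ^ 2 = - 1"
  then have "s = s0 \<or> s = - s0" using s0(1) by (metis power2_eq_iff)
  then show ?thesis using sigma_K[OF s0(2)] by auto
qed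

lemma sigma_poly: "map_poly \<sigma> (\<Prod>i=1..d. [:- \<alpha> i, 1:]) = (\<Prod>i=1..d. [:- \<alpha> i, 1:])"
proof (rule poly_eqI)
  fix k
  have "coeff (\<Prod>i=1..d. [:- \<alpha> i, 1:]) k \<in> K"
    unfolding coeff_prod_linear using elem_sym_K sf_uminus[OF K_subfield] sf_1[OF K_subfield] sf_0[OF K_subfield]
    by (auto intro!: sf_mult[OF K_subfield] sf_power[OF K_subfield])
  then show "coeff (map_poly \<sigma> (\<Prod>i=1..d. [:- \<alpha> i, 1:])) k = coeff (\<Prod>i=1..d. [:- \<alpha> i, 1:]) k"
    unfolding s.mp_coeff by (rule sigma_K)
qed

lemma sigma_alpha: "i \<in> {1..d} \<Longrightarrow> \<exists>j\<in>{1..d}. \<sigma> (\<alpha> i) = \<alpha> j"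
proof -
  assume i: "i \<in> {1..d}"
  let ?f = "\<Prod>i=1..d. [:- \<alpha> i, 1:]"
  have "poly ?f (\<alpha> i) = 0" unfolding poly_prod using i by (intro prod_zero) auto
  then have "poly ?f (\<sigma> (\<alpha> i)) = 0" using s.poly_mp[of ?f "\<alpha> i"] unfolding sigma_poly by simp
  then show ?thesis unfolding poly_prod by (auto simp: prod_zero_iff)
qed

abbreviation "\<tau> \<equiv> extend_aut emb x y \<sigma>"

lemma tau: "semiaut emb \<sigma> \<tau>" "\<tau> x = x" "\<tau> y = y"
proof -
  let ?f = "\<Prod>i=1..d. [:- \<alpha> i, 1:]"
  have mp: "map_poly (\<lambda>a. emb (\<sigma> a)) p = map_poly emb (map_poly \<sigma> p)" for p
    by (rule poly_eqI) (simp add: coeff_map_poly)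
  have "\<exists>!t. field_hom t \<and> bij t \<and> (\<forall>a. t (emb a) = emb (\<sigma> a)) \<and> t x = x \<and> t y = y"
  proof (rule F0.aut_extension[OF sigma_hom sigma_bij])
    show "y ^ 2 = poly (map_poly (\<lambda>a. emb (\<sigma> a)) ?f) x"
      unfolding mp sigma_poly using F0.y_square by (simp only: F0.ev_def)
    show "p = 0" if "poly (map_poly emb p) x = 0" for p
      using that F0.ev_eq_0_iff[of p] unfolding F0.ev_def by blast
    show "field_gen (range emb \<union> {x, y}) = UNIV" by (rule F0.generated)
  qed
  from theI'[OF this] show "semiaut emb \<sigma> \<tau>" "\<tau> x = x" "\<tau> y = y"
    unfolding extend_aut_def semiaut_def using sigma_hom sigma_bij by blast+
qed

text \<open>The common target of all cases: branch points differing exactly by the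
  \<open>\<gamma>\<close>, and an automorphism fixing the coordinates of the model. This
  \<open>\<tau>'\<close> may differ from the extension \<open>\<tau>\<close> that defines the Galois
  action, provided both act alike on divisor classes.\<close>

definition has_model :: bool where
  "has_model \<longleftrightarrow> (\<exists>b x' y' \<tau>'. odd_model {1..n} b emb x' y' \<and> odd_model.compatible {1..n} b emb x' y' \<sigma> \<tau>' \<and>
     (\<forall>D. func_field.Div0 emb D \<longrightarrow> func_field.principal emb (act \<tau> D - act \<tau>' D)) \<and>
     (\<forall>i\<in>{1..n}. \<forall>j\<in>{1..n}. i \<noteq> j \<longrightarrow> b j - b i = \<gamma> d \<alpha> i j))"

text \<open>\<open>\<sigma>\<close> sends the class of \<open>E i\<close> to that of
  \<open>E j\<close> when it sends \<open>\<alpha> i\<close> to \<open>\<alpha> j\<close>, and these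
  classes are distinct. So the given equation already serves as model.\<close>

lemma has_model_odd:
  assumes dn: "d = n" and triv: "\<forall>C\<in>torsion emb 2. galois_act emb x y \<sigma> C = C"
  shows has_model
proof -
  interpret O: odd_model "{1..n}" \<alpha> emb x y
  proof
    show "curve_function_field (\<Prod>i\<in>{1..n}. [:- \<alpha> i, 1:]) emb x y" using cff dn by simp
    show "inj_on \<alpha> {1..n}" using inj dn by simp
  qed (simp_all add: two n_def)
  have "\<sigma> (\<alpha> i) = \<alpha> i" if i: "i \<in> {1..n}" for i
  proof -
    obtain j where j: "j \<in> {1..n}" "\<sigma> (\<alpha> i) = \<alpha> j" using sigma_alpha[of i] i dn by auto
    have "O.principal (act \<tau> (O.E i) - O.E i)"
      using O.galois_act_trivial_iff[OF tau(1) O.Div0_E[OF i]] triv O.E_torsion_2[OF i] by blast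
    then have "O.principal (O.E j - O.E i)" unfolding O.act_E_moved[OF tau(1,2) i j] .
    then show ?thesis using O.E_class_inj[OF i j(1)] j(2) by simp
  qed
  then have "O.compatible \<sigma> \<tau>" unfolding O.compatible_def using tau sigma_sqrt_m1 by blast
  moreover have "d = 2 * genus d + 1" using dn by (simp only: n_def g_def)
  then have "\<alpha> j - \<alpha> i = \<gamma> d \<alpha> i j" for i j unfolding \<gamma>_def by (rule if_P[symmetric])
  ultimately show ?thesis unfolding has_model_def using O.odd_model_axioms O.principal_0
    by (intro exI[of _ \<alpha>] exI[of _ x] exI[of _ y] exI[of _ \<tau>]) simp
qed

context
  assumes dSn: "d = Suc n"
begin

lemma insert_d: "insert d {1..n} = {1..d}" and d_notin: "d \<notin> {1..n}" and d_in: "d \<in> {1..d}"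
  using dSn by auto

lemma even_model_I: "I = {1..n} \<Longrightarrow> even_model I d \<alpha> emb x y s0 g"
proof -
  assume I: "I = {1..n}"
  show ?thesis
  proof
    show "curve_function_field (\<Prod>i\<in>insert d I. [:- \<alpha> i, 1:]) emb x y" unfolding I insert_d by (rule cff)
    show "inj_on \<alpha> (insert d I)" unfolding I insert_d by (rule inj)
  qed (use d_notin two s0 in \<open>auto simp: I n_def\<close>)
qed

lemma gamma_even:
  assumes "i \<in> {1..n}" "j \<in> {1..n}" "i \<noteq> j"
  shows "\<gamma> d \<alpha> i j = (\<alpha> j - \<alpha> i) * (\<Prod>l\<in>{1..n} - {i, j}. \<alpha> d - \<alpha> l)"
proof -
  have "2 * genus d + 1 = n" by (simp add: n_def g_def)
  moreover have "d \<noteq> n" using dSn by simp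
  ultimately show ?thesis by (simp only: \<gamma>_def if_False)
qed

interpretation M: even_model "{1..n}" d \<alpha> emb x y s0 0 g
  by (rule even_model_I) (rule refl)

interpretation O: odd_model "{1..n}" M.\<beta> emb M.x' M.y'
  by (rule M.odd)

text \<open>The Weierstrass points indexed by the original branch points, so that \<open>d\<close>,
  which the model moves to infinity, is on the same footing as the others.\<close>

definition w :: "nat \<Rightarrow> 'f \<Rightarrow> int" where
  "w i = (if i = d then O.pinf else O.e i)"

lemma w_W: "i \<in> {1..d} \<Longrightarrow> w i \<in> O.W"
  using insert_d O.e_W O.pinf_W by (auto simp: w_def)

lemma w_P: "i \<in> {1..d} \<Longrightarrow> w i \<in> points emb"
  using w_W O.W_points by blast

lemma beta_nz: "i \<in> {1..n} \<Longrightarrow> M.\<beta> i \<noteq> 0"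
  using M.prod0_nz M.\<alpha>_neq by (simp add: M.\<beta>_def)

lemma x'_eq: "M.x' = - emb M.prod0 / (x - emb (\<alpha> d))"
  by (simp add: M.x'_def)

lemma x_M: "x = emb (\<alpha> d) - emb M.prod0 / M.x'"
  using M.x_eq by simp

lemma w_value:
  assumes i: "i \<in> {1..d}"
  shows "F0.hasval (w i) x (\<alpha> i)"
proof (cases "i = d")
  case True
  have w: "w i = O.pinf" using True by (simp add: w_def)
  have x'0: "M.x' \<noteq> 0" using O.x_ne_emb[of 0] by simp
  have p0: "emb M.prod0 \<noteq> 0" using M.prod0_nz by simp
  have "t - a = - p / q" if "t = a - p / q" for t a p q :: 'f
    using that by simp
  from this[OF x_M] have "x - emb (\<alpha> d) = - emb M.prod0 / M.x'" .
  moreover have "O.pinf (- emb M.prod0 / M.x') = 2"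
    using O.v_divide[OF O.pinf(1), of "- emb M.prod0" "M.x'"] x'0 p0 O.v_uminus[OF O.pinf(1)] O.v_emb[OF O.pinf(1)]
      O.pinf_x[of 0] by simp
  ultimately show ?thesis unfolding w F0.hasval_def vpos_def using True by simp
next
  case False
  then have i': "i \<in> {1..n}" using i insert_d by blast
  have w: "w i = O.e i" using False by (simp add: w_def)
  have "O.hasval (O.e i) (emb (\<alpha> d) - emb M.prod0 / M.x') (\<alpha> d - M.prod0 / M.\<beta> i)"
    using O.e[OF i'] beta_nz[OF i'] by (intro O.hasval_diff O.hasval_divide O.hasval_emb)
  moreover have "\<alpha> d - M.prod0 / M.\<beta> i = \<alpha> i" using M.prod0_nz M.\<alpha>_neq[OF i'] by (simp add: M.\<beta>_def)
  ultimately show ?thesis unfolding w x_M[symmetric] by simp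
qed

lemma w_unique:
  assumes i: "i \<in> {1..d}" and v: "v \<in> points emb" "F0.hasval v x (\<alpha> i)"
  shows "v = w i"
proof (cases "i = d")
  case True
  have nz: "x - emb (\<alpha> d) \<noteq> 0" by (rule M.X_nz)
  have "0 < v (x - emb (\<alpha> d))" using v(2) nz True by (simp add: F0.hasval_def vpos_def)
  then have "v M.x' < 0"
    unfolding x'_eq using O.v_divide[OF v(1), of "- emb M.prod0" "x - emb (\<alpha> d)"] nz M.prod0_nz
      O.v_uminus[OF v(1)] O.v_emb[OF v(1)] by simp
  then show ?thesis using O.pinf_eqI[OF v(1)] True by (simp add: w_def)
next
  case False
  then have i': "i \<in> {1..n}" using i insert_d by blast
  have ne: "\<alpha> i - \<alpha> d \<noteq> 0" using M.\<alpha>_neq[OF i'] by auto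
  have "O.hasval v (emb (- M.prod0) / (x - emb (\<alpha> d))) (- M.prod0 / (\<alpha> i - \<alpha> d))"
    using v ne by (intro O.hasval_divide O.hasval_diff O.hasval_emb)
  moreover have "- M.prod0 / (\<alpha> i - \<alpha> d) = M.\<beta> i"
    unfolding M.\<beta>_def by (metis minus_diff_eq minus_divide_right minus_divide_left diff_zero)
  moreover have "emb (- M.prod0) / (x - emb (\<alpha> d)) = M.x'" unfolding x'_eq by simp
  ultimately have "O.hasval v M.x' (M.\<beta> i)" by simp
  then show ?thesis using O.e_eqI[OF v(1) i'] False by (simp add: w_def)
qed

lemma w_inj: "i \<in> {1..d} \<Longrightarrow> j \<in> {1..d} \<Longrightarrow> w i = w j \<longleftrightarrow> i = j"
proof
  assume ij: "i \<in> {1..d}" "j \<in> {1..d}" "w i = w j"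
  have "F0.hasval (w i) x (\<alpha> j)" unfolding ij(3) by (rule w_value[OF ij(2)])
  with w_value[OF ij(1)] have "\<alpha> i = \<alpha> j" by (rule F0.hasval_unique[OF w_P[OF ij(1)]])
  then show "i = j" by (rule inj_onD[OF inj _ ij(1,2)])
qed simp

lemma act_w:
  assumes ij: "i \<in> {1..d}" "j \<in> {1..d}" "\<sigma> (\<alpha> i) = \<alpha> j"
  shows "act \<tau> (frag_of (w i)) = frag_of (w j)"
proof -
  have bij: "bij \<tau>" using tau(1) by (simp add: semiaut_def)
  have "w j \<circ> \<tau> \<in> points emb" using F0.semiaut_points[OF tau(1)] w_P[OF ij(2)] by simp
  moreover have "F0.hasval (w j \<circ> \<tau>) x (\<alpha> i)"
    using F0.semiaut_hasval[OF tau(1) refl, of "w j" x "\<alpha> i"] w_value[OF ij(2)] tau(2) ij(3) by simp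
  ultimately have "w j \<circ> \<tau> = w i" using w_unique[OF ij(1)] by blast
  then show ?thesis using act_frag_of[OF bij, of "w j"] by simp
qed

text \<open>\<open>E i\<close> is \<open>w i - w d\<close> and is carried to
  \<open>w (\<pi> i) - w (\<pi> d)\<close>. As the class does not change, \<open>parity\<close>
  applied to the difference says that the two pairs of indices are equal or complementary.\<close>

lemma permutation_cases:
  assumes triv: "\<forall>C\<in>torsion emb 2. galois_act emb x y \<sigma> C = C"
  shows "(\<forall>i\<in>{1..d}. \<sigma> (\<alpha> i) = \<alpha> i) \<or> (d = 4 \<and> (\<exists>i0 k l. {i0, k, l} = {1..3} \<and> i0 \<noteq> k \<and> i0 \<noteq> l \<and> k \<noteq> l \<and>
    \<sigma> (\<alpha> 4) = \<alpha> i0 \<and> \<sigma> (\<alpha> i0) = \<alpha> 4 \<and> \<sigma> (\<alpha> k) = \<alpha> l \<and> \<sigma> (\<alpha> l) = \<alpha> k))"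
proof -
  have "\<forall>i\<in>{1..d}. \<exists>j. j \<in> {1..d} \<and> \<sigma> (\<alpha> i) = \<alpha> j" using sigma_alpha by blast
  from bchoice[OF this] obtain \<pi> where p: "\<And>i. i \<in> {1..d} \<Longrightarrow> \<pi> i \<in> {1..d} \<and> \<sigma> (\<alpha> i) = \<alpha> (\<pi> i)"
    by blast
  have inj_pi: "inj_on \<pi> {1..d}"
  proof (rule inj_onI)
    fix i j assume ij: "i \<in> {1..d}" "j \<in> {1..d}" "\<pi> i = \<pi> j"
    then have "\<sigma> (\<alpha> i) = \<sigma> (\<alpha> j)" using p by simp
    then have "\<alpha> i = \<alpha> j" by simp
    then show "i = j" by (rule inj_onD[OF inj _ ij(1,2)])
  qed
  have bij: "bij \<tau>" using tau(1) by (simp add: semiaut_def)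
  have d2: "d = 2 * (g + 1)" using dSn by (simp add: n_def)
  have "g \<noteq> 0" using d2 d3 by (intro notI) simp
  then have d_even: "even d" "4 \<le> d" by (subst d2, simp)+
  have H: "(\<forall>j\<in>{1..d}. (j \<in> {\<pi> i, \<pi> d}) = (j \<in> {i, d})) \<or>
      (\<forall>j\<in>{1..d}. (j \<in> {\<pi> i, \<pi> d}) \<noteq> (j \<in> {i, d}))" if i: "i \<in> {1..d - 1}" for i
  proof -
    have i': "i \<in> {1..n}" "i \<in> {1..d}" "i \<noteq> d" using i dSn by auto
    have pid: "\<pi> i \<noteq> \<pi> d" using inj_onD[OF inj_pi _ i'(2) d_in] i'(3) by blast
    have Ei: "O.E i = frag_of (w i) - frag_of (w d)" using i'(3) by (simp add: O.E_def w_def)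
    let ?D = "(frag_of (w (\<pi> i)) - frag_of (w (\<pi> d))) - (frag_of (w i) - frag_of (w d))"
    have "O.principal (act \<tau> (O.E i) - O.E i)"
      using O.galois_act_trivial_iff[OF tau(1) O.Div0_E[OF i'(1)]] triv O.E_torsion_2[OF i'(1)] by blast
    moreover have "act \<tau> (O.E i) = frag_of (w (\<pi> i)) - frag_of (w (\<pi> d))"
      unfolding Ei act_diff[OF bij] act_w[OF i'(2) conjunct1[OF p[OF i'(2)]] conjunct2[OF p[OF i'(2)]]]
        act_w[OF d_in conjunct1[OF p[OF d_in]] conjunct2[OF p[OF d_in]]] ..
    ultimately have pr: "O.principal ?D" unfolding Ei by simp
    have keys: "Poly_Mapping.keys ?D \<subseteq> O.W"
    proof
      fix v assume v: "v \<in> Poly_Mapping.keys ?D"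
      show "v \<in> O.W"
      proof (rule ccontr)
        assume "v \<notin> O.W"
        then have "v \<noteq> w (\<pi> i)" "v \<noteq> w (\<pi> d)" "v \<noteq> w i" "v \<noteq> w d"
          using w_W[of "\<pi> i"] w_W[of "\<pi> d"] w_W[OF i'(2)] w_W[OF d_in] p[OF i'(2)] p[OF d_in] by metis+
        then have "Poly_Mapping.lookup ?D v = 0" by (simp add: lookup_minus)
        then show False using v by (simp add: in_keys_iff)
      qed
    qed
    have lk: "Poly_Mapping.lookup ?D (w j) =
      (if j = \<pi> i then 1 else 0) - (if j = \<pi> d then 1 else 0) - ((if j = i then 1 else 0) - (if j = d then 1 else 0))"
      if j: "j \<in> {1..d}" for j
      using w_inj[OF j] p[OF i'(2)] p[OF d_in] i'(2) d_in by (simp add: lookup_minus)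
    have ev: "even (Poly_Mapping.lookup ?D (w j)) \<longleftrightarrow> ((j \<in> {\<pi> i, \<pi> d}) = (j \<in> {i, d}))" if j: "j \<in> {1..d}" for j
      unfolding lk[OF j] using pid i'(3) by auto
    have par: "even (Poly_Mapping.lookup ?D (w j)) \<longleftrightarrow> even (Poly_Mapping.lookup ?D (w j'))"
      if "j \<in> {1..d}" "j' \<in> {1..d}" for j j'
      using O.parity[OF pr keys w_W[OF that(1)] w_W[OF that(2)]] .
    have "(((j \<in> {\<pi> i, \<pi> d}) = (j \<in> {i, d})) = ((j' \<in> {\<pi> i, \<pi> d}) = (j' \<in> {i, d})))"
      if "j \<in> {1..d}" "j' \<in> {1..d}" for j j'
      using par[OF that] unfolding ev[OF that(1)] ev[OF that(2)] .
    note par' = this[OF _ d_in]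
    show ?thesis
      using agree_or_differ[where A = "{1..d}" and Q = "\<lambda>j. j \<in> {\<pi> i, \<pi> d}" and R = "\<lambda>j. j \<in> {i, d}", OF par'] .
  qed
  have ran: "\<And>i. i \<in> {1..d} \<Longrightarrow> \<pi> i \<in> {1..d}" using p by blast
  from permutation_of_pairs[OF d_even ran inj_pi H] show ?thesis
  proof
    assume id: "\<forall>i\<in>{1..d}. \<pi> i = i"
    have "\<sigma> (\<alpha> i) = \<alpha> i" if "i \<in> {1..d}" for i using p[OF that] bspec[OF id that] by simp
    then show ?thesis by blast
  next
    assume "d = 4 \<and> (\<exists>i0 k l. {i0, k, l} = {1..3} \<and> i0 \<noteq> k \<and> i0 \<noteq> l \<and> k \<noteq> l \<and> \<pi> 4 = i0 \<and> \<pi> i0 = 4 \<and> \<pi> k = l \<and> \<pi> l = k)"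
    then obtain i0 k l where *: "d = 4" "{i0, k, l} = {1..3}" "i0 \<noteq> k" "i0 \<noteq> l" "k \<noteq> l"
      "\<pi> 4 = i0" "\<pi> i0 = 4" "\<pi> k = l" "\<pi> l = k" by blast
    have "i0 \<in> {i0, k, l}" "k \<in> {i0, k, l}" "l \<in> {i0, k, l}" by auto
    then have in_d: "i0 \<in> {1..d}" "k \<in> {1..d}" "l \<in> {1..d}" "4 \<in> {1..d}" unfolding *(2) using *(1) by simp_all
    have "\<sigma> (\<alpha> 4) = \<alpha> i0" "\<sigma> (\<alpha> i0) = \<alpha> 4" "\<sigma> (\<alpha> k) = \<alpha> l" "\<sigma> (\<alpha> l) = \<alpha> k"
      using p[OF in_d(1)] p[OF in_d(2)] p[OF in_d(3)] p[OF in_d(4)] unfolding *(6-9) by blast+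
    then show ?thesis using *(1-5) by blast
  qed
qed

text \<open>All constants in the change of coordinates are fixed by \<open>\<sigma>\<close>, so
  \<open>\<tau>\<close> fixes the new coordinates and can be used itself.\<close>

lemma has_model_even_fixed:
  assumes fixed: "\<forall>i\<in>{1..d}. \<sigma> (\<alpha> i) = \<alpha> i"
  shows has_model
proof -
  interpret t: fld_hom \<tau> using tau(1) by unfold_locales (simp add: semiaut_def)
  have te: "\<tau> (emb a) = emb (\<sigma> a)" for a using tau(1) by (simp add: semiaut_def)
  have f: "\<sigma> (\<alpha> i) = \<alpha> i" if "i \<in> {1..n} \<or> i = d" for i using fixed that insert_d by blast
  have sp: "\<sigma> M.prod0 = M.prod0" unfolding M.prod0_def s.prod s.diff using f by (intro prod.cong) auto
  have "\<tau> M.x' = M.x'" unfolding x'_eq t.divide t.uminus t.diff te sp using f tau(2) by simp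
  moreover have "\<tau> M.y' = M.y'"
    unfolding M.y'_def t.divide t.mult t.power t.diff te s.mult s.power sp using f tau(2,3) sigma_K[OF s0(2)] by simp
  moreover have "\<sigma> (M.\<beta> i) = M.\<beta> i" if "i \<in> {1..n}" for i
    unfolding M.\<beta>_def s.diff s.divide sp s.zero using f that by simp
  ultimately have "O.compatible \<sigma> \<tau>" unfolding O.compatible_def using tau(1) sigma_sqrt_m1 by blast
  moreover have "M.\<beta> j - M.\<beta> i = \<gamma> d \<alpha> i j" if "i \<in> {1..n}" "j \<in> {1..n}" "i \<noteq> j" for i j
    unfolding gamma_even[OF that] by (rule M.beta_diff[OF that])
  moreover have "O.principal (act \<tau> D - act \<tau> D)" for D using O.principal_0 by simp
  ultimately show ?thesis unfolding has_model_def using O.odd_model_axioms by blast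
qed

end

end

end

lemma semiaut_inv:
  assumes "semiaut emb \<sigma> \<tau>"
  shows "semiaut emb (inv_into UNIV \<sigma>) (inv_into UNIV \<tau>)"
proof -
  have inv_hom: "field_hom (inv_into UNIV h) \<and> bij (inv_into UNIV h)" if h: "field_hom h" "bij h" for h :: "'c::field \<Rightarrow> 'c"
  proof -
    interpret fld_hom h by unfold_locales fact
    have r: "h (inv_into UNIV h a) = a" "inv_into UNIV h (h a) = a" for a
      using h(2) by (simp_all add: f_inv_into_f bij_is_surj inv_into_f_f bij_is_inj)
    have "inv_into UNIV h 1 = 1" using r(2)[of 1] by simp
    moreover have "inv_into UNIV h (a + c) = inv_into UNIV h a + inv_into UNIV h c" for a c
      using r(2)[of "inv_into UNIV h a + inv_into UNIV h c"] r(1) by simp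
    moreover have "inv_into UNIV h (a * c) = inv_into UNIV h a * inv_into UNIV h c" for a c
      using r(2)[of "inv_into UNIV h a * inv_into UNIV h c"] r(1) by simp
    ultimately show ?thesis using bij_imp_bij_inv[OF h(2)] by (simp add: field_hom_def)
  qed
  have s: "field_hom \<sigma>" "bij \<sigma>" "field_hom \<tau>" "bij \<tau>" "\<And>a. \<tau> (emb a) = emb (\<sigma> a)"
    using assms by (auto simp: semiaut_def)
  have "inv_into UNIV \<tau> (emb a) = emb (inv_into UNIV \<sigma> a)" for a
  proof -
    have "\<tau> (emb (inv_into UNIV \<sigma> a)) = emb a"
      unfolding s(5) using s(2) by (simp add: f_inv_into_f bij_is_surj)
    then show ?thesis using s(4) by (metis bij_is_inj inv_into_f_f UNIV_I)
  qed
  then show ?thesis using inv_hom[OF s(1,2)] inv_hom[OF s(3,4)] by (simp add: semiaut_def)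
qed

context curve_setting
begin

context
  fixes \<sigma> assumes gal: "\<sigma> \<in> galois_group K"
begin

interpretation s: fld_hom \<sigma> by unfold_locales (rule sigma_hom[OF gal])

abbreviation (input) "\<tau>\<sigma> \<equiv> extend_aut emb x y \<sigma>"

text \<open>The elements of the Klein four-group differ by a translation from an element that fixes all branch points
  of the odd model.\<close>

lemma has_model_swap:
  assumes dn: "d = Suc n" and d4: "d = 4" and ikl: "{i0, k, l} = {1..3}" and ne: "i0 \<noteq> k" "i0 \<noteq> l" "k \<noteq> l"
    and sw: "\<sigma> (\<alpha> 4) = \<alpha> i0" "\<sigma> (\<alpha> i0) = \<alpha> 4" "\<sigma> (\<alpha> k) = \<alpha> l" "\<sigma> (\<alpha> l) = \<alpha> k"
  shows "has_model \<sigma>"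
proof -
  have n3: "n = 3" using dn d4 by simp
  have g1: "g = 1" using n3 by (simp add: n_def)
  have I: "{i0, k, l} = {1..n}" unfolding n3 by (rule ikl)
  \<comment> \<open>This translation places the branch point of \<open>i0\<close> at 0, as needed
    for the translation by \<open>(0, 0)\<close>.\<close>
  define c where "c = even_model.prod0 {i0, k, l} d \<alpha> / (\<alpha> d - \<alpha> i0)"
  interpret N: even_model "{i0, k, l}" d \<alpha> emb x y s0 c g
    by (rule even_model_I[OF gal dn I])
  interpret ON: odd_model "{i0, k, l}" N.\<beta> emb N.x' N.y' by (rule N.odd)
  have b0: "N.\<beta> i0 = 0" unfolding N.\<beta>_def by (simp add: c_def)
  define A where "A = (\<alpha> d - \<alpha> k) * (\<alpha> d - \<alpha> l)"
  define A' where "A' = (\<alpha> i0 - \<alpha> l) * (\<alpha> i0 - \<alpha> k)"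
  have sA: "\<sigma> A = A'" using sw d4 by (simp add: A_def A'_def)
  have prod0: "N.prod0 = (\<alpha> d - \<alpha> i0) * A" using ne by (simp add: N.prod0_def A_def mult.assoc)
  have nz: "\<alpha> d - \<alpha> i0 \<noteq> 0" "\<alpha> d - \<alpha> k \<noteq> 0" "\<alpha> d - \<alpha> l \<noteq> 0" by (rule N.\<alpha>_neq; simp)+
  have A0: "A \<noteq> 0" using nz by (simp add: A_def)
  have cA: "c = A" unfolding c_def prod0 using nz by simp
  have bk: "N.\<beta> k = (\<alpha> k - \<alpha> i0) * (\<alpha> d - \<alpha> l)"
  proof -
    have "{i0, k, l} - {i0, k} = {l}" using ne by auto
    then show ?thesis using N.beta_diff[of i0 k] ne b0 by simp
  qed
  have bl: "N.\<beta> l = (\<alpha> l - \<alpha> i0) * (\<alpha> d - \<alpha> k)"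
  proof -
    have "{i0, k, l} - {i0, l} = {k}" using ne by auto
    then show ?thesis using N.beta_diff[of i0 l] ne b0 by simp
  qed
  have B: "N.\<beta> k * N.\<beta> l = A * A'" unfolding bk bl A_def A'_def by (simp add: algebra_simps)
  have sb: "\<sigma> (N.\<beta> i) = N.\<beta> i" if "i \<in> {i0, k, l}" for i
  proof -
    have "\<sigma> (N.\<beta> k) = N.\<beta> k" unfolding bk s.mult s.diff using sw d4 by (simp add: algebra_simps)
    moreover have "\<sigma> (N.\<beta> l) = N.\<beta> l" unfolding bl s.mult s.diff using sw d4 by (simp add: algebra_simps)
    ultimately show ?thesis using that b0 by auto
  qed
  \<comment> \<open>In this form \<open>\<sigma>\<close> visibly exchanges the zero and the pole, so
    that \<open>x'\<close> becomes a constant times its inverse.\<close>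
  have x'_eq: "N.x' = - emb A * (x - emb (\<alpha> i0)) / (x - emb (\<alpha> d))"
  proof -
    have "- (r * a) / X - a = - a * (X + r) / X" if "X \<noteq> 0" for r a X :: 'f
      using that by (simp add: field_simps)
    note frac = this
    have "N.x' = - emb N.prod0 / (x - emb (\<alpha> d)) - emb c" by (rule N.x'_def)
    also have "\<dots> = - (emb (\<alpha> d - \<alpha> i0) * emb A) / (x - emb (\<alpha> d)) - emb A"
      by (simp only: prod0 cA F0.emb.mult)
    also have "\<dots> = - emb A * ((x - emb (\<alpha> d)) + emb (\<alpha> d - \<alpha> i0)) / (x - emb (\<alpha> d))"
      by (rule frac[OF N.X_nz])
    also have "(x - emb (\<alpha> d)) + emb (\<alpha> d - \<alpha> i0) = x - emb (\<alpha> i0)" by simp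
    finally show ?thesis .
  qed
  have y'_eq: "N.y' = emb s0 * (emb (\<alpha> d - \<alpha> i0) * emb A) * y / (x - emb (\<alpha> d)) ^ 2"
  proof -
    have "N.y' = emb (s0 * N.prod0 ^ g) * y / (x - emb (\<alpha> d)) ^ (g + 1)" by (rule N.y'_def)
    also have "\<dots> = emb s0 * (emb (\<alpha> d - \<alpha> i0) * emb A) * y / (x - emb (\<alpha> d)) ^ 2"
      by (simp only: g1 prod0 power_one_right one_add_one F0.emb.mult)
    finally show ?thesis .
  qed
  let ?f = "\<Prod>i\<in>{i0, k, l}. [:- N.\<beta> i, 1:]"
  \<comment> \<open>Although \<open>\<sigma>\<close> permutes the original branch points, it fixes
    those of the model, so another extension \<open>t\<close> of \<open>\<sigma>\<close> fixes the
    coordinates of the model.\<close>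
  have "\<exists>!t. field_hom t \<and> bij t \<and> (\<forall>a. t (emb a) = emb (\<sigma> a)) \<and> t N.x' = N.x' \<and> t N.y' = N.y'"
  proof (rule ON.aut_extension[OF sigma_hom[OF gal] sigma_bij[OF gal]])
    have "map_poly \<sigma> ON.f = ON.f" unfolding ON.f_def s.mp_prod using sb by (intro prod.cong) auto
    moreover have "map_poly (\<lambda>a. emb (\<sigma> a)) p = map_poly emb (map_poly \<sigma> p)" for p
      by (rule poly_eqI) (simp add: coeff_map_poly)
    ultimately show "N.y' ^ 2 = poly (map_poly (\<lambda>a. emb (\<sigma> a)) ON.f) N.x'"
      using ON.y_square unfolding ON.ev_def by simp
    show "p = 0" if "poly (map_poly emb p) N.x' = 0" for p
      using that ON.ev_eq_0_iff[of p] unfolding ON.ev_def by blast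
    show "field_gen (range emb \<union> {N.x', N.y'}) = UNIV" by (rule ON.generated)
  qed
  then obtain t where t: "field_hom t" "bij t" "\<And>a. t (emb a) = emb (\<sigma> a)" "t N.x' = N.x'" "t N.y' = N.y'"
    by blast
  have st: "semiaut emb \<sigma> t" using t sigma_hom[OF gal] sigma_bij[OF gal] by (simp add: semiaut_def)
  have comp: "ON.compatible \<sigma> t" unfolding ON.compatible_def using st t(4,5) sb sigma_sqrt_m1[OF gal] by blast
  \<comment> \<open>The discrepancy between the two extensions is linear over the constants; the
    computations below identify it as the translation by \<open>(0, 0)\<close>.\<close>
  define T where "T = \<tau>\<sigma> \<circ> inv_into UNIV t"
  have tau: "semiaut emb \<sigma> \<tau>\<sigma>" "\<tau>\<sigma> x = x" "\<tau>\<sigma> y = y" by (rule tau[OF gal])+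
  interpret tt: fld_hom \<tau>\<sigma> using tau(1) by unfold_locales (simp add: semiaut_def)
  have te: "\<tau>\<sigma> (emb a) = emb (\<sigma> a)" for a using tau(1) by (simp add: semiaut_def)
  have sT: "semiaut emb id T"
  proof -
    have "\<sigma> \<circ> inv_into UNIV \<sigma> = id" using sigma_bij[OF gal] by (simp add: fun_eq_iff f_inv_into_f bij_is_surj)
    then show ?thesis unfolding T_def using semiaut_comp[OF tau(1) semiaut_inv[OF st]] by simp
  qed
  have it: "inv_into UNIV t N.x' = N.x'" "inv_into UNIV t N.y' = N.y'" "inv_into UNIV t \<circ> t = id"
    using t(2,4,5) inv_into_f_f[OF bij_is_inj[OF t(2)] UNIV_I] by (metis, metis, simp add: fun_eq_iff)
  have U: "x - emb (\<alpha> i0) \<noteq> 0" and X: "x - emb (\<alpha> d) \<noteq> 0" by (rule N.X_nz)+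
  have a0: "emb A \<noteq> 0" using A0 by simp
  have "\<tau>\<sigma> N.x' = - emb A' * (x - emb (\<alpha> d)) / (x - emb (\<alpha> i0))"
    unfolding x'_eq tt.divide tt.mult tt.uminus tt.diff te tau sA using sw d4 by simp
  also have "\<dots> = (emb A * emb A') / (- emb A * (x - emb (\<alpha> i0)) / (x - emb (\<alpha> d)))"
  proof -
    have "- a' * X / U = (a * a') / (- a * U / X)" if "a \<noteq> 0" "U \<noteq> 0" "X \<noteq> 0" for a a' U X :: 'f
      using that by (simp add: field_simps)
    from this[OF a0 U X] show ?thesis .
  qed
  finally have Tx: "T N.x' = emb (N.\<beta> k * N.\<beta> l) / N.x'"
    unfolding T_def comp_apply it(1) B F0.emb.mult x'_eq[symmetric] .
  have "\<tau>\<sigma> N.y' = emb s0 * (- emb (\<alpha> d - \<alpha> i0) * emb A') * y / (x - emb (\<alpha> i0)) ^ 2"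
    unfolding y'_eq tt.divide tt.mult tt.power tt.diff te tau sA s.diff using sw d4 sigma_K[OF gal s0(2)] by simp
  also have "\<dots> = - ((emb A * emb A') * (emb s0 * (emb (\<alpha> d - \<alpha> i0) * emb A) * y / (x - emb (\<alpha> d)) ^ 2)
      / (- emb A * (x - emb (\<alpha> i0)) / (x - emb (\<alpha> d))) ^ 2)"
  proof -
    have "q * (- r * a') * y / U ^ 2 = - ((a * a') * (q * (r * a) * y / X ^ 2) / (- a * U / X) ^ 2)"
      if "a \<noteq> 0" "U \<noteq> 0" "X \<noteq> 0" for a a' q r U X :: 'f
      using that by (simp add: power2_eq_square field_simps)
    from this[OF a0 U X] show ?thesis .
  qed
  finally have Ty: "T N.y' = - (emb (N.\<beta> k * N.\<beta> l) * N.y' / N.x' ^ 2)"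
    unfolding T_def comp_apply it(2) B F0.emb.mult x'_eq[symmetric] y'_eq[symmetric] .
  have "ON.principal (act \<tau>\<sigma> D - act t D)" if D: "ON.Div0 D" for D
  proof -
    have bT: "bij T" using sT by (simp add: semiaut_def)
    have "\<tau>\<sigma> = T \<circ> t" unfolding T_def comp_assoc it(3) by simp
    then have "act \<tau>\<sigma> D = act T (act t D)" using act_comp[OF t(2) bT] by metis
    then show ?thesis
      using translation_acts_trivially[OF ON.odd_model_axioms ne b0 sT Tx Ty ON.Div0_act[OF st D]] by simp
  qed
  moreover have "N.\<beta> j - N.\<beta> i = \<gamma> d \<alpha> i j" if "i \<in> {1..n}" "j \<in> {1..n}" "i \<noteq> j" for i j
    unfolding gamma_even[OF gal dn that] I[symmetric] using that N.beta_diff unfolding I[symmetric] by blast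
  ultimately show ?thesis unfolding has_model_def[OF gal] I[symmetric] using ON.odd_model_axioms comp by blast
qed

lemma has_model:
  assumes triv: "\<forall>C\<in>torsion emb 2. galois_act emb x y \<sigma> C = C"
  shows "has_model \<sigma>"
proof (cases "d = n")
  case True
  then show ?thesis using has_model_odd[OF gal] triv by blast
next
  case False
  then have dn: "d = Suc n" using d_cases by simp
  show ?thesis
    using permutation_cases[OF gal dn triv] has_model_even_fixed[OF gal dn] has_model_swap[OF dn] by blast
qed

lemma torsion_4_action:
  assumes triv: "\<forall>C\<in>torsion emb 2. galois_act emb x y \<sigma> C = C"
    and r: "\<forall>i j. 1 \<le> i \<and> i < j \<and> j \<le> n \<longrightarrow> r i j ^ 2 = \<gamma> d \<alpha> i j"
  shows "(\<forall>C\<in>torsion emb 4. galois_act emb x y \<sigma> C = C) \<longleftrightarrow>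
      (\<forall>i j. 1 \<le> i \<and> i < j \<and> j \<le> n \<longrightarrow> \<sigma> (r i j) = r i j)"
    and "(\<forall>C\<in>torsion emb 4. galois_act emb x y \<sigma> C = inv\<^bsub>jacobian emb\<^esub> C) \<Longrightarrow>
      (\<forall>i j. 1 \<le> i \<and> i < j \<and> j \<le> n \<longrightarrow> \<sigma> (r i j) = - r i j)"
proof -
  obtain b x' y' t where model: "odd_model {1..n} b emb x' y'" and comp: "odd_model.compatible {1..n} b emb x' y' \<sigma> t"
    and same: "\<And>D. func_field.Div0 emb D \<Longrightarrow> func_field.principal emb (act \<tau>\<sigma> D - act t D)"
    and diff: "\<And>i j. i \<in> {1..n} \<Longrightarrow> j \<in> {1..n} \<Longrightarrow> i \<noteq> j \<Longrightarrow> b j - b i = \<gamma> d \<alpha> i j"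
    using has_model[OF triv] unfolding has_model_def[OF gal] by blast
  interpret O: odd_model "{1..n}" b emb x' y' by (rule model)
  have rb: "r i j ^ 2 = b j - b i" if "1 \<le> i" "i < j" "j \<le> n" for i j
    using r diff[of i j] that by auto
  have main: "(\<forall>C\<in>torsion emb 4. galois_act emb x y \<sigma> C = C) \<longleftrightarrow>
      (\<forall>i\<in>{1..n}. \<forall>j\<in>{1..n}. \<forall>r. i \<noteq> j \<longrightarrow> r ^ 2 = b j - b i \<longrightarrow> \<sigma> r = r)"
    "(\<forall>C\<in>torsion emb 4. galois_act emb x y \<sigma> C = inv\<^bsub>jacobian emb\<^esub> C) \<Longrightarrow>
      (\<forall>i\<in>{1..n}. \<forall>j\<in>{1..n}. \<forall>r. i \<noteq> j \<longrightarrow> r ^ 2 = b j - b i \<longrightarrow> \<sigma> r = - r)"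
    by (rule O.galois_act_torsion_4[OF tau(1)[OF gal] comp]; use same in blast)+
  \<comment> \<open>Roots are given only for \<open>i < j\<close>. Reversing the indices changes the
    sign of the difference, so the root is multiplied by \<open>s0\<close>, which lies in
    \<open>K\<close>.\<close>
  have conv: "\<sigma> q = q" if R: "\<forall>i j. 1 \<le> i \<and> i < j \<and> j \<le> n \<longrightarrow> \<sigma> (r i j) = r i j"
    and ij: "i \<in> {1..n}" "j \<in> {1..n}" "i \<noteq> j" and q: "q ^ 2 = b j - b i" for i j q
  proof (cases "i < j")
    case True
    then have "q ^ 2 = r i j ^ 2" using rb[of i j] q ij by simp
    then have "q = r i j \<or> q = - r i j" by (simp add: power2_eq_iff)
    moreover have "\<sigma> (r i j) = r i j" using R True ij by simp
    ultimately show ?thesis by auto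
  next
    case False
    then have "q ^ 2 = (s0 * r j i) ^ 2" using rb[of j i] q ij s0(1) by (simp add: power_mult_distrib)
    then have "q = s0 * r j i \<or> q = - (s0 * r j i)" by (simp only: power2_eq_iff)
    moreover have "\<sigma> (s0 * r j i) = s0 * r j i" using R False ij sigma_K[OF gal s0(2)] by simp
    ultimately show ?thesis by auto
  qed
  show "(\<forall>C\<in>torsion emb 4. galois_act emb x y \<sigma> C = C) \<longleftrightarrow>
      (\<forall>i j. 1 \<le> i \<and> i < j \<and> j \<le> n \<longrightarrow> \<sigma> (r i j) = r i j)"
  proof
    assume "\<forall>C\<in>torsion emb 4. galois_act emb x y \<sigma> C = C"
    then have *: "\<And>i j q. i \<in> {1..n} \<Longrightarrow> j \<in> {1..n} \<Longrightarrow> i \<noteq> j \<Longrightarrow> q ^ 2 = b j - b i \<Longrightarrow> \<sigma> q = q"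
      using main(1) by blast
    show "\<forall>i j. 1 \<le> i \<and> i < j \<and> j \<le> n \<longrightarrow> \<sigma> (r i j) = r i j"
    proof (intro allI impI)
      fix i j assume "1 \<le> i \<and> i < j \<and> j \<le> n"
      then show "\<sigma> (r i j) = r i j" using *[of i j "r i j"] rb[of i j] by simp
    qed
  next
    assume "\<forall>i j. 1 \<le> i \<and> i < j \<and> j \<le> n \<longrightarrow> \<sigma> (r i j) = r i j"
    from conv[OF this] show "\<forall>C\<in>torsion emb 4. galois_act emb x y \<sigma> C = C"
      by (intro main(1)[THEN iffD2] ballI allI impI)
  qed
  show "\<forall>i j. 1 \<le> i \<and> i < j \<and> j \<le> n \<longrightarrow> \<sigma> (r i j) = - r i j"
    if neg: "\<forall>C\<in>torsion emb 4. galois_act emb x y \<sigma> C = inv\<^bsub>jacobian emb\<^esub> C"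
  proof (intro allI impI)
    fix i j assume ij: "1 \<le> i \<and> i < j \<and> j \<le> n"
    have *: "\<And>i j q. i \<in> {1..n} \<Longrightarrow> j \<in> {1..n} \<Longrightarrow> i \<noteq> j \<Longrightarrow> q ^ 2 = b j - b i \<Longrightarrow> \<sigma> q = - q"
      using main(2)[OF neg] by blast
    show "\<sigma> (r i j) = - r i j" using *[of i j "r i j"] rb[of i j] ij by simp
  qed
qed

text \<open>These statements depend on the curve only through \<open>emb\<close>, so any odd model
  may prove them, even when the Galois action does not respect its coordinates.\<close>

lemma jacobian_facts:
  shows "torsion emb m \<subseteq> carrier (jacobian emb)"
    and "torsion emb 2 \<subseteq> torsion emb 4"
    and "C \<in> carrier (jacobian emb) \<Longrightarrow> galois_act emb x y \<sigma> C \<in> carrier (jacobian emb)"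
    and "C \<in> torsion emb 2 \<Longrightarrow> inv\<^bsub>jacobian emb\<^esub> C = C"
proof -
  have "\<exists>b x' y'. odd_model {1..n} b emb x' y'"
  proof (cases "d = n")
    case True
    have "odd_model {1..n} \<alpha> emb x y"
    proof
      show "curve_function_field (\<Prod>i\<in>{1..n}. [:- \<alpha> i, 1:]) emb x y" using cff True by simp
      show "inj_on \<alpha> {1..n}" using inj True by simp
    qed (simp_all add: two n_def)
    then show ?thesis by blast
  next
    case False
    then have dn: "d = Suc n" using d_cases by simp
    show ?thesis using even_model.odd[OF even_model_I[OF gal dn refl]] by blast
  qed
  then obtain b x' y' where "odd_model {1..n} b emb x' y'" by blast
  then interpret O: odd_model "{1..n}" b emb x' y' .
  show "torsion emb m \<subseteq> carrier (jacobian emb)" by (auto simp: torsion_def)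
  show "torsion emb 2 \<subseteq> torsion emb 4" by (rule O.torsion_2_subset_4)
  show "galois_act emb x y \<sigma> C \<in> carrier (jacobian emb)" if "C \<in> carrier (jacobian emb)"
    using O.galois_act_carrier[OF tau(1)[OF gal] that] .
  show "inv\<^bsub>jacobian emb\<^esub> C = C" if "C \<in> torsion emb 2" using O.inv_torsion_2[OF that] .
qed

end

end

theorem theorem2p4:
  fixes d :: nat
    and \<iota> :: "complex \<Rightarrow> 'a::alg_closed_field"
    and \<alpha> :: "nat \<Rightarrow> 'a"
    and K K1 K2 :: "'a set"
    and emb :: "'a \<Rightarrow> 'f::field"
    and x y :: 'f
    and N :: nat
    and \<phi> :: "'f divisor set \<Rightarrow> nat \<Rightarrow> 'a"
    and r :: "nat \<Rightarrow> nat \<Rightarrow> 'a"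
  assumes "d \<ge> 3"
    and "field_hom \<iota>"
    and "alg_independent \<iota> \<alpha> {1..d}"
    and "K = sym_field \<iota> \<alpha> d"
    and "\<forall>a. is_algebraic_over K a"
    and "curve_function_field (\<Prod>i=1..d. [:- \<alpha> i, 1:]) emb x y"
    and "projective_jacobian K emb x y N \<phi>"
    and "K1 = coord_field K N \<phi> (torsion emb 2)"
    and "K2 = coord_field K N \<phi> (torsion emb 4)"
    and "\<forall>i j. 1 \<le> i \<and> i < j \<and> j \<le> 2 * genus d + 1 \<longrightarrow> r i j ^ 2 = \<gamma> d \<alpha> i j"
  shows "K2 = field_gen (K1 \<union> {r i j | i j. 1 \<le> i \<and> i < j \<and> j \<le> 2 * genus d + 1}) \<and>
    (\<forall>\<sigma>\<in>galois_group K.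
       (\<forall>P\<in>torsion emb 4. galois_act emb x y \<sigma> P = inv\<^bsub>jacobian emb\<^esub> P) \<longrightarrow>
         (\<forall>a\<in>K1. \<sigma> a = a) \<and>
         (\<forall>i j. 1 \<le> i \<and> i < j \<and> j \<le> 2 * genus d + 1 \<longrightarrow> \<sigma> (r i j) = - r i j))"
proof -
  interpret S: curve_setting d \<iota> \<alpha> K emb x y
    using assms(1,2,4,6) alg_independent_inj[OF assms(2,3)] by unfold_locales
  have n: "2 * genus d + 1 = S.n" by (simp only: S.n_def S.g_def)
  note r = assms(10)[unfolded n]
  have fix1: "(\<forall>a\<in>K1. \<sigma> a = a) \<longleftrightarrow> (\<forall>C\<in>torsion emb 2. galois_act emb x y \<sigma> C = C)" if "\<sigma> \<in> galois_group K" for \<sigma>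
    unfolding assms(8) by (rule coord_field_fixed_iff[OF that assms(7) S.jacobian_facts(1)[OF that]
      S.jacobian_facts(3)[OF that subsetD[OF S.jacobian_facts(1)[OF that]]]])
  have fix2: "(\<forall>a\<in>K2. \<sigma> a = a) \<longleftrightarrow> (\<forall>C\<in>torsion emb 4. galois_act emb x y \<sigma> C = C)" if "\<sigma> \<in> galois_group K" for \<sigma>
    unfolding assms(9) by (rule coord_field_fixed_iff[OF that assms(7) S.jacobian_facts(1)[OF that]
      S.jacobian_facts(3)[OF that subsetD[OF S.jacobian_facts(1)[OF that]]]])
  let ?R = "{r i j | i j. 1 \<le> i \<and> i < j \<and> j \<le> S.n}"
  let ?L = "field_gen (K1 \<union> ?R)"
  have fixL: "(\<forall>a\<in>?L. \<sigma> a = a) \<longleftrightarrow> (\<forall>a\<in>K1. \<sigma> a = a) \<and> (\<forall>i j. 1 \<le> i \<and> i < j \<and> j \<le> S.n \<longrightarrow> \<sigma> (r i j) = r i j)"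
    if "\<sigma> \<in> galois_group K" for \<sigma>
  proof
    assume "\<forall>a\<in>?L. \<sigma> a = a"
    then have "\<forall>a\<in>K1 \<union> ?R. \<sigma> a = a" using field_gen_subset[of "K1 \<union> ?R"] by blast
    then show "(\<forall>a\<in>K1. \<sigma> a = a) \<and> (\<forall>i j. 1 \<le> i \<and> i < j \<and> j \<le> S.n \<longrightarrow> \<sigma> (r i j) = r i j)" by blast
  next
    assume "(\<forall>a\<in>K1. \<sigma> a = a) \<and> (\<forall>i j. 1 \<le> i \<and> i < j \<and> j \<le> S.n \<longrightarrow> \<sigma> (r i j) = r i j)"
    then have "K1 \<union> ?R \<subseteq> {a. \<sigma> a = a}" by blast
    then have "?L \<subseteq> {a. \<sigma> a = a}"
      using that by (intro field_gen_minimal field_hom_fixed_subfield) (simp_all add: galois_group_def)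
    then show "\<forall>a\<in>?L. \<sigma> a = a" by blast
  qed
  have KK: "K \<subseteq> coord_field K N \<phi> T" for T
    unfolding coord_field_def by (rule order_trans[OF Un_upper1 field_gen_subset])
  have sub: "is_subfield (coord_field K N \<phi> T)" for T unfolding coord_field_def by (rule is_subfield_field_gen)
  have "K2 = ?L"
  proof (rule galois_fixed_eqI[of K2 K ?L])
    show "is_subfield K2" "K \<subseteq> K2" unfolding assms(9) by (rule sub, rule KK)
    show "is_subfield ?L" by (rule is_subfield_field_gen)
    have "K \<subseteq> K1" unfolding assms(8) by (rule KK)
    then show "K \<subseteq> ?L" using field_gen_subset[of "K1 \<union> ?R"] by blast
    show "is_algebraic_over K a" for a using assms(5) by blast
    show "(of_nat m :: 'a) \<noteq> 0" if "0 < m" for m :: nat by (rule field_hom_complex_char_0[OF assms(2) that])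
    fix \<sigma> assume s: "\<sigma> \<in> galois_group K"
    show "(\<forall>a\<in>K2. \<sigma> a = a) \<longleftrightarrow> (\<forall>a\<in>?L. \<sigma> a = a)"
    proof (cases "\<forall>C\<in>torsion emb 2. galois_act emb x y \<sigma> C = C")
      case True
      then show ?thesis unfolding fixL[OF s] fix1[OF s] fix2[OF s] S.torsion_4_action(1)[OF s True r] by simp
    next
      \<comment> \<open>A nontrivial action on two-torsion moves both \<open>K1\<close> and
        four-torsion, so neither side holds.\<close>
      case False
      then show ?thesis unfolding fixL[OF s] fix1[OF s] fix2[OF s] using S.jacobian_facts(2)[OF s] by blast
    qed
  qed
  moreover have "(\<forall>a\<in>K1. \<sigma> a = a) \<and> (\<forall>i j. 1 \<le> i \<and> i < j \<and> j \<le> S.n \<longrightarrow> \<sigma> (r i j) = - r i j)"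
    if s: "\<sigma> \<in> galois_group K" and neg: "\<forall>P\<in>torsion emb 4. galois_act emb x y \<sigma> P = inv\<^bsub>jacobian emb\<^esub> P" for \<sigma>
  proof -
    \<comment> \<open>On two-torsion multiplication by -1 is the identity.\<close>
    have triv: "\<forall>C\<in>torsion emb 2. galois_act emb x y \<sigma> C = C"
    proof
      fix C assume C: "C \<in> torsion emb 2"
      then have "C \<in> torsion emb 4" using S.jacobian_facts(2)[OF s] by blast
      then have "galois_act emb x y \<sigma> C = inv\<^bsub>jacobian emb\<^esub> C" using neg by blast
      then show "galois_act emb x y \<sigma> C = C" using S.jacobian_facts(4)[OF s C] by simp
    qed
    show ?thesis using fix1[OF s] triv S.torsion_4_action(2)[OF s triv r neg] by blast
  qed
  ultimately show ?thesis unfolding n by blast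
qed

end
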